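(* Let $m_1,m_2,m_3,m_4>0$ be arbitrary masses. Then the regular tetrahedron belongs to at least three one-parameter families (parametrized up to rotation and scaling; i.e. non-trivial families of pairwise non-similar configurations, forming curves through the regular tetrahedron in the space of similarity classes) of four-body balanced configurations which admit a relative equilibrium motion in $\mathbb{R}^4$. If no three of the four masses are equal, there are, in a neighbourhood of the regular tetrahedron, exactly three such families.
   Context: Setting: $n=4$ bodies with positive masses $m_1,\dots,m_4$. Let $\mathcal D^*=\{\xi\in\mathbb R^4:\sum_i\xi_i=0\}$ with the Euclidean inner product $\langle\xi,\eta\rangle=\sum_i \xi_i\eta_i/m_i$ ("symmetric" for endomorphisms of $\mathcal D^*$ refers to it); $(e_i)$ is the standard basis of $\mathbb R^4$. A configuration $x=(\vec r_1,\dots,\vec r_4)$ in a Euclidean space $E$, up to translation, is identified with the linear map $x:\mathcal D^*\to E$, $\xi\mapsto\sum\xi_i\vec r_i$; only non-collision configurations ($r_{ij}=|\vec r_i-\vec r_j|>0$ for $i\neq j$) are considered. Put $s_{ij}=r_{ij}^2$. The intrinsic inertia endomorphism $B$ of $x$ is the symmetric endomorphism of $\mathcal D^*$ with $\langle B\xi,\eta\rangle=\langle x(\xi),x(\eta)\rangle_E$; it determines $x$ up to isometry. Let $\Phi(s)=\mathcal G s^{-1/2}$ ($\mathcal G>0$) and $\varphi=\Phi'$. The Wintner–Conley endomorphism is the symmetric endomorphism $A\xi=\sum_{i<j}\varphi(s_{ij})(m_j\xi_i-m_i\xi_j)(e_i-e_j)$ of $\mathcal D^*$; Newton's equations read $\ddot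 x=2x\circ A$. The configuration is balanced if $AB=BA$. A relative equilibrium motion of $x$ in a Euclidean space $E$ is a solution of Newton's equations of the form $x(t)=e^{\Omega t}x$ with $\Omega$ a constant antisymmetric endomorphism of $E$ ($x$ being placed isometrically in $E$). The regular tetrahedron is the configuration with all $r_{ij}$ equal; it is the unique non-planar central configuration of four bodies. *)

theory Defs
  imports "HOL-Analysis.Analysis"
begin

text \<open>
  Four bodies are indexed by the type \<^typ>\<open>4\<close>; a configuration in a Euclidean space
  \<open>'e\<close> is an element of \<open>'e^4\<close>, and \<^typ>\<open>real^4\<close> carries masses and codispositions.
\<close>

section \<open>Codispositions and configurations\<close>

definition codisp :: "(real^4) set" where
  "codisp = {\<xi>. (\<Sum>i\<in>UNIV. \<xi> $ i) = 0}"

definition codisp_inner :: "real^4 \<Rightarrow> real^4 \<Rightarrow> real^4 \<Rightarrow> real" where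
  "codisp_inner m \<xi> \<eta> = (\<Sum>i\<in>UNIV. \<xi> $ i * \<eta> $ i / m $ i)"

text \<open>The linear map attached to a configuration; on \<^const>\<open>codisp\<close> it depends on the
  positions only up to translation.\<close>

definition config_map :: "'e::real_vector^4 \<Rightarrow> real^4 \<Rightarrow> 'e" where
  "config_map x \<xi> = (\<Sum>i\<in>UNIV. \<xi> $ i *\<^sub>R x $ i)"

definition sq_dist :: "'e::metric_space^4 \<Rightarrow> 4 \<Rightarrow> 4 \<Rightarrow> real" where
  "sq_dist x i j = (dist (x $ i) (x $ j))\<^sup>2"

definition noncollision :: "'e^4 \<Rightarrow> bool" where
  "noncollision x \<longleftrightarrow> (\<forall>i j. i \<noteq> j \<longrightarrow> x $ i \<noteq> x $ j)"

definition regular_tetrahedron :: "'e::metric_space^4 \<Rightarrow> bool" where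
  "regular_tetrahedron x \<longleftrightarrow> (\<exists>d>0. \<forall>i j. i \<noteq> j \<longrightarrow> dist (x $ i) (x $ j) = d)"

text \<open>Similarity includes reflections: shapes are classified by the inertia endomorphism up to a
  scale factor, and this endomorphism determines a configuration up to isometry.\<close>

definition similar_config :: "'e::real_inner^4 \<Rightarrow> 'e^4 \<Rightarrow> bool" where
  "similar_config x y \<longleftrightarrow>
     (\<exists>c>0. \<exists>f b. orthogonal_transformation f \<and> (\<forall>i. y $ i = c *\<^sub>R f (x $ i) + b))"

section \<open>Inertia and Wintner-Conley endomorphisms\<close>

text \<open>The defining property forces linearity and symmetry; existence and uniqueness are proved
  in \<open>inertia_endo_ex1\<close> below. Values outside \<^const>\<open>codisp\<close> are \<open>undefined\<close>.\<close>

definition inertia_endo :: "real^4 \<Rightarrow> 'e::real_inner^4 \<Rightarrow> real^4 \<Rightarrow> real^4" where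
  "inertia_endo m x = (THE B. B \<in> codisp \<rightarrow>\<^sub>E codisp \<and>
     (\<forall>\<xi>\<in>codisp. \<forall>\<eta>\<in>codisp.
        codisp_inner m (B \<xi>) \<eta> = config_map x \<xi> \<bullet> config_map x \<eta>))"

definition potential_fun :: "real \<Rightarrow> real \<Rightarrow> real" where
  "potential_fun G s = G * s powr (- 1 / 2)"

definition force_fun :: "real \<Rightarrow> real \<Rightarrow> real" where
  "force_fun G = deriv (potential_fun G)"

definition wintner_conley :: "real \<Rightarrow> real^4 \<Rightarrow> 'e::metric_space^4 \<Rightarrow> real^4 \<Rightarrow> real^4" where
  "wintner_conley G m x \<xi> =
     (\<Sum>i\<in>UNIV. \<Sum>j\<in>{i<..}.
        (force_fun G (sq_dist x i j) * (m $ j * \<xi> $ i - m $ i * \<xi> $ j)) *\<^sub>R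
          (axis i 1 - axis j 1))"

definition balanced :: "real \<Rightarrow> real^4 \<Rightarrow> 'e::real_inner^4 \<Rightarrow> bool" where
  "balanced G m x \<longleftrightarrow>
     (\<forall>\<xi>\<in>codisp. wintner_conley G m x (inertia_endo m x \<xi>)
                 = inertia_endo m x (wintner_conley G m x \<xi>))"

section \<open>Relative equilibria\<close>

text \<open>Newton's equations for the configuration up to translation: both derivatives are taken of
  the maps \<open>t \<mapsto> x(t)(\<xi>)\<close> for \<open>\<xi>\<close> in \<^const>\<open>codisp\<close>.\<close>

definition newton_solution ::
    "real \<Rightarrow> real^4 \<Rightarrow> (real \<Rightarrow> 'e::real_inner^4) \<Rightarrow> bool" where
  "newton_solution G m X \<longleftrightarrow>
     (\<forall>t. noncollision (X t)) \<and>
     (\<exists>V. \<forall>t. \<forall>\<xi>\<in>codisp.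
        ((\<lambda>u. config_map (X u) \<xi>) has_vector_derivative V t \<xi>) (at t) \<and>
        ((\<lambda>u. V u \<xi>) has_vector_derivative
           2 *\<^sub>R config_map (X t) (wintner_conley G m (X t) \<xi>)) (at t))"

definition antisymmetric_endo :: "('e::real_inner \<Rightarrow> 'e) \<Rightarrow> bool" where
  "antisymmetric_endo \<Omega> \<longleftrightarrow> linear \<Omega> \<and> (\<forall>u v. \<Omega> u \<bullet> v = - (u \<bullet> \<Omega> v))"

text \<open>The library exponential needs a type that is a Banach algebra, which endomorphisms are
  not; hence the exponential series applied to a vector.\<close>

definition endo_exp :: "('e::real_normed_vector \<Rightarrow> 'e) \<Rightarrow> 'e \<Rightarrow> 'e" where
  "endo_exp \<Omega> v = (\<Sum>k. (1 / fact k) *\<^sub>R (\<Omega> ^^ k) v)"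

definition relative_equilibrium_motion ::
    "real \<Rightarrow> real^4 \<Rightarrow> 'e::euclidean_space^4 \<Rightarrow> (real \<Rightarrow> 'e^4) \<Rightarrow> bool" where
  "relative_equilibrium_motion G m y X \<longleftrightarrow>
     (\<exists>\<Omega>. antisymmetric_endo \<Omega> \<and>
          (\<forall>t. X t = (\<chi> i. endo_exp (\<lambda>v. t *\<^sub>R \<Omega> v) (y $ i)))) \<and>
     newton_solution G m X"

definition admits_relative_equilibrium_R4 :: "real \<Rightarrow> real^4 \<Rightarrow> real^3^4 \<Rightarrow> bool" where
  "admits_relative_equilibrium_R4 G m x \<longleftrightarrow>
     (\<exists>(\<iota> :: real^3 \<Rightarrow> real^4) X. linear \<iota> \<and> (\<forall>v. norm (\<iota> v) = norm v) \<and>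
        relative_equilibrium_motion G m (\<chi> i. \<iota> (x $ i)) X)"

definition balanced_RE4 :: "real \<Rightarrow> real^4 \<Rightarrow> real^3^4 \<Rightarrow> bool" where
  "balanced_RE4 G m x \<longleftrightarrow>
     noncollision x \<and> balanced G m x \<and> admits_relative_equilibrium_R4 G m x"

section \<open>One-parameter families through a configuration\<close>

text \<open>Pairwise non-similarity on the compact interval makes \<open>\<gamma>\<close> induce a simple arc in the space
  of similarity classes, having the class of \<open>T\<close> as an interior point.\<close>

definition family_through :: "real \<Rightarrow> real^4 \<Rightarrow> real^3^4 \<Rightarrow> (real \<Rightarrow> real^3^4) \<Rightarrow> bool" where
  "family_through G m T \<gamma> \<longleftrightarrow>
     continuous_on {-1..1} \<gamma> \<and> \<gamma> 0 = T \<and>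
     (\<forall>s\<in>{-1..1}. balanced_RE4 G m (\<gamma> s)) \<and>
     (\<forall>s\<in>{-1..1}. \<forall>t\<in>{-1..1}. s \<noteq> t \<longrightarrow> \<not> similar_config (\<gamma> s) (\<gamma> t))"

text \<open>Families count as distinct only if they have no similarity class but that of \<open>T\<close> in
  common, so that one curve cannot be counted twice, and no additional family arises by joining
  halves of families already counted.\<close>

definition distinct_families ::
    "real \<Rightarrow> real^4 \<Rightarrow> real^3^4 \<Rightarrow> nat \<Rightarrow> (nat \<Rightarrow> real \<Rightarrow> real^3^4) \<Rightarrow> bool" where
  "distinct_families G m T n \<gamma> \<longleftrightarrow>
     (\<forall>k<n. family_through G m T (\<gamma> k)) \<and>
     (\<forall>k<n. \<forall>l<n. k \<noteq> l \<longrightarrow>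
        (\<forall>s\<in>{-1..1}. \<forall>t\<in>{-1..1}.
           similar_config (\<gamma> k s) (\<gamma> l t) \<longrightarrow> s = 0 \<and> t = 0))"

section \<open>Well-definedness\<close>

lemma codisp_inner_nondegenerate:
  assumes m: "\<And>i. m $ i > 0" and "\<xi> \<in> codisp" "\<xi>' \<in> codisp"
    and eq: "\<And>\<eta>. \<eta> \<in> codisp \<Longrightarrow> codisp_inner m \<xi> \<eta> = codisp_inner m \<xi>' \<eta>"
  shows "\<xi> = \<xi>'"
proof -
  have d: "\<xi> - \<xi>' \<in> codisp"
    using assms by (simp add: codisp_def sum_subtractf)
  have "codisp_inner m (\<xi> - \<xi>') (\<xi> - \<xi>') = 0"
    using eq[OF d] by (simp add: codisp_inner_def left_diff_distrib diff_divide_distrib sum_subtractf)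
  then have "\<forall>i. (\<xi> - \<xi>') $ i * (\<xi> - \<xi>') $ i / m $ i = 0"
    unfolding codisp_inner_def
    by (subst (asm) sum_nonneg_eq_0_iff) (auto simp: m less_imp_le)
  then show ?thesis
    using m by (auto simp: vec_eq_iff) (metis less_irrefl)
qed

lemma inertia_endo_ex1:
  fixes x :: "'e::real_inner^4"
  assumes m: "\<And>i. m $ i > 0"
  shows "\<exists>!B. B \<in> codisp \<rightarrow>\<^sub>E codisp \<and>
     (\<forall>\<xi>\<in>codisp. \<forall>\<eta>\<in>codisp.
        codisp_inner m (B \<xi>) \<eta> = config_map x \<xi> \<bullet> config_map x \<eta>)"
proof -
  define M where "M = (\<Sum>i\<in>UNIV. m $ i)"
  have M: "M > 0" unfolding M_def by (intro sum_pos) (auto simp: m)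
  define c where "c \<xi> = (\<Sum>i\<in>UNIV. m $ i * (x $ i \<bullet> config_map x \<xi>)) / M" for \<xi>
  define B0 :: "real^4 \<Rightarrow> real^4" where
    "B0 \<xi> = (\<chi> i. m $ i * (x $ i \<bullet> config_map x \<xi> - c \<xi>))" for \<xi>
  have "B0 \<xi> \<in> codisp" for \<xi>
  proof -
    have "(\<Sum>i\<in>UNIV. B0 \<xi> $ i) = (\<Sum>i\<in>UNIV. m $ i * (x $ i \<bullet> config_map x \<xi>)) - M * c \<xi>"
      by (simp add: B0_def right_diff_distrib sum_subtractf M_def sum_distrib_right)
    then show ?thesis
      using M by (simp add: codisp_def c_def)
  qed
  moreover have "codisp_inner m (B0 \<xi>) \<eta> = config_map x \<xi> \<bullet> config_map x \<eta>"
    if "\<eta> \<in> codisp" for \<xi> \<eta>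
  proof -
    have "m $ i * a * b / m $ i = a * b" for i a b
      using m[of i] by simp
    then have "codisp_inner m (B0 \<xi>) \<eta>
        = (\<Sum>i\<in>UNIV. (x $ i \<bullet> config_map x \<xi> - c \<xi>) * \<eta> $ i)"
      unfolding codisp_inner_def B0_def vec_lambda_beta by (rule sum.cong[OF refl])
    also have "\<dots> = (\<Sum>i\<in>UNIV. \<eta> $ i * (x $ i \<bullet> config_map x \<xi>)) - c \<xi> * (\<Sum>i\<in>UNIV. \<eta> $ i)"
      by (simp add: algebra_simps sum_subtractf sum_distrib_left)
    also have "\<dots> = config_map x \<eta> \<bullet> config_map x \<xi>"
      using that by (simp add: codisp_def config_map_def[of x \<eta>] inner_sum_left)
    finally show ?thesis by (simp add: inner_commute)
  qed
  ultimately have ex: "restrict B0 codisp \<in> codisp \<rightarrow>\<^sub>E codisp \<and>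
     (\<forall>\<xi>\<in>codisp. \<forall>\<eta>\<in>codisp.
        codisp_inner m (restrict B0 codisp \<xi>) \<eta> = config_map x \<xi> \<bullet> config_map x \<eta>)"
    by auto
  show ?thesis
  proof (rule ex1I[of _ "restrict B0 codisp"])
    fix B
    assume B: "B \<in> codisp \<rightarrow>\<^sub>E codisp \<and> (\<forall>\<xi>\<in>codisp. \<forall>\<eta>\<in>codisp.
        codisp_inner m (B \<xi>) \<eta> = config_map x \<xi> \<bullet> config_map x \<eta>)"
    show "B = restrict B0 codisp"
    proof (rule PiE_ext[of _ codisp "\<lambda>_. codisp"])
      fix \<xi> :: "real^4" assume \<xi>: "\<xi> \<in> codisp"
      show "B \<xi> = restrict B0 codisp \<xi>"
        by (rule codisp_inner_nondegenerate[OF m]) (use B ex \<xi> in auto)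
    qed (use B ex in auto)
  qed (rule ex)
qed

lemma wintner_conley_codisp: "wintner_conley G m x \<xi> \<in> codisp"
proof -
  have ax: "(\<Sum>k\<in>UNIV. (axis i 1 :: real^4) $ k) = 1" for i
    by (simp add: axis_def)
  have sub: "subspace codisp"
    by (auto simp: subspace_def codisp_def sum.distrib simp flip: sum_distrib_left)
  have "(axis i 1 - axis j 1 :: real^4) \<in> codisp" for i j
    by (simp add: codisp_def sum_subtractf ax)
  then show ?thesis
    unfolding wintner_conley_def by (intro subspace_sum subspace_scale sub)
qed

end

theory Submission
  imports Defs
begin

text \<open>
  A relative equilibrium in 4-space turns in two orthogonal planes. A spatial configuration spans a
  hyperplane, so the square of the generator has a double eigenvalue there, and the
  Wintner-Conley endomorphism \<open>A\<close> is a scalar plus a rank one term \<open>b \<langle>w, \<cdot>\<rangle> w\<close>; moreover \<open>w\<close> is an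
  eigenvector of the inertia endomorphism \<open>B\<close>. Conversely, if \<open>A\<close> has this form and \<open>w\<close> is an
  eigenvector of \<open>B\<close>, then \<open>A\<close> and \<open>B\<close> commute, and since attraction makes \<open>A\<close> negative a generator
  can be written down
  (\<open>relative_equilibrium_forces\<close>, \<open>balanced_RE4_of_shape\<close>). Put \<open>w\<^sub>i = m\<^sub>i p\<^sub>i\<close>, so that
  \<open>\<Sum> m\<^sub>i p\<^sub>i = 0\<close>. The rank one condition says that, up to scale,
  \<open>s\<^sub>i\<^sub>j = (1 + \<beta> p\<^sub>i p\<^sub>j) powr (-2/3)\<close> for \<open>i \<noteq> j\<close>; this is \<open>shape \<beta> p\<close>. The eigenvector
  condition says that \<open>\<Sum>\<^sub>j s\<^sub>i\<^sub>j m\<^sub>j p\<^sub>j\<close> is an affine function of \<open>p\<^sub>i\<close>; this is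
  \<open>eigen_direction\<close>. Only the products \<open>\<beta> p\<^sub>i p\<^sub>j\<close> matter, and they are determined by the
  similarity class (\<open>shape_unique\<close>). The regular tetrahedron is \<open>\<beta> = 0\<close>.

  At \<open>\<beta> = 0\<close> the eigenvector condition is the eigenvalue problem of the form
  \<open>\<Sum> m\<^sub>i\<^sup>2 p\<^sub>i\<^sup>2\<close> relative to \<open>\<Sum> m\<^sub>i p\<^sub>i\<^sup>2\<close> on the three-dimensional space \<open>\<Sum> m\<^sub>i p\<^sub>i = 0\<close>.
  When no three masses are equal its three eigenvalues are distinct (\<open>inertia_frame_exists\<close>).
  In the chart \<open>p = v\<^sub>k + \<Sum>\<^sub>l\<^sub>\<noteq>\<^sub>k a\<^sub>l v\<^sub>l\<close>, \<open>\<bar>a\<^sub>l\<bar> \<le> 1\<close>, around the eigenvector \<open>v\<^sub>k\<close>, the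
  equation for small \<open>\<beta>\<close> is a fixed point problem
  \<open>(\<Lambda>\<^sub>k - \<Lambda>\<^sub>l) a\<^sub>l = O(\<beta>)\<close> whose right-hand side is also \<open>O(\<beta>)\<close>-Lipschitz, hence a contraction
  of the whole chart: exactly one solution for each \<open>\<beta>\<close>, continuous in \<open>\<beta>\<close> (\<open>branch\<close>). Dividing by
  a coordinate of largest modulus puts every direction into one of the three charts, so the three
  branches exhaust the relative equilibria near the tetrahedron (\<open>three_families_generic\<close>).

  When three masses are equal, each of the three pairs among them yields the explicit solution
  \<open>p = e\<^sub>a - e\<^sub>b\<close>: only the distance between \<open>a\<close> and \<open>b\<close> is changed
  (\<open>three_families_equal_masses\<close>).
\<close>

section \<open>Codispositions, similarity and the force law\<close>

lemma codisp_iff: "\<xi> \<in> codisp \<longleftrightarrow> (\<Sum>i\<in>UNIV. \<xi> $ i) = 0"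
  by (simp add: codisp_def)

lemma subspace_codisp: "subspace codisp"
  by (auto simp: subspace_def codisp_def sum.distrib simp flip: sum_distrib_left)

lemma dim_codisp: "dim codisp = 3"
proof -
  have "codisp = {x :: real^4. 1 \<bullet> x = 0}"
    by (simp add: codisp_def inner_vec_def)
  then show ?thesis
    using dim_hyperplane[of "1 :: real^4"] by simp
qed

lemma linear_config_map: "linear (config_map x)"
  unfolding config_map_def
  by (rule linearI) (simp_all add: scaleR_left_distrib sum.distrib scaleR_sum_right)

lemma config_map_axis_diff: "config_map x (axis i 1 - axis j 1) = x $ i - x $ j"
proof -
  have "config_map x (axis k 1) = x $ k" for k
    unfolding config_map_def by (simp add: axis_def if_distrib[of "\<lambda>c. c *\<^sub>R _"] cong: if_cong)
  then show ?thesis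
    by (simp add: linear_diff[OF linear_config_map])
qed

lemma axis_diff_codisp: "axis i 1 - axis j 1 \<in> codisp"
  by (simp add: codisp_def sum_subtractf axis_def)

lemma sum_axis_diff: "(\<Sum>k\<in>UNIV. f k * (axis i 1 - axis j 1 :: real^4) $ k) = f i - f j"
  by (simp add: right_diff_distrib sum_subtractf axis_def if_distrib[of "\<lambda>c. _ * c"] cong: if_cong)

text \<open>A vector orthogonal to all codispositions has equal components.\<close>

lemma codisp_orthogonal_const:
  assumes "\<And>\<xi>. \<xi> \<in> codisp \<Longrightarrow> (\<Sum>i\<in>UNIV. f i * \<xi> $ i) = 0"
  shows "f i = f j"
  using assms[OF axis_diff_codisp[of i j]] unfolding sum_axis_diff by simp

lemma sq_dist_same [simp]: "sq_dist x i i = 0"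
  by (simp add: sq_dist_def)

lemma sq_dist_commute: "sq_dist x i j = sq_dist x j i"
  by (simp add: sq_dist_def dist_commute)

text \<open>The inertia form is determined by the mutual distances.\<close>

lemma config_map_inner:
  fixes x :: "'e::real_inner^4"
  assumes \<xi>: "\<xi> \<in> codisp" and \<eta>: "\<eta> \<in> codisp"
  shows "config_map x \<xi> \<bullet> config_map x \<eta> =
    - (\<Sum>i\<in>UNIV. \<Sum>j\<in>UNIV. sq_dist x i j * \<xi> $ i * \<eta> $ j) / 2"
proof -
  have "sq_dist x i j = x $ i \<bullet> x $ i + x $ j \<bullet> x $ j - 2 * (x $ i \<bullet> x $ j)" for i j
    by (simp add: sq_dist_def dist_norm power2_norm_eq_inner algebra_simps inner_commute)
  then have "sq_dist x i j * \<xi> $ i * \<eta> $ j = (x $ i \<bullet> x $ i) * \<xi> $ i * \<eta> $ j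
      + (x $ j \<bullet> x $ j) * \<xi> $ i * \<eta> $ j - 2 * ((x $ i \<bullet> x $ j) * \<xi> $ i * \<eta> $ j)" for i j
    by (simp add: left_diff_distrib distrib_right)
  then have "(\<Sum>i\<in>UNIV. \<Sum>j\<in>UNIV. sq_dist x i j * \<xi> $ i * \<eta> $ j) =
     (\<Sum>i\<in>UNIV. \<Sum>j\<in>UNIV. (x $ i \<bullet> x $ i) * \<xi> $ i * \<eta> $ j)
     + (\<Sum>i\<in>UNIV. \<Sum>j\<in>UNIV. (x $ j \<bullet> x $ j) * \<xi> $ i * \<eta> $ j)
     - 2 * (\<Sum>i\<in>UNIV. \<Sum>j\<in>UNIV. (x $ i \<bullet> x $ j) * \<xi> $ i * \<eta> $ j)"
    by (simp only: sum.distrib sum_subtractf sum_distrib_left)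
  also have "(\<Sum>i\<in>UNIV. \<Sum>j\<in>UNIV. (x $ i \<bullet> x $ i) * \<xi> $ i * \<eta> $ j) = 0"
    using \<eta> by (simp add: codisp_iff flip: sum_distrib_left)
  also have "(\<Sum>i\<in>UNIV. \<Sum>j\<in>UNIV. (x $ j \<bullet> x $ j) * \<xi> $ i * \<eta> $ j) =
      (\<Sum>j\<in>UNIV. \<Sum>i\<in>UNIV. (x $ j \<bullet> x $ j) * \<eta> $ j * \<xi> $ i)"
    by (subst sum.swap) (simp add: algebra_simps)
  also have "\<dots> = 0"
    using \<xi> by (simp add: codisp_iff flip: sum_distrib_left)
  also have "(\<Sum>i\<in>UNIV. \<Sum>j\<in>UNIV. (x $ i \<bullet> x $ j) * \<xi> $ i * \<eta> $ j) = config_map x \<xi> \<bullet> config_map x \<eta>"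
    unfolding config_map_def inner_sum_left by (simp add: inner_sum_right mult_ac sum_distrib_left)
  finally show ?thesis by simp
qed

text \<open>At equal distances the inertia form is a multiple of \<open>\<Sum> \<xi>\<^sub>i\<^sup>2\<close>; it stays positive definite under a
  relative perturbation of the squared distances by one eighth.\<close>

lemma nearly_regular_inj:
  fixes x :: "'e::real_inner^4"
  assumes s: "s > 0" and near: "\<And>i j. i \<noteq> j \<Longrightarrow> \<bar>sq_dist x i j - s\<bar> \<le> s / 8"
    and \<xi>: "\<xi> \<in> codisp" and 0: "config_map x \<xi> = 0"
  shows "\<xi> = 0"
proof -
  let ?d = "\<lambda>i j. if i = j then 0 else sq_dist x i j - s"
  have "0 = (\<Sum>i\<in>UNIV. \<Sum>j\<in>UNIV. sq_dist x i j * \<xi> $ i * \<xi> $ j)"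
    using config_map_inner[OF \<xi> \<xi>, of x] 0 by simp
  also have "\<dots> = (\<Sum>i\<in>UNIV. \<Sum>j\<in>UNIV. ?d i j * \<xi> $ i * \<xi> $ j + s * \<xi> $ i * \<xi> $ j
        - (if i = j then s * (\<xi> $ i)\<^sup>2 else 0))"
    by (intro sum.cong refl) (auto simp: algebra_simps power2_eq_square)
  also have "\<dots> = (\<Sum>i\<in>UNIV. \<Sum>j\<in>UNIV. ?d i j * \<xi> $ i * \<xi> $ j) - s * (\<Sum>i\<in>UNIV. (\<xi> $ i)\<^sup>2)"
    using \<xi> by (simp only: sum.distrib sum_subtractf)
      (simp add: codisp_iff flip: sum_distrib_left)
  finally have eq: "s * (\<Sum>i\<in>UNIV. (\<xi> $ i)\<^sup>2) = (\<Sum>i\<in>UNIV. \<Sum>j\<in>UNIV. ?d i j * \<xi> $ i * \<xi> $ j)"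
    by simp
  have "?d i j * \<xi> $ i * \<xi> $ j \<le> s / 8 * (\<bar>\<xi> $ i\<bar> * \<bar>\<xi> $ j\<bar>)" for i j
  proof -
    have "\<bar>?d i j\<bar> * (\<bar>\<xi> $ i\<bar> * \<bar>\<xi> $ j\<bar>) \<le> s / 8 * (\<bar>\<xi> $ i\<bar> * \<bar>\<xi> $ j\<bar>)"
      using near[of i j] s by (intro mult_right_mono) auto
    moreover have "?d i j * \<xi> $ i * \<xi> $ j \<le> \<bar>?d i j\<bar> * (\<bar>\<xi> $ i\<bar> * \<bar>\<xi> $ j\<bar>)"
      using abs_ge_self[of "?d i j * \<xi> $ i * \<xi> $ j"] by (simp only: abs_mult mult.assoc)
    ultimately show ?thesis by linarith
  qed
  then have "(\<Sum>i\<in>UNIV. \<Sum>j\<in>UNIV. ?d i j * \<xi> $ i * \<xi> $ j) \<le>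
      (\<Sum>i\<in>UNIV. \<Sum>j\<in>UNIV. s / 8 * (\<bar>\<xi> $ i\<bar> * \<bar>\<xi> $ j\<bar>))"
    by (intro sum_mono)
  also have "\<dots> = s / 8 * (\<Sum>i\<in>UNIV. \<bar>\<xi> $ i\<bar>)\<^sup>2"
    unfolding power2_eq_square sum_product unfolding sum_distrib_left ..
  also have "\<dots> \<le> s / 8 * (4 * (\<Sum>i\<in>UNIV. (\<xi> $ i)\<^sup>2))"
    using s sum_squared_le_sum_of_squares[of "\<lambda>i. \<bar>\<xi> $ i\<bar>" UNIV]
    by (intro mult_left_mono) (auto simp: mult.commute)
  finally have "s * (\<Sum>i\<in>UNIV. (\<xi> $ i)\<^sup>2) \<le> 0"
    unfolding eq[symmetric] by simp
  then have "(\<Sum>i\<in>UNIV. (\<xi> $ i)\<^sup>2) = 0"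
    using s by (simp add: mult_le_0_iff sum_nonneg antisym)
  then show ?thesis
    by (simp add: sum_nonneg_eq_0_iff vec_eq_iff)
qed

text \<open>The configuration spans space, that is, its inertia form is positive definite.\<close>

definition spatial :: "real^3^4 \<Rightarrow> bool" where
  "spatial x \<longleftrightarrow> (\<forall>\<xi>\<in>codisp. config_map x \<xi> = 0 \<longrightarrow> \<xi> = 0)"

lemma spatial_surj:
  assumes "spatial x"
  shows "config_map x ` codisp = UNIV"
proof -
  have "inj_on (config_map x) (span codisp)"
    using assms subspace_codisp
    by (simp add: linear_inj_on_span_iff_independent_image linear_config_map inj_on_def)
       (metis (no_types, lifting) eq_iff_diff_eq_0 linear_config_map linear_diff spatial_def span_eq_iff subspace_codisp subspace_diff)
  then have "dim (config_map x ` codisp) = 3"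
    using dim_image_eq[OF linear_config_map] dim_codisp by metis
  then have "span (config_map x ` codisp) = UNIV"
    using dim_eq_full[of "config_map x ` codisp"] by simp
  then show ?thesis
    using linear_subspace_image[OF linear_config_map subspace_codisp] by (metis span_eq_iff)
qed

lemma similar_config_sq_dist:
  assumes "similar_config x y"
  obtains c where "c > 0" "\<And>i j. sq_dist y i j = c * sq_dist x i j"
proof -
  from assms obtain c f b where c: "c > 0" "orthogonal_transformation f"
    "\<And>i. y $ i = c *\<^sub>R f (x $ i) + b"
    unfolding similar_config_def by blast
  have "sq_dist y i j = c\<^sup>2 * sq_dist x i j" for i j
  proof -
    have "y $ i - y $ j = c *\<^sub>R f (x $ i - x $ j)"
      by (simp add: c(3) linear_diff orthogonal_transformation_linear c(2) algebra_simps)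
    then show ?thesis
      using c(1) by (simp add: sq_dist_def dist_norm power_mult_distrib
          orthogonal_transformation_norm[OF c(2)])
  qed
  with c(1) show thesis by (intro that[of "c\<^sup>2"]) auto
qed

text \<open>The isometry is \<open>x(\<xi>) \<mapsto> y(\<xi>)\<close>, which is well defined because both maps have the same inertia
  form up to the factor.\<close>

lemma similar_config_of_sq_dist:
  assumes x: "spatial x" and c: "c > 0" and d: "\<And>i j. sq_dist y i j = c * sq_dist x i j"
  shows "similar_config x y"
proof -
  define r where "r = sqrt c"
  have r: "r > 0" "r * r = c" using c by (auto simp: r_def)
  have inner: "config_map y \<xi> \<bullet> config_map y \<xi> = c * (config_map x \<xi> \<bullet> config_map x \<xi>)"
    if "\<xi> \<in> codisp" for \<xi>
    using that by (simp add: config_map_inner d sum_distrib_left mult.assoc)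
  define h where "h v = (SOME \<xi>. \<xi> \<in> codisp \<and> config_map x \<xi> = v)" for v
  have h: "h v \<in> codisp \<and> config_map x (h v) = v" for v
    unfolding h_def
    by (rule someI_ex) (use spatial_surj[OF x] in \<open>metis UNIV_I imageE\<close>)
  have hx: "h (config_map x \<xi>) = \<xi>" if "\<xi> \<in> codisp" for \<xi>
  proof -
    have "h (config_map x \<xi>) - \<xi> \<in> codisp"
      by (intro subspace_diff subspace_codisp that) (simp add: h)
    moreover have "config_map x (h (config_map x \<xi>) - \<xi>) = 0"
      by (simp add: linear_diff[OF linear_config_map] h)
    ultimately have "h (config_map x \<xi>) - \<xi> = 0" using x by (auto simp only: spatial_def)
    then show ?thesis by simp
  qed
  have lh: "linear h"
  proof (rule linearI)
    fix u v a
    have "h u + h v \<in> codisp" "a *\<^sub>R h u \<in> codisp"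
      by (simp_all add: h subspace_add subspace_scale subspace_codisp)
    from this[THEN hx] show "h (u + v) = h u + h v" "h (a *\<^sub>R u) = a *\<^sub>R h u"
      by (simp_all add: linear_add[OF linear_config_map] linear_cmul[OF linear_config_map] h)
  qed
  define f where "f v = (1 / r) *\<^sub>R config_map y (h v)" for v
  have "linear f"
    unfolding f_def
    using linear_compose_scale_right[OF linear_compose[OF lh linear_config_map[of y]]]
    by (simp add: o_def)
  moreover have "norm (f v) = norm v" for v
  proof -
    have "f v \<bullet> f v = v \<bullet> v"
      using r inner[of "h v"] h[of v] c by (simp add: f_def divide_simps)
    then show ?thesis by (simp add: norm_eq_sqrt_inner)
  qed
  ultimately have f: "orthogonal_transformation f"
    by (simp add: orthogonal_transformation)
  have "y $ i = r *\<^sub>R f (x $ i) + (y $ 4 - r *\<^sub>R f (x $ 4))" for i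
  proof -
    have "r *\<^sub>R f (x $ i - x $ 4) = y $ i - y $ 4"
      using r hx[OF axis_diff_codisp, of i 4]
      by (simp add: f_def config_map_axis_diff)
    then show ?thesis
      by (simp add: linear_diff[OF \<open>linear f\<close>] algebra_simps)
  qed
  then show ?thesis
    unfolding similar_config_def using r f by blast
qed

lemma force_fun_eq:
  assumes "s > 0"
  shows "force_fun G s = - (G / 2) * s powr (- 3 / 2)"
proof -
  have "((\<lambda>s. G * s powr (- 1 / 2)) has_real_derivative
      G * ((- 1 / 2) * s powr (- 1 / 2 - 1))) (at s)"
    by (intro DERIV_cmult has_real_derivative_powr assms)
  then have "deriv (potential_fun G) s = G * ((- 1 / 2) * s powr (- 1 / 2 - 1))"
    by (intro DERIV_imp_deriv) (simp add: potential_fun_def[abs_def])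
  then show ?thesis
    by (simp add: force_fun_def)
qed

lemma sum_upper_triangle_symmetric:
  fixes F :: "4 \<Rightarrow> 4 \<Rightarrow> real"
  assumes "\<And>i j. F i j = - F j i"
  shows "(\<Sum>i\<in>UNIV. \<Sum>j\<in>{i<..}. F i j * (of_bool (i = k) - of_bool (j = k))) = (\<Sum>j\<in>UNIV. F k j)"
proof -
  have "(\<Sum>i\<in>UNIV. \<Sum>j\<in>{i<..}. F i j * (of_bool (i = k) - of_bool (j = k))) =
     (\<Sum>i\<in>UNIV. \<Sum>j\<in>{i<..}. of_bool (i = k) * F i j) - (\<Sum>i\<in>UNIV. \<Sum>j\<in>{i<..}. of_bool (j = k) * F i j)"
    by (simp add: algebra_simps sum_subtractf)
  also have "(\<Sum>i\<in>UNIV. \<Sum>j\<in>{i<..}. of_bool (i = k) * F i j) = (\<Sum>j\<in>{k<..}. F k j)"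
    unfolding sum_distrib_left[symmetric]
    by (simp add: of_bool_def if_distrib[of "\<lambda>c. c * _"] cong: if_cong)
  also have "(\<Sum>i\<in>UNIV. \<Sum>j\<in>{i<..}. of_bool (j = k) * F i j) = (\<Sum>i\<in>UNIV. if i \<in> {..<k} then F i k else 0)"
    by (intro sum.cong refl) (simp add: of_bool_def if_distrib[of "\<lambda>c. c * _"] sum.delta cong: if_cong)
  also have "\<dots> = (\<Sum>i\<in>{..<k}. F i k)"
    by (simp add: sum.If_cases lessThan_def)
  also have "\<dots> = - (\<Sum>i\<in>{..<k}. F k i)"
    unfolding sum_negf[symmetric] by (intro sum.cong refl assms)
  also have "(\<Sum>j\<in>{k<..}. F k j) - (- (\<Sum>i\<in>{..<k}. F k i)) = (\<Sum>j\<in>{k<..} \<union> {..<k}. F k j)"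
    by (subst sum.union_disjoint) auto
  also have "\<dots> = (\<Sum>j\<in>UNIV. F k j)"
    using assms[of k k] by (intro sum.mono_neutral_left) (auto simp: not_less order_le_less)
  finally show ?thesis .
qed

text \<open>The sum over pairs \<open>i < j\<close> becomes a sum over all bodies acting on body \<open>k\<close>.\<close>

lemma wintner_conley_component:
  "wintner_conley G m x \<xi> $ k =
     (\<Sum>j\<in>UNIV. force_fun G (sq_dist x k j) * (m $ j * \<xi> $ k - m $ k * \<xi> $ j))"
proof -
  have ax: "(axis i 1 - axis j 1 :: real^4) $ k = of_bool (i = k) - of_bool (j = k)" for i j
    by (simp add: axis_def)
  show ?thesis
    unfolding wintner_conley_def sum_component vector_scaleR_component ax
      real_scaleR_def
    by (rule sum_upper_triangle_symmetric) (simp add: sq_dist_commute algebra_simps)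
qed

lemma inertia_endo_spec:
  fixes x :: "'e::real_inner^4"
  assumes m: "\<And>i. m $ i > 0" and \<xi>: "\<xi> \<in> codisp"
  shows "inertia_endo m x \<xi> \<in> codisp"
    and "\<eta> \<in> codisp \<Longrightarrow> codisp_inner m (inertia_endo m x \<xi>) \<eta> = config_map x \<xi> \<bullet> config_map x \<eta>"
  using theI'[OF inertia_endo_ex1[OF m, of x]] \<xi>
  unfolding inertia_endo_def[symmetric] by auto

section \<open>The exponential of an endomorphism\<close>

lemma linear_funpow:
  assumes "linear (\<Omega> :: 'e::real_vector \<Rightarrow> 'e)"
  shows "linear (\<Omega> ^^ k)"
proof (induction k)
  case (Suc k)
  show ?case using linear_compose[OF Suc assms] by (simp add: o_def)
qed (simp add: id_def[symmetric] linear_id)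

lemma funpow_scale:
  assumes "linear (\<Omega> :: 'e::real_vector \<Rightarrow> 'e)"
  shows "((\<lambda>v. t *\<^sub>R \<Omega> v) ^^ k) v = t ^ k *\<^sub>R (\<Omega> ^^ k) v"
  by (induction k) (auto simp: linear_cmul[OF assms])

lemma norm_funpow_le:
  fixes \<Omega> :: "'e::real_normed_vector \<Rightarrow> 'e"
  assumes "\<And>v. norm (\<Omega> v) \<le> K * norm v" "K \<ge> 0"
  shows "norm ((\<Omega> ^^ k) v) \<le> K ^ k * norm v"
proof (induction k)
  case (Suc k)
  have "norm ((\<Omega> ^^ Suc k) v) \<le> K * norm ((\<Omega> ^^ k) v)"
    using assms(1)[of "(\<Omega> ^^ k) v"] by simp
  also have "\<dots> \<le> K * (K ^ k * norm v)"
    by (intro mult_left_mono Suc assms)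
  finally show ?case by simp
qed simp

context
  fixes \<Omega> :: "'e::euclidean_space \<Rightarrow> 'e"
  assumes lin: "linear \<Omega>"
begin

lemma endo_exp_scale: "endo_exp (\<lambda>v. t *\<^sub>R \<Omega> v) v = (\<Sum>k. (t ^ k / fact k) *\<^sub>R (\<Omega> ^^ k) v)"
  unfolding endo_exp_def funpow_scale[OF lin] by simp

lemma summable_endo_exp: "summable (\<lambda>k. (t ^ k / fact k) *\<^sub>R (\<Omega> ^^ k) v)"
proof -
  obtain K where K: "\<And>v. norm (\<Omega> v) \<le> K * norm v" "K > 0"
    using linear_bounded_pos[OF lin] by auto
  have "summable (\<lambda>k. (inverse (fact k) * (\<bar>t\<bar> * K) ^ k) * norm v)"
    by (intro summable_mult2 summable_exp)
  then show ?thesis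
  proof (rule summable_comparison_test'[where N = 0])
    fix k
    have "norm ((t ^ k / fact k) *\<^sub>R (\<Omega> ^^ k) v) \<le> \<bar>t\<bar> ^ k / fact k * (K ^ k * norm v)"
      using norm_funpow_le[of \<Omega> K k v] K
      by (simp add: power_abs mult_left_mono divide_right_mono)
    then show "norm ((t ^ k / fact k) *\<^sub>R (\<Omega> ^^ k) v) \<le> inverse (fact k) * (\<bar>t\<bar> * K) ^ k * norm v"
      by (simp add: power_mult_distrib divide_inverse mult_ac)
  qed
qed

lemma endo_exp_linear: "linear (endo_exp (\<lambda>v. t *\<^sub>R \<Omega> v))"
proof (rule linearI)
  fix u v and c :: real
  show "endo_exp (\<lambda>v. t *\<^sub>R \<Omega> v) (u + v) = endo_exp (\<lambda>v. t *\<^sub>R \<Omega> v) u + endo_exp (\<lambda>v. t *\<^sub>R \<Omega> v) v"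
    unfolding endo_exp_scale
    by (subst suminf_add[OF summable_endo_exp summable_endo_exp])
       (simp add: linear_add[OF linear_funpow[OF lin]] scaleR_right_distrib)
  show "endo_exp (\<lambda>v. t *\<^sub>R \<Omega> v) (c *\<^sub>R v) = c *\<^sub>R endo_exp (\<lambda>v. t *\<^sub>R \<Omega> v) v"
    unfolding endo_exp_scale
    by (subst bounded_linear.suminf[OF bounded_linear_scaleR_right summable_endo_exp])
       (simp add: linear_cmul[OF linear_funpow[OF lin]] mult.commute)
qed

lemma endo_exp_commute: "endo_exp (\<lambda>v. t *\<^sub>R \<Omega> v) (\<Omega> v) = \<Omega> (endo_exp (\<lambda>v. t *\<^sub>R \<Omega> v) v)"
proof -
  have "bounded_linear \<Omega>"
    using lin by (simp add: linear_conv_bounded_linear)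
  from bounded_linear.suminf[OF this summable_endo_exp, of t v] show ?thesis
    unfolding endo_exp_scale by (simp add: linear_cmul[OF lin] funpow_swap1)
qed

lemma endo_exp_0: "endo_exp (\<lambda>v. 0 *\<^sub>R \<Omega> v) v = v"
proof -
  have "endo_exp (\<lambda>v. 0 *\<^sub>R \<Omega> v) v = (\<Sum>k. if k = 0 then v else 0)"
    unfolding endo_exp_scale by (intro suminf_cong) auto
  also have "\<dots> = v"
    using suminf_finite[of "{0::nat}" "\<lambda>k. if k = 0 then v else 0"] by simp
  finally show ?thesis .
qed

lemma endo_exp_has_vector_derivative:
  "((\<lambda>t. endo_exp (\<lambda>v. t *\<^sub>R \<Omega> v) v) has_vector_derivative
     endo_exp (\<lambda>v. t *\<^sub>R \<Omega> v) (\<Omega> v)) (at t)"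
proof -
  have "((\<lambda>t. endo_exp (\<lambda>v. t *\<^sub>R \<Omega> v) v \<bullet> b) has_real_derivative
      endo_exp (\<lambda>v. t *\<^sub>R \<Omega> v) (\<Omega> v) \<bullet> b) (at t)" for b
  proof -
    define c where "c k = ((\<Omega> ^^ k) v \<bullet> b) / fact k" for k
    have eq: "endo_exp (\<lambda>v. t *\<^sub>R \<Omega> v) u \<bullet> b = (\<Sum>k. ((\<Omega> ^^ k) u \<bullet> b) / fact k * t ^ k)" for t u
      unfolding endo_exp_scale
      by (subst bounded_linear.suminf[OF bounded_linear_inner_left summable_endo_exp])
         (simp add: mult_ac)
    have "summable (\<lambda>k. c k * y ^ k)" for y
      using bounded_linear.summable[OF bounded_linear_inner_left[of b] summable_endo_exp[of y v]]
      by (simp add: c_def mult_ac)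
    then have "((\<lambda>x. \<Sum>n. c n * x ^ n) has_field_derivative (\<Sum>n. diffs c n * t ^ n)) (at t)"
      by (rule termdiffs_strong_converges_everywhere)
    moreover have "diffs c n = ((\<Omega> ^^ n) (\<Omega> v) \<bullet> b) / fact n" for n
      by (simp add: diffs_def c_def funpow_swap1 del: of_nat_Suc)
    ultimately show ?thesis
      unfolding eq by (simp add: c_def)
  qed
  then show ?thesis
    unfolding has_vector_derivative_def
    by (subst has_derivative_componentwise_within)
       (simp add: has_field_derivative_def mult_commute_abs)
qed

text \<open>The derivative of the squared norm vanishes because the generator is antisymmetric and
  commutes with its exponential.\<close>

lemma endo_exp_norm:
  assumes "\<And>u v. \<Omega> u \<bullet> v = - (u \<bullet> \<Omega> v)"
  shows "norm (endo_exp (\<lambda>v. t *\<^sub>R \<Omega> v) v) = norm v"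
proof -
  define g where "g t = endo_exp (\<lambda>v. t *\<^sub>R \<Omega> v) v" for t
  have "\<Omega> u \<bullet> u = 0" for u
    using assms[of u u] by (simp add: inner_commute)
  then have "((\<lambda>t. g t \<bullet> g t) has_real_derivative 0) (at t)" for t
    using has_derivative_inner[OF endo_exp_has_vector_derivative[of v t, unfolded has_vector_derivative_def]
        endo_exp_has_vector_derivative[of v t, unfolded has_vector_derivative_def]]
    unfolding g_def endo_exp_commute
    by (simp add: has_field_derivative_def inner_commute lambda_zero)
  then have "g t \<bullet> g t = g 0 \<bullet> g 0"
    by (intro DERIV_isconst_all) auto
  then show ?thesis
    by (simp add: g_def endo_exp_0[simplified] norm_eq_sqrt_inner)
qed

end

section \<open>Relative equilibria as an algebraic condition\<close>

lemma config_map_image: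
  assumes "linear L"
  shows "config_map (\<chi> i. L (x $ i)) \<xi> = L (config_map x \<xi>)"
  unfolding config_map_def by (simp add: linear_sum[OF assms] linear_cmul[OF assms])

lemma sq_dist_image:
  fixes L :: "'a::real_normed_vector \<Rightarrow> 'b::real_normed_vector"
  assumes "linear L" "\<And>v. norm (L v) = norm v"
  shows "sq_dist (\<chi> i. L (x $ i)) i j = sq_dist x i j"
  unfolding sq_dist_def by (simp add: dist_norm assms(2) flip: linear_diff[OF assms(1)])

lemma noncollision_iff_sq_dist:
  fixes x :: "'e::metric_space^4"
  shows "noncollision x \<longleftrightarrow> (\<forall>i j. i \<noteq> j \<longrightarrow> sq_dist x i j > 0)"
  by (auto simp: noncollision_def sq_dist_def)

lemma wintner_conley_cong:
  "(\<And>i j. sq_dist x i j = sq_dist y i j) \<Longrightarrow> wintner_conley G m x = wintner_conley G m y"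
  by (simp add: wintner_conley_def fun_eq_iff)

text \<open>A rigid rotation solves Newton's equations as soon as it does so at time zero, because it
  commutes with its own generator and keeps all mutual distances.\<close>

lemma newton_solution_rotation_iff:
  fixes y :: "'e::euclidean_space^4"
  assumes \<Omega>: "antisymmetric_endo \<Omega>"
    and X: "\<And>t. X t = (\<chi> i. endo_exp (\<lambda>v. t *\<^sub>R \<Omega> v) (y $ i))"
  shows "newton_solution G m X \<longleftrightarrow> noncollision y \<and>
    (\<forall>\<xi>\<in>codisp. \<Omega> (\<Omega> (config_map y \<xi>)) = 2 *\<^sub>R config_map y (wintner_conley G m y \<xi>))"
proof -
  have lin: "linear \<Omega>" and anti: "\<And>u v. \<Omega> u \<bullet> v = - (u \<bullet> \<Omega> v)"
    using \<Omega> by (auto simp: antisymmetric_endo_def)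
  let ?E = "\<lambda>t. endo_exp (\<lambda>v. t *\<^sub>R \<Omega> v)"
  have map: "config_map (X t) \<xi> = ?E t (config_map y \<xi>)" for t \<xi>
    unfolding X by (rule config_map_image[OF endo_exp_linear[OF lin]])
  have sq: "sq_dist (X t) i j = sq_dist y i j" for t i j
    unfolding X by (rule sq_dist_image[OF endo_exp_linear[OF lin] endo_exp_norm[OF lin anti]])
  have A: "wintner_conley G m (X t) = wintner_conley G m y" for t
    by (rule wintner_conley_cong) (rule sq)
  have d: "((\<lambda>u. ?E u v) has_vector_derivative ?E t (\<Omega> v)) (at t)" for t v
    by (rule endo_exp_has_vector_derivative[OF lin])
  have E0: "?E 0 v = v" for v
    by (rule endo_exp_0[OF lin])
  show ?thesis
  proof
    assume N: "newton_solution G m X"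
    then obtain V where V: "\<And>t \<xi>. \<xi> \<in> codisp \<Longrightarrow>
        ((\<lambda>u. config_map (X u) \<xi>) has_vector_derivative V t \<xi>) (at t)"
      "\<And>t \<xi>. \<xi> \<in> codisp \<Longrightarrow> ((\<lambda>u. V u \<xi>) has_vector_derivative
           2 *\<^sub>R config_map (X t) (wintner_conley G m (X t) \<xi>)) (at t)"
      unfolding newton_solution_def by blast
    have "\<Omega> (\<Omega> (config_map y \<xi>)) = 2 *\<^sub>R config_map y (wintner_conley G m y \<xi>)" if "\<xi> \<in> codisp" for \<xi>
    proof -
      have "V u \<xi> = ?E u (\<Omega> (config_map y \<xi>))" for u
        using V(1)[OF that, of u] d unfolding map by (rule vector_derivative_unique_at)
      then have "((\<lambda>u. ?E u (\<Omega> (config_map y \<xi>))) has_vector_derivative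
          2 *\<^sub>R config_map y (wintner_conley G m y \<xi>)) (at 0)"
        using V(2)[OF that, of 0] unfolding map A E0 by simp
      from vector_derivative_unique_at[OF d this] show ?thesis
        unfolding E0 .
    qed
    moreover have "noncollision (X 0)"
      using N by (simp add: newton_solution_def)
    ultimately show "noncollision y \<and> (\<forall>\<xi>\<in>codisp. \<Omega> (\<Omega> (config_map y \<xi>)) =
        2 *\<^sub>R config_map y (wintner_conley G m y \<xi>))"
      by (simp add: noncollision_iff_sq_dist sq)
  next
    assume *: "noncollision y \<and> (\<forall>\<xi>\<in>codisp. \<Omega> (\<Omega> (config_map y \<xi>)) =
        2 *\<^sub>R config_map y (wintner_conley G m y \<xi>))"
    then have "noncollision (X t)" for t
      by (simp add: noncollision_iff_sq_dist sq)
    moreover have "((\<lambda>u. config_map (X u) \<xi>) has_vector_derivative ?E t (\<Omega> (config_map y \<xi>))) (at t) \<and>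
        ((\<lambda>u. ?E u (\<Omega> (config_map y \<xi>))) has_vector_derivative
           2 *\<^sub>R config_map (X t) (wintner_conley G m (X t) \<xi>)) (at t)" if "\<xi> \<in> codisp" for t \<xi>
    proof
      show "((\<lambda>u. config_map (X u) \<xi>) has_vector_derivative ?E t (\<Omega> (config_map y \<xi>))) (at t)"
        unfolding map by (rule d)
      have "2 *\<^sub>R config_map (X t) (wintner_conley G m (X t) \<xi>) = ?E t (\<Omega> (\<Omega> (config_map y \<xi>)))"
        using * that by (simp add: map A linear_cmul[OF endo_exp_linear[OF lin]])
      then show "((\<lambda>u. ?E u (\<Omega> (config_map y \<xi>))) has_vector_derivative
           2 *\<^sub>R config_map (X t) (wintner_conley G m (X t) \<xi>)) (at t)"
        using d by simp
    qed
    ultimately show "newton_solution G m X"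
      unfolding newton_solution_def
      by (intro conjI allI exI[of _ "\<lambda>t \<xi>. ?E t (\<Omega> (config_map y \<xi>))"] ballI) auto
  qed
qed

lemma admits_relative_equilibrium_R4_iff:
  "admits_relative_equilibrium_R4 G m x \<longleftrightarrow> noncollision x \<and>
    (\<exists>(\<iota> :: real^3 \<Rightarrow> real^4) \<Omega>. linear \<iota> \<and> (\<forall>v. norm (\<iota> v) = norm v) \<and> antisymmetric_endo \<Omega> \<and>
      (\<forall>\<xi>\<in>codisp. \<Omega> (\<Omega> (\<iota> (config_map x \<xi>))) = 2 *\<^sub>R \<iota> (config_map x (wintner_conley G m x \<xi>))))"
proof -
  have *: "(\<exists>X. relative_equilibrium_motion G m (\<chi> i. \<iota> (x $ i)) X) \<longleftrightarrow> noncollision x \<and>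
      (\<exists>\<Omega>. antisymmetric_endo \<Omega> \<and> (\<forall>\<xi>\<in>codisp. \<Omega> (\<Omega> (\<iota> (config_map x \<xi>))) =
          2 *\<^sub>R \<iota> (config_map x (wintner_conley G m x \<xi>))))"
    if \<iota>: "linear \<iota>" "\<forall>v. norm (\<iota> v) = norm v" for \<iota> :: "real^3 \<Rightarrow> real^4"
  proof -
    let ?y = "\<chi> i. \<iota> (x $ i)"
    have sq: "sq_dist ?y i j = sq_dist x i j" for i j
      using \<iota> by (intro sq_dist_image) auto
    have A: "wintner_conley G m ?y = wintner_conley G m x"
      by (rule wintner_conley_cong) (rule sq)
    have nc: "noncollision ?y = noncollision x"
      by (simp add: noncollision_iff_sq_dist sq)
    have "(\<exists>X. relative_equilibrium_motion G m ?y X) \<longleftrightarrow>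
      (\<exists>\<Omega>. antisymmetric_endo \<Omega> \<and> newton_solution G m (\<lambda>t. \<chi> i. endo_exp (\<lambda>v. t *\<^sub>R \<Omega> v) (?y $ i)))"
      unfolding relative_equilibrium_motion_def by (auto simp flip: fun_eq_iff)
    also have "\<dots> \<longleftrightarrow> noncollision x \<and> (\<exists>\<Omega>. antisymmetric_endo \<Omega> \<and> (\<forall>\<xi>\<in>codisp. \<Omega> (\<Omega> (\<iota> (config_map x \<xi>))) =
          2 *\<^sub>R \<iota> (config_map x (wintner_conley G m x \<xi>))))"
      using newton_solution_rotation_iff[OF _ refl, where y = ?y and G = G and m = m]
      by (auto simp only: nc A config_map_image[OF \<iota>(1)])
    finally show ?thesis .
  qed
  show ?thesis
    unfolding admits_relative_equilibrium_R4_def using * by blast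
qed

section \<open>From shapes to relative equilibria\<close>

text \<open>Squared distances, up to scale, of a configuration whose force coefficients are proportional to
  \<open>1 + \<beta> p\<^sub>i p\<^sub>j\<close>; the diagonal is zero.\<close>

definition shape :: "real \<Rightarrow> real^4 \<Rightarrow> 4 \<Rightarrow> 4 \<Rightarrow> real" where
  "shape \<beta> p i j = (if i = j then 0 else (1 + \<beta> * p $ i * p $ j) powr (- 2 / 3))"

text \<open>The codisposition with components \<open>m\<^sub>i p\<^sub>i\<close> is an eigenvector of the inertia endomorphism of a
  configuration with squared distances \<open>s\<close>: the image of \<open>p\<close> is a multiple of \<open>p\<close> modulo
  constants, which are orthogonal to all codispositions.\<close>

definition eigen_direction :: "(4 \<Rightarrow> 4 \<Rightarrow> real) \<Rightarrow> real^4 \<Rightarrow> real^4 \<Rightarrow> bool" where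
  "eigen_direction s m p \<longleftrightarrow>
     (\<exists>l c. \<forall>i. (\<Sum>j\<in>UNIV. s i j * (m $ j * p $ j)) = l * p $ i + c)"

text \<open>The codisposition of a direction \<open>p\<close>, provided that \<open>\<Sum> m\<^sub>i p\<^sub>i = 0\<close>. With respect to the
  inner product of codispositions it represents the functional \<open>p \<bullet> _\<close>.\<close>

definition weighted :: "real^4 \<Rightarrow> real^4 \<Rightarrow> real^4" where
  "weighted m p = (\<chi> i. m $ i * p $ i)"

lemma codisp_inner_weighted:
  assumes "\<And>i. m $ i > 0"
  shows "codisp_inner m (weighted m p) \<eta> = p \<bullet> \<eta>"
proof -
  have "m $ i \<noteq> 0" for i using assms[of i] by simp
  then show ?thesis by (simp add: codisp_inner_def weighted_def inner_vec_def)
qed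

lemma config_map_weighted_inner:
  fixes x :: "'e::real_inner^4"
  assumes w: "weighted m p \<in> codisp" and \<eta>: "\<eta> \<in> codisp"
    and eig: "\<And>i. (\<Sum>j\<in>UNIV. sq_dist x i j * (m $ j * p $ j)) = l * p $ i + c"
  shows "config_map x (weighted m p) \<bullet> config_map x \<eta> = - (l / 2) * (p \<bullet> \<eta>)"
proof -
  have "config_map x \<eta> \<bullet> config_map x (weighted m p) =
      - (\<Sum>i\<in>UNIV. (\<Sum>j\<in>UNIV. sq_dist x i j * (m $ j * p $ j)) * \<eta> $ i) / 2"
    unfolding config_map_inner[OF \<eta> w] by (simp add: weighted_def sum_distrib_right sum_distrib_left mult_ac)
  also have "\<dots> = - (l * (p \<bullet> \<eta>) + c * (\<Sum>i\<in>UNIV. \<eta> $ i)) / 2"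
    by (simp add: eig inner_vec_def distrib_right sum.distrib sum_distrib_left mult.assoc)
  also have "\<dots> = - (l / 2) * (p \<bullet> \<eta>)"
    using \<eta> by (simp add: codisp_iff)
  finally show ?thesis by (simp add: inner_commute)
qed

text \<open>The term \<open>j = k\<close> vanishes, so the diagonal of the rank one matrix plays no role.\<close>

lemma rank_one_sum:
  assumes p: "weighted m p \<in> codisp" and \<xi>: "\<xi> \<in> codisp"
  shows "(\<Sum>j\<in>UNIV. (1 + \<beta> * p $ k * p $ j) * (m $ j * \<xi> $ k - m $ k * \<xi> $ j)) =
    (\<Sum>i\<in>UNIV. m $ i) * \<xi> $ k - \<beta> * (p \<bullet> \<xi>) * (m $ k * p $ k)"
proof -
  have "(\<Sum>j\<in>UNIV. (1 + \<beta> * p $ k * p $ j) * (m $ j * \<xi> $ k - m $ k * \<xi> $ j)) =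
      (\<Sum>j\<in>UNIV. \<xi> $ k * m $ j - m $ k * \<xi> $ j
        + \<beta> * p $ k * \<xi> $ k * (m $ j * p $ j) - \<beta> * p $ k * m $ k * (p $ j * \<xi> $ j))"
    by (intro sum.cong refl) (simp add: algebra_simps)
  also have "\<dots> = \<xi> $ k * (\<Sum>i\<in>UNIV. m $ i) - m $ k * (\<Sum>i\<in>UNIV. \<xi> $ i)
        + \<beta> * p $ k * \<xi> $ k * (\<Sum>i\<in>UNIV. m $ i * p $ i) - \<beta> * p $ k * m $ k * (p \<bullet> \<xi>)"
    by (simp only: sum.distrib sum_subtractf sum_distrib_left inner_vec_def inner_real_def)
  also have "\<dots> = (\<Sum>i\<in>UNIV. m $ i) * \<xi> $ k - \<beta> * (p \<bullet> \<xi>) * (m $ k * p $ k)"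
    using p \<xi> by (simp add: codisp_iff weighted_def)
  finally show ?thesis .
qed

text \<open>The Wintner-Conley endomorphism is a scalar plus an endomorphism of rank one.\<close>

lemma wintner_conley_rank_one:
  assumes f: "\<And>i j. i \<noteq> j \<Longrightarrow> force_fun G (sq_dist x i j) = a * (1 + \<beta> * p $ i * p $ j)"
    and p: "weighted m p \<in> codisp" and \<xi>: "\<xi> \<in> codisp"
  shows "wintner_conley G m x \<xi> =
    (a * (\<Sum>i\<in>UNIV. m $ i)) *\<^sub>R \<xi> - (a * \<beta> * (p \<bullet> \<xi>)) *\<^sub>R weighted m p"
proof -
  have "wintner_conley G m x \<xi> $ k =
      a * ((\<Sum>i\<in>UNIV. m $ i) * \<xi> $ k - \<beta> * (p \<bullet> \<xi>) * (m $ k * p $ k))" for k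
    unfolding rank_one_sum[OF p \<xi>, symmetric] wintner_conley_component sum_distrib_left
  proof (rule sum.cong[OF refl])
    fix j show "force_fun G (sq_dist x k j) * (m $ j * \<xi> $ k - m $ k * \<xi> $ j) =
       a * ((1 + \<beta> * p $ k * p $ j) * (m $ j * \<xi> $ k - m $ k * \<xi> $ j))"
      by (cases "k = j") (auto simp: f)
  qed
  then show ?thesis by (simp add: vec_eq_iff weighted_def algebra_simps)
qed

text \<open>Attraction makes the quadratic form of the Wintner-Conley endomorphism nonpositive.\<close>

lemma wintner_conley_weighted_nonpos:
  assumes m: "\<And>i. m $ i > 0" and f: "\<And>i j. i \<noteq> j \<Longrightarrow> force_fun G (sq_dist x i j) \<le> 0"
  shows "p \<bullet> wintner_conley G m x (weighted m p) \<le> 0"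
proof -
  let ?f = "\<lambda>i j. force_fun G (sq_dist x i j) * m $ i * m $ j"
  have f_sym: "?f i j = ?f j i" for i j
    by (simp add: sq_dist_commute)
  let ?S = "\<Sum>i\<in>UNIV. \<Sum>j\<in>UNIV. ?f i j * (p $ i * (p $ i - p $ j))"
  have eq: "p \<bullet> wintner_conley G m x (weighted m p) = ?S"
    by (simp add: inner_vec_def wintner_conley_component weighted_def sum_distrib_left algebra_simps)
  have "?S = (\<Sum>i\<in>UNIV. \<Sum>j\<in>UNIV. ?f i j * (p $ j * (p $ j - p $ i)))"
    by (subst sum.swap) (intro sum.cong refl arg_cong2[where f = "(*)"] f_sym)
  then have "2 * ?S = (\<Sum>i\<in>UNIV. \<Sum>j\<in>UNIV. ?f i j * (p $ i * (p $ i - p $ j)) + ?f i j * (p $ j * (p $ j - p $ i)))"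
    by (simp only: sum.distrib)
  also have "\<dots> = (\<Sum>i\<in>UNIV. \<Sum>j\<in>UNIV. ?f i j * (p $ i - p $ j)\<^sup>2)"
    by (intro sum.cong refl) (simp add: algebra_simps power2_eq_square)
  also have "\<dots> \<le> 0"
  proof (intro sum_nonpos)
    fix i j :: 4
    have "?f i j * (p $ i - p $ j)\<^sup>2 \<le> 0" if "i \<noteq> j"
      using f[OF that] m[of i] m[of j] by (intro mult_nonpos_nonneg) auto
    then show "?f i j * (p $ i - p $ j)\<^sup>2 \<le> 0" by (cases "i = j") auto
  qed
  finally show ?thesis unfolding eq by simp
qed

lemma force_fun_shape:
  assumes "\<kappa> > 0" "i \<noteq> j" "1 + \<beta> * p $ i * p $ j > 0"
  shows "force_fun G (\<kappa> * shape \<beta> p i j) = - (G / 2 * \<kappa> powr (- 3 / 2)) * (1 + \<beta> * p $ i * p $ j)"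
  using assms by (simp add: shape_def force_fun_eq powr_mult powr_powr)

text \<open>A nonpositive symmetric endomorphism of space with a double eigenvalue becomes, after adding one
  dimension, half the square of an antisymmetric endomorphism: two planes turn at the two
  frequencies.\<close>

lemma antisymmetric_square_exists:
  fixes e :: "real^3"
  assumes e: "norm e = 1" and a: "a \<le> 0" "a' \<le> 0"
  obtains \<iota> :: "real^3 \<Rightarrow> real^4" and \<Omega> where
    "linear \<iota>" "\<And>v. norm (\<iota> v) = norm v" "antisymmetric_endo \<Omega>"
    "\<And>v. \<Omega> (\<Omega> (\<iota> v)) = 2 *\<^sub>R \<iota> (a *\<^sub>R v + ((a' - a) * (e \<bullet> v)) *\<^sub>R e)"
proof -
  have "norm (axis 1 1 :: real^3) = 1" by simp
  then obtain f :: "real^3 \<Rightarrow> real^3" where f: "orthogonal_transformation f" "f e = axis 1 1"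
    by (rule orthogonal_transformation_exists_1[OF e])
  define J :: "real^3 \<Rightarrow> real^4" where "J v = vector [v $ 1, v $ 2, v $ 3, 0]" for v
  define p q where "p = sqrt (- 2 * a)" and "q = sqrt (- 2 * a')"
  define \<Omega> :: "real^4 \<Rightarrow> real^4" where
    "\<Omega> z = vector [- q * z $ 4, - p * z $ 3, p * z $ 2, q * z $ 1]" for z
  have pq: "p * p = - 2 * a" "q * q = - 2 * a'"
    using a by (auto simp: p_def q_def)
  have v4: "(vector [s, t, u, v] :: real^4) $ 1 = s" "(vector [s, t, u, v] :: real^4) $ 2 = t"
     "(vector [s, t, u, v] :: real^4) $ 3 = u" "(vector [s, t, u, v] :: real^4) $ 4 = v" for s t u v
    by (simp_all add: vector_def)
  have lJ: "linear J"
    by (rule linearI) (simp_all add: J_def vec_eq_iff forall_4 v4)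
  have nJ: "norm (J v) = norm v" for v
    by (simp add: J_def norm_eq_sqrt_inner inner_vec_def sum_3 sum_4 v4)
  have lf: "linear f"
    using f(1) by (rule orthogonal_transformation_linear)
  have e1: "axis (1::3) (1::real) $ 1 = 1" "axis (1::3) (1::real) $ 2 = 0" "axis (1::3) (1::real) $ 3 = 0"
    by (simp_all add: axis_def)
  have \<Omega>J: "\<Omega> (\<Omega> (J v)) = 2 *\<^sub>R J (a *\<^sub>R v + ((a' - a) * v $ 1) *\<^sub>R axis 1 1)" for v
    by (simp add: vec_eq_iff forall_4 \<Omega>_def J_def v4 e1 pq flip: mult.assoc) (simp add: algebra_simps)
  show thesis
  proof (rule that[of "J \<circ> f" \<Omega>])
    show "linear (J \<circ> f)" by (rule linear_compose[OF lf lJ])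
    show "norm ((J \<circ> f) v) = norm v" for v
      by (simp add: nJ orthogonal_transformation_norm[OF f(1)])
    have "linear \<Omega>"
      by (rule linearI) (simp_all add: \<Omega>_def vec_eq_iff forall_4 v4 algebra_simps)
    then show "antisymmetric_endo \<Omega>"
      by (simp add: antisymmetric_endo_def \<Omega>_def inner_vec_def sum_4 v4 algebra_simps)
    fix v
    have "f v $ 1 = f e \<bullet> f v"
      unfolding f(2) by (simp add: inner_axis' )
    also have "\<dots> = e \<bullet> v"
      using f(1) by (simp add: orthogonal_transformation_def)
    finally show "\<Omega> (\<Omega> ((J \<circ> f) v)) = 2 *\<^sub>R (J \<circ> f) (a *\<^sub>R v + ((a' - a) * (e \<bullet> v)) *\<^sub>R e)"
      by (simp add: \<Omega>J linear_add[OF lf] linear_cmul[OF lf] f(2))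
  qed
qed

theorem balanced_RE4_of_shape:
  fixes x :: "real^3^4"
  assumes G: "G > 0" and m: "\<And>i. m $ i > 0" and x: "spatial x" and \<kappa>: "\<kappa> > 0"
    and sq: "\<And>i j. sq_dist x i j = \<kappa> * shape \<beta> p i j"
    and pos: "\<And>i j. i \<noteq> j \<Longrightarrow> 1 + \<beta> * p $ i * p $ j > 0"
    and p: "p \<noteq> 0" and w: "weighted m p \<in> codisp"
    and eig: "eigen_direction (shape \<beta> p) m p"
  shows "balanced_RE4 G m x"
proof -
  define W where "W = weighted m p"
  define M where "M = (\<Sum>i\<in>UNIV. m $ i)"
  define a where "a = - (G / 2 * \<kappa> powr (- 3 / 2))"
  have a: "a < 0" using G \<kappa> by (simp add: a_def)
  have M: "M > 0" unfolding M_def using m by (intro sum_pos) auto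
  note Wc = w[folded W_def]
  have f: "force_fun G (sq_dist x i j) = a * (1 + \<beta> * p $ i * p $ j)" if "i \<noteq> j" for i j
    unfolding sq a_def by (rule force_fun_shape[OF \<kappa> that pos[OF that]])
  have A: "wintner_conley G m x \<xi> = (a * M) *\<^sub>R \<xi> - (a * \<beta> * (p \<bullet> \<xi>)) *\<^sub>R W" if "\<xi> \<in> codisp" for \<xi>
    unfolding M_def W_def by (rule wintner_conley_rank_one[OF f w that])
  obtain l c where lc: "\<And>i. (\<Sum>j\<in>UNIV. shape \<beta> p i j * (m $ j * p $ j)) = l * p $ i + c"
    using eig unfolding eigen_direction_def by blast
  define \<sigma> where "\<sigma> = - (\<kappa> * l / 2)"
  (* the image of W is orthogonal to the images of all codispositions annihilated by p *)
  have XW: "config_map x W \<bullet> config_map x \<eta> = \<sigma> * (p \<bullet> \<eta>)" if "\<eta> \<in> codisp" for \<eta>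
  proof -
    have "(\<Sum>j\<in>UNIV. sq_dist x i j * (m $ j * p $ j)) = (\<kappa> * l) * p $ i + \<kappa> * c" for i
      using lc[of i] by (simp add: sq mult.assoc distrib_left flip: sum_distrib_left)
    from config_map_weighted_inner[OF w that this] show ?thesis
      by (simp add: W_def \<sigma>_def)
  qed
  have XA: "config_map x (wintner_conley G m x \<xi>) =
      (a * M) *\<^sub>R config_map x \<xi> - (a * \<beta> * (p \<bullet> \<xi>)) *\<^sub>R config_map x W" if "\<xi> \<in> codisp" for \<xi>
    by (simp add: A[OF that] linear_diff[OF linear_config_map] linear_cmul[OF linear_config_map])
  have pW: "p \<bullet> W > 0"
  proof -
    obtain i where i: "p $ i \<noteq> 0" using p by (auto simp: vec_eq_iff)
    have "p \<bullet> W = (\<Sum>i\<in>UNIV. m $ i * (p $ i)\<^sup>2)"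
      by (simp add: W_def weighted_def inner_vec_def power2_eq_square mult_ac)
    also have "\<dots> > 0"
      using m i by (intro sum_pos2[of _ i]) (auto simp: less_imp_le)
    finally show ?thesis .
  qed
  have nc: "noncollision x"
    using \<kappa> pos by (auto simp: noncollision_iff_sq_dist sq shape_def powr_gt_zero less_imp_neq[symmetric])
  note B = inertia_endo_spec[OF m, where x = x]
  have lin: "codisp_inner m (u *\<^sub>R \<xi> - v *\<^sub>R \<eta>) \<zeta> = u * codisp_inner m \<xi> \<zeta> - v * codisp_inner m \<eta> \<zeta>" for u v \<xi> \<eta> \<zeta>
    by (simp add: codisp_inner_def algebra_simps diff_divide_distrib sum_subtractf sum_distrib_left)
  have "balanced G m x"
    unfolding balanced_def
  proof
    fix \<xi> :: "real^4" assume \<xi>: "\<xi> \<in> codisp"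
    show "wintner_conley G m x (inertia_endo m x \<xi>) = inertia_endo m x (wintner_conley G m x \<xi>)"
    proof (rule codisp_inner_nondegenerate[OF m wintner_conley_codisp B(1)[OF wintner_conley_codisp]])
      fix \<eta> :: "real^4" assume \<eta>: "\<eta> \<in> codisp"
      have sym: "codisp_inner m u v = codisp_inner m v u" for u v
        by (simp add: codisp_inner_def mult.commute)
      have "p \<bullet> inertia_endo m x \<xi> = codisp_inner m (inertia_endo m x \<xi>) W"
        unfolding W_def by (subst sym) (simp add: codisp_inner_weighted[OF m])
      also have "\<dots> = \<sigma> * (p \<bullet> \<xi>)"
        using B(2)[OF \<xi> Wc] XW[OF \<xi>] by (simp add: inner_commute)
      finally have pB: "p \<bullet> inertia_endo m x \<xi> = \<sigma> * (p \<bullet> \<xi>)" .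
      show "codisp_inner m (wintner_conley G m x (inertia_endo m x \<xi>)) \<eta> =
          codisp_inner m (inertia_endo m x (wintner_conley G m x \<xi>)) \<eta>"
        unfolding A[OF B(1)[OF \<xi>]] B(2)[OF wintner_conley_codisp \<eta>] XA[OF \<xi>] lin pB
        using XW[OF \<eta>] B(2)[OF \<xi> \<eta>]
        by (simp add: inner_diff_left W_def codisp_inner_weighted[OF m])
    qed
  qed
  moreover have "admits_relative_equilibrium_R4 G m x"
  proof -
    define X where "X = config_map x W"
    have X0: "X \<noteq> 0"
    proof
      assume "X = 0"
      then have "W = 0" using x Wc by (simp add: spatial_def X_def)
      then show False using pW by simp
    qed
    have XX: "X \<bullet> X = \<sigma> * (p \<bullet> W)"
      using XW[OF Wc] by (simp add: X_def)
    define e where "e = (1 / norm X) *\<^sub>R X"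
    define a' where "a' = a * M - a * \<beta> * (p \<bullet> W)"
    have e: "norm e = 1" using X0 by (simp add: e_def)
    have "p \<bullet> wintner_conley G m x W \<le> 0"
      unfolding W_def
    proof (rule wintner_conley_weighted_nonpos[OF m])
      fix i j :: 4 assume "i \<noteq> j"
      then show "force_fun G (sq_dist x i j) \<le> 0"
        using f[of i j] pos[of i j] a by (simp add: mult_nonpos_nonneg)
    qed
    then have "a' * (p \<bullet> W) \<le> 0"
      by (simp add: A[OF Wc] a'_def inner_diff_right algebra_simps)
    then have a': "a' \<le> 0"
      using pW by (simp add: mult_le_0_iff)
    have aM: "a * M \<le> 0"
      using a M by (simp add: mult_nonpos_nonneg)
    obtain \<iota> :: "real^3 \<Rightarrow> real^4" and \<Omega> where \<iota>: "linear \<iota>" "\<And>v. norm (\<iota> v) = norm v" "antisymmetric_endo \<Omega>"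
      "\<And>v. \<Omega> (\<Omega> (\<iota> v)) = 2 *\<^sub>R \<iota> ((a * M) *\<^sub>R v + ((a' - a * M) * (e \<bullet> v)) *\<^sub>R e)"
      using antisymmetric_square_exists[OF e aM a'] by metis
    have "config_map x (wintner_conley G m x \<xi>) =
       (a * M) *\<^sub>R config_map x \<xi> + ((a' - a * M) * (e \<bullet> config_map x \<xi>)) *\<^sub>R e" if \<xi>: "\<xi> \<in> codisp" for \<xi>
    proof -
      have nX: "norm X * norm X = \<sigma> * (p \<bullet> W)"
        using XX by (simp add: dot_square_norm power2_eq_square)
      have nX0: "norm X * norm X > 0" using X0 by simp
      then have \<sigma>: "\<sigma> \<noteq> 0" using nX by auto
      have "((a' - a * M) * (e \<bullet> config_map x \<xi>)) *\<^sub>R e =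
         (- (a * \<beta> * (p \<bullet> W)) * (\<sigma> * (p \<bullet> \<xi>)) / (norm X * norm X)) *\<^sub>R X"
        using XW[OF \<xi>] by (simp add: e_def a'_def X_def[symmetric])
      also have "- (a * \<beta> * (p \<bullet> W)) * (\<sigma> * (p \<bullet> \<xi>)) / (norm X * norm X) = - (a * \<beta> * (p \<bullet> \<xi>))"
        unfolding nX using pW \<sigma> by (simp add: field_simps)
      finally show ?thesis
        unfolding XA[OF \<xi>] by (simp add: X_def)
    qed
    then show ?thesis
      unfolding admits_relative_equilibrium_R4_iff using nc \<iota> by metis
  qed
  ultimately show ?thesis
    using nc by (simp add: balanced_RE4_def)
qed

section \<open>From relative equilibria to shapes\<close>

text \<open>Antisymmetric endomorphisms of 3-space are cross products.\<close>

lemma antisymmetric_endo_cross3: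
  fixes L :: "real^3 \<Rightarrow> real^3"
  assumes "antisymmetric_endo L"
  obtains c where "\<And>v. L v = cross3 c v"
proof
  fix v :: "real^3"
  have lin: "linear L" and anti: "\<And>u v. L u \<bullet> v = - (u \<bullet> L v)"
    using assms by (auto simp: antisymmetric_endo_def)
  let ?e = "\<lambda>i::3. axis i (1::real)"
  have sym: "L (?e j) $ i = - (L (?e i) $ j)" for i j
    using anti[of "?e j" "?e i"] by (simp add: inner_axis inner_axis')
  have diag: "L (?e j) $ j = 0" for j
    using sym[of j j] by simp
  have "v = v $ 1 *\<^sub>R ?e 1 + v $ 2 *\<^sub>R ?e 2 + v $ 3 *\<^sub>R ?e 3"
    by (simp add: vec_eq_iff forall_3 axis_def)
  then have "L v = L (v $ 1 *\<^sub>R ?e 1 + v $ 2 *\<^sub>R ?e 2 + v $ 3 *\<^sub>R ?e 3)"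
    by (rule arg_cong)
  also have "\<dots> = v $ 1 *\<^sub>R L (?e 1) + v $ 2 *\<^sub>R L (?e 2) + v $ 3 *\<^sub>R L (?e 3)"
    by (simp add: linear_add[OF lin] linear_cmul[OF lin])
  finally show "L v = cross3 (vector [L (?e 2) $ 3, L (?e 3) $ 1, L (?e 1) $ 2]) v"
    using sym[of 1 2] sym[of 2 3] sym[of 3 1] 
    by (simp add: vec_eq_iff forall_3 cross3_def diag vector_3)
qed

text \<open>If the square of an antisymmetric endomorphism of 4-space maps a hyperplane into itself,
  it has a double eigenvalue there. In an orthonormal frame adapted to the hyperplane the
  endomorphism is given by two vectors \<open>c\<close> and \<open>h\<close> (an infinitesimal rotation of the hyperplane
  and the mixing with the normal), and invariance forces them to be parallel.\<close>

lemma antisymmetric_square_on_hyperplane: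
  fixes \<iota> :: "real^3 \<Rightarrow> real^4" and \<Omega> :: "real^4 \<Rightarrow> real^4"
  assumes \<iota>: "linear \<iota>" "\<And>v. norm (\<iota> v) = norm v" and \<Omega>: "antisymmetric_endo \<Omega>"
    and inv: "\<And>v. \<Omega> (\<Omega> (\<iota> v)) \<in> range \<iota>"
  obtains a r e where "\<And>v. \<Omega> (\<Omega> (\<iota> v)) = \<iota> (a *\<^sub>R v + (r * (e \<bullet> v)) *\<^sub>R e)"
proof -
  have lin: "linear \<Omega>" and anti: "\<And>u v. \<Omega> u \<bullet> v = - (u \<bullet> \<Omega> v)"
    using \<Omega> by (auto simp: antisymmetric_endo_def)
  have inner: "\<iota> u \<bullet> \<iota> v = u \<bullet> v" for u v
    by (simp add: dot_norm \<iota>(2) flip: linear_add[OF \<iota>(1)])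
  have adj: "adjoint \<iota> z \<bullet> v = z \<bullet> \<iota> v" "v \<bullet> adjoint \<iota> z = \<iota> v \<bullet> z" for z v
    by (simp_all add: adjoint_works[OF \<iota>(1)] adjoint_clauses[OF \<iota>(1)] inner_commute)
  have ladj: "linear (adjoint \<iota>)" by (rule adjoint_linear[OF \<iota>(1)])
  have inj: "inj \<iota>"
    using \<iota> by (simp add: linear_injective_0) (metis norm_eq_zero)
  have dim_range: "dim (range \<iota>) = 3"
    using dim_image_eq[OF \<iota>(1), of UNIV] inj by simp
  have sub: "subspace (range \<iota>)"
    using linear_subspace_image[OF \<iota>(1) subspace_UNIV] .
  obtain n0 where n0: "n0 \<noteq> 0" "\<And>y. y \<in> span (range \<iota>) \<Longrightarrow> orthogonal n0 y"
    using orthogonal_to_subspace_exists[of "range \<iota>"] dim_range by auto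
  define n where "n = n0 /\<^sub>R norm n0"
  have n1: "n \<bullet> n = 1"
    using n0(1) by (simp add: n_def dot_square_norm power2_eq_square)
  have n\<iota>: "n \<bullet> \<iota> v = 0" for v
    using n0(2)[of "\<iota> v"] by (simp add: n_def orthogonal_def span_base)
  have decomp: "z = \<iota> (adjoint \<iota> z) + (n \<bullet> z) *\<^sub>R n" for z
  proof -
    define r where "r = z - \<iota> (adjoint \<iota> z) - (n \<bullet> z) *\<^sub>R n"
    have r\<iota>: "\<iota> v \<bullet> r = 0" for v
      by (simp add: r_def inner_diff_right inner adj n\<iota> inner_commute[of "\<iota> v" n])
    have rn: "n \<bullet> r = 0"
      by (simp add: r_def inner_diff_right n\<iota> n1)
    have "n \<notin> span (range \<iota>)"
    proof
      assume "n \<in> span (range \<iota>)"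
      then obtain v where "n = \<iota> v" using span_eq_iff sub by (metis imageE)
      then show False using n\<iota>[of v] n1 by simp
    qed
    then have "dim (insert n (range \<iota>)) = 4"
      by (simp add: dim_insert dim_range)
    then have "span (insert n (range \<iota>)) = UNIV"
      by (simp flip: dim_eq_full)
    then have "orthogonal r r"
      by (intro orthogonal_to_span[of r "insert n (range \<iota>)"])
         (auto simp: orthogonal_def rn r\<iota> inner_commute[of r])
    then have "r = 0" by (simp add: orthogonal_self)
    then show ?thesis by (simp add: r_def algebra_simps)
  qed
  have "antisymmetric_endo (\<lambda>v. adjoint \<iota> (\<Omega> (\<iota> v)))"
    unfolding antisymmetric_endo_def
    using linear_compose[OF linear_compose[OF \<iota>(1) lin] ladj]
    by (simp add: o_def adj anti)
  then obtain c where c: "\<And>v. adjoint \<iota> (\<Omega> (\<iota> v)) = cross3 c v"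
    by (rule antisymmetric_endo_cross3) blast
  (* the normal component of the generator on the hyperplane is the functional with vector h *)
  define h where "h = - adjoint \<iota> (\<Omega> n)"
  have \<Omega>n: "\<Omega> n = - \<iota> h"
    using decomp[of "\<Omega> n"] anti[of n n] by (simp add: h_def inner_commute linear_neg[OF \<iota>(1)])
  have \<Omega>\<iota>: "\<Omega> (\<iota> v) = \<iota> (cross3 c v) + (h \<bullet> v) *\<^sub>R n" for v
  proof -
    have "n \<bullet> \<Omega> (\<iota> v) = h \<bullet> v"
      using anti[of n "\<iota> v"] by (simp add: h_def adj)
    then show ?thesis using decomp[of "\<Omega> (\<iota> v)"] by (simp add: c)
  qed
  have \<Omega>\<Omega>: "\<Omega> (\<Omega> (\<iota> v)) = \<iota> (cross3 c (cross3 c v) - (h \<bullet> v) *\<^sub>R h) + (h \<bullet> cross3 c v) *\<^sub>R n" for v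
    unfolding \<Omega>\<iota>[of v] linear_add[OF lin] linear_cmul[OF lin] \<Omega>\<iota>[of "cross3 c v"] \<Omega>n
    by (simp add: linear_diff[OF \<iota>(1)] linear_cmul[OF \<iota>(1)])
  have hc: "h \<bullet> cross3 c v = 0" for v
  proof -
    obtain u where "\<Omega> (\<Omega> (\<iota> v)) = \<iota> u" using inv[of v] by auto
    then have "n \<bullet> (\<iota> (cross3 c (cross3 c v) - (h \<bullet> v) *\<^sub>R h) + (h \<bullet> cross3 c v) *\<^sub>R n) = n \<bullet> \<iota> u"
      using \<Omega>\<Omega>[of v] by simp
    then show ?thesis by (simp add: inner_add_right n\<iota> n1)
  qed
  have S: "\<Omega> (\<Omega> (\<iota> v)) = \<iota> ((c \<bullet> v) *\<^sub>R c - (c \<bullet> c) *\<^sub>R v - (h \<bullet> v) *\<^sub>R h)" for v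
    unfolding \<Omega>\<Omega> by (simp add: hc Lagrange)
  show thesis
  proof (cases "c = 0")
    case True
    show thesis by (rule that[of 0 "-1" h]) (simp add: S True)
  next
    case False
    have "cross3 c h \<bullet> cross3 c h = 0"
    proof -
      have "cross3 c h \<bullet> cross3 c h = - (h \<bullet> cross3 c (cross3 c h))"
        by (simp add: cross3_def inner_vec_def sum_3 vector_3 algebra_simps)
      then show ?thesis by (simp add: hc)
    qed
    then have "cross3 c (cross3 c h) = 0" by simp
    then have h: "(c \<bullet> c) *\<^sub>R h = (c \<bullet> h) *\<^sub>R c" unfolding Lagrange by simp
    define k where "k = (c \<bullet> h) / (c \<bullet> c)"
    have "h = k *\<^sub>R c"
    proof -
      have "h = (1 / (c \<bullet> c)) *\<^sub>R ((c \<bullet> c) *\<^sub>R h)" using False by simp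
      then show ?thesis unfolding h by (simp add: k_def)
    qed
    then show thesis
      by (intro that[of "- (c \<bullet> c)" "1 - k * k" c]) (simp add: S algebra_simps)
  qed
qed

lemma wintner_conley_symmetric:
  assumes m: "\<And>i. m $ i > 0"
  shows "codisp_inner m (wintner_conley G m x \<xi>) \<eta> = codisp_inner m (wintner_conley G m x \<eta>) \<xi>"
proof -
  let ?f = "\<lambda>i j. force_fun G (sq_dist x i j)"
  have eq: "codisp_inner m (wintner_conley G m x \<xi>) \<eta> =
      (\<Sum>k\<in>UNIV. \<Sum>j\<in>UNIV. ?f k j * m $ j * \<xi> $ k * \<eta> $ k / m $ k) - (\<Sum>k\<in>UNIV. \<Sum>j\<in>UNIV. ?f k j * \<xi> $ j * \<eta> $ k)" for \<xi> \<eta>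
  proof -
    have "(?f k j * (m $ j * \<xi> $ k - m $ k * \<xi> $ j)) * \<eta> $ k / m $ k
       = ?f k j * m $ j * \<xi> $ k * \<eta> $ k / m $ k - ?f k j * \<xi> $ j * \<eta> $ k" for j k
      using m[of k] by (simp add: field_simps)
    then show ?thesis
      by (simp add: codisp_inner_def wintner_conley_component sum_distrib_right sum_divide_distrib
          flip: sum_subtractf)
  qed
  have "(\<Sum>k\<in>UNIV. \<Sum>j\<in>UNIV. ?f k j * \<xi> $ j * \<eta> $ k) = (\<Sum>j\<in>UNIV. \<Sum>k\<in>UNIV. ?f k j * \<xi> $ j * \<eta> $ k)"
    by (rule sum.swap)
  also have "\<dots> = (\<Sum>k\<in>UNIV. \<Sum>j\<in>UNIV. ?f k j * \<eta> $ j * \<xi> $ k)"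
    by (simp add: sq_dist_commute mult_ac)
  finally show ?thesis unfolding eq by (simp add: mult_ac)
qed

text \<open>A relative equilibrium forces the Wintner-Conley endomorphism to be a scalar plus rank one,
  hence the force coefficients to be a constant plus an off-diagonal rank one matrix; the
  direction of the rank one part is an eigenvector of the inertia endomorphism.\<close>

theorem relative_equilibrium_forces:
  fixes x :: "real^3^4"
  assumes m: "\<And>i. m $ i > 0" and x: "spatial x" and RE: "admits_relative_equilibrium_R4 G m x"
  obtains \<phi> b p where "\<And>i j. i \<noteq> j \<Longrightarrow> force_fun G (sq_dist x i j) = \<phi> - b * p $ i * p $ j"
    "b \<noteq> 0 \<Longrightarrow> p \<noteq> 0 \<and> weighted m p \<in> codisp \<and> eigen_direction (sq_dist x) m p"
proof -
  let ?A = "wintner_conley G m x"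
  obtain \<iota> :: "real^3 \<Rightarrow> real^4" and \<Omega> where \<iota>: "linear \<iota>" "\<And>v. norm (\<iota> v) = norm v"
    and \<Omega>: "antisymmetric_endo \<Omega>"
    and N: "\<And>\<xi>. \<xi> \<in> codisp \<Longrightarrow> \<Omega> (\<Omega> (\<iota> (config_map x \<xi>))) = 2 *\<^sub>R \<iota> (config_map x (?A \<xi>))"
    using RE unfolding admits_relative_equilibrium_R4_iff by metis
  have surj: "\<exists>\<xi>\<in>codisp. v = config_map x \<xi>" for v
    using spatial_surj[OF x] by blast
  have "\<Omega> (\<Omega> (\<iota> v)) \<in> range \<iota>" for v
    using surj[of v] N by (metis linear_cmul[OF \<iota>(1)] rangeI)
  then obtain a r e where are: "\<And>v. \<Omega> (\<Omega> (\<iota> v)) = \<iota> (a *\<^sub>R v + (r * (e \<bullet> v)) *\<^sub>R e)"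
    using antisymmetric_square_on_hyperplane[OF \<iota> \<Omega>] by metis
  obtain w where w: "w \<in> codisp" "e = config_map x w"
    using surj by blast
  have A: "?A \<xi> = (a / 2) *\<^sub>R \<xi> + (r / 2 * (e \<bullet> config_map x \<xi>)) *\<^sub>R w" if \<xi>: "\<xi> \<in> codisp" for \<xi>
  proof -
    let ?d = "?A \<xi> - ((a / 2) *\<^sub>R \<xi> + (r / 2 * (e \<bullet> config_map x \<xi>)) *\<^sub>R w)"
    have "\<iota> (2 *\<^sub>R config_map x (?A \<xi>)) = \<iota> (a *\<^sub>R config_map x \<xi> + (r * (e \<bullet> config_map x \<xi>)) *\<^sub>R e)"
      using N[OF \<xi>] are by (simp add: linear_cmul[OF \<iota>(1)])
    then have "norm (\<iota> (2 *\<^sub>R config_map x (?A \<xi>) - (a *\<^sub>R config_map x \<xi> + (r * (e \<bullet> config_map x \<xi>)) *\<^sub>R e))) = 0"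
      by (simp only: linear_diff[OF \<iota>(1)] right_minus_eq norm_eq_zero)
    then have eq: "2 *\<^sub>R config_map x (?A \<xi>) = a *\<^sub>R config_map x \<xi> + (r * (e \<bullet> config_map x \<xi>)) *\<^sub>R e"
      by (simp only: \<iota>(2) norm_eq_zero right_minus_eq)
    have "config_map x (2 *\<^sub>R ?d) = 2 *\<^sub>R config_map x (?A \<xi>)
        - (a *\<^sub>R config_map x \<xi> + (r * (e \<bullet> config_map x \<xi>)) *\<^sub>R config_map x w)"
      by (simp add: linear_diff[OF linear_config_map] linear_add[OF linear_config_map]
          linear_cmul[OF linear_config_map] algebra_simps)
    then have "config_map x (2 *\<^sub>R ?d) = 0"
      unfolding eq w(2)[symmetric] by simp
    moreover have "2 *\<^sub>R ?d \<in> codisp"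
      by (intro subspace_scale subspace_diff subspace_add subspace_codisp wintner_conley_codisp \<xi> w)
    ultimately have "2 *\<^sub>R ?d = 0" using x by (auto simp only: spatial_def)
    then show ?thesis by simp
  qed
  define p where "p = (\<chi> i. w $ i / m $ i)"
  have wp: "w = weighted m p"
    using m by (simp add: p_def weighted_def vec_eq_iff) (metis less_irrefl nonzero_mult_div_cancel_left times_divide_eq_right)
  have wi: "codisp_inner m w \<eta> = p \<bullet> \<eta>" for \<eta>
    unfolding wp by (rule codisp_inner_weighted[OF m])
  have key: "\<exists>b. (\<forall>\<xi>\<in>codisp. ?A \<xi> = (a / 2) *\<^sub>R \<xi> + (b * (p \<bullet> \<xi>)) *\<^sub>R w) \<and>
      (b \<noteq> 0 \<longrightarrow> p \<noteq> 0 \<and> eigen_direction (sq_dist x) m p)"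
  proof (cases "r = 0 \<or> w = 0")
    case True
    then show ?thesis using A by (intro exI[of _ 0]) auto
  next
    case False
    have p0: "p \<noteq> 0"
      using False by (auto simp: wp weighted_def vec_eq_iff)
    have e0: "e \<bullet> e > 0"
      using x w False by (auto simp: spatial_def)
    have pw: "p \<bullet> w > 0"
    proof -
      have "p \<bullet> w = (\<Sum>i\<in>UNIV. (w $ i)\<^sup>2 / m $ i)"
        by (simp add: p_def inner_vec_def power2_eq_square)
      also obtain i where "w $ i \<noteq> 0" using False by (auto simp: vec_eq_iff)
      then have "(\<Sum>i\<in>UNIV. (w $ i)\<^sup>2 / m $ i) > 0"
        using m by (intro sum_pos2[of _ i]) (auto simp: less_imp_le)
      finally show ?thesis .
    qed
    define \<sigma> where "\<sigma> = (e \<bullet> e) / (p \<bullet> w)"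
    have ex: "e \<bullet> config_map x \<xi> = \<sigma> * (p \<bullet> \<xi>)" if \<xi>: "\<xi> \<in> codisp" for \<xi>
    proof -
      have lin: "codisp_inner m (u *\<^sub>R \<xi> + v *\<^sub>R \<eta>) \<zeta> = u * codisp_inner m \<xi> \<zeta> + v * codisp_inner m \<eta> \<zeta>" for u v \<xi> \<eta> \<zeta>
        by (simp add: codisp_inner_def algebra_simps add_divide_distrib sum.distrib sum_distrib_left)
      have sym: "codisp_inner m u v = codisp_inner m v u" for u v
        by (simp add: codisp_inner_def mult.commute)
      have "r / 2 * (e \<bullet> config_map x \<xi>) * (p \<bullet> w) = r / 2 * (e \<bullet> e) * (p \<bullet> \<xi>)"
        using wintner_conley_symmetric[OF m, of G x \<xi> w]
        unfolding A[OF \<xi>] A[OF w(1)] lin wi sym[of \<xi> w] w(2)[symmetric] by simp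
      then show ?thesis
        using False pw by (simp add: \<sigma>_def field_simps)
    qed
    have "eigen_direction (sq_dist x) m p"
    proof -
      let ?g = "\<lambda>i. (\<Sum>j\<in>UNIV. sq_dist x i j * (m $ j * p $ j)) + 2 * \<sigma> * p $ i"
      have "(\<Sum>i\<in>UNIV. ?g i * \<xi> $ i) = 0" if \<xi>: "\<xi> \<in> codisp" for \<xi>
      proof -
        have "config_map x \<xi> \<bullet> config_map x w =
            - (\<Sum>i\<in>UNIV. (\<Sum>j\<in>UNIV. sq_dist x i j * (m $ j * p $ j)) * \<xi> $ i) / 2"
          unfolding config_map_inner[OF \<xi> w(1)]
          by (simp add: wp weighted_def sum_distrib_right sum_distrib_left mult_ac)
        moreover have "config_map x \<xi> \<bullet> config_map x w = \<sigma> * (p \<bullet> \<xi>)"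
          using ex[OF \<xi>] w(2) by (simp add: inner_commute)
        moreover have "(\<Sum>i\<in>UNIV. ?g i * \<xi> $ i) =
            (\<Sum>i\<in>UNIV. (\<Sum>j\<in>UNIV. sq_dist x i j * (m $ j * p $ j)) * \<xi> $ i) + 2 * (\<sigma> * (p \<bullet> \<xi>))"
          by (simp add: distrib_right sum.distrib inner_vec_def mult.assoc flip: sum_distrib_left)
        ultimately show ?thesis by simp
      qed
      then have "?g i = ?g 1" for i by (rule codisp_orthogonal_const)
      then have "(\<Sum>j\<in>UNIV. sq_dist x i j * (m $ j * p $ j)) = (- 2 * \<sigma>) * p $ i + ?g 1" for i
        by (simp add: algebra_simps)
      then show ?thesis unfolding eigen_direction_def by blast
    qed
    then show ?thesis
      using A p0 ex by (intro exI[of _ "r / 2 * \<sigma>"]) (auto simp: mult.assoc)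
  qed
  then obtain b where b: "\<And>\<xi>. \<xi> \<in> codisp \<Longrightarrow> ?A \<xi> = (a / 2) *\<^sub>R \<xi> + (b * (p \<bullet> \<xi>)) *\<^sub>R w"
    "b \<noteq> 0 \<Longrightarrow> p \<noteq> 0 \<and> eigen_direction (sq_dist x) m p" by blast
  let ?F = "\<lambda>i j. force_fun G (sq_dist x i j) + b * p $ i * p $ j"
  (* testing with the codisposition of two bodies k, l and reading off the component of a third *)
  have share: "?F i k = ?F i l" if "i \<noteq> k" "i \<noteq> l" for i k l
  proof -
    have "?A (axis k 1 - axis l 1) $ i = - m $ i * (force_fun G (sq_dist x i k) - force_fun G (sq_dist x i l))"
    proof -
      have "?A (axis k 1 - axis l 1) $ i =
          (\<Sum>j\<in>UNIV. (- m $ i * force_fun G (sq_dist x i j)) * (axis k 1 - axis l 1 :: real^4) $ j)"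
        unfolding wintner_conley_component using that by (intro sum.cong refl) (simp add: axis_def)
      then show ?thesis unfolding sum_axis_diff by (simp add: algebra_simps)
    qed
    moreover have "?A (axis k 1 - axis l 1) $ i = b * (p $ k - p $ l) * (m $ i * p $ i)"
      using that unfolding b(1)[OF axis_diff_codisp]
      by (simp add: axis_def inner_diff_right inner_axis wp weighted_def)
         (simp add: inner_axis flip: axis_def)
    ultimately have "m $ i * (force_fun G (sq_dist x i l) - force_fun G (sq_dist x i k)) = m $ i * (b * (p $ k - p $ l) * p $ i)"
      by (simp add: algebra_simps)
    then have "force_fun G (sq_dist x i l) - force_fun G (sq_dist x i k) = b * (p $ k - p $ l) * p $ i"
      using m[of i] by simp
    then show ?thesis by (simp add: algebra_simps)
  qed
  have sym: "?F i j = ?F j i" for i j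
    by (simp add: sq_dist_commute)
  have all: "?F i j = ?F 1 2" if "i \<noteq> j" for i j
    (* move one end of the edge at a time *)
  proof (cases "i = 1")
    case True
    then show ?thesis using share[of 1 j 2] that by simp
  next
    case False
    have "?F i j = ?F i 1" using share[of i j 1] that False by simp
    also have "\<dots> = ?F 1 2" using sym[of i 1] share[of 1 i 2] False by simp
    finally show ?thesis .
  qed
  show thesis
  proof (rule that[of "?F 1 2" b p])
    show "force_fun G (sq_dist x i j) = ?F 1 2 - b * p $ i * p $ j" if "i \<noteq> j" for i j
      using all[OF that] by simp
    show "p \<noteq> 0 \<and> weighted m p \<in> codisp \<and> eigen_direction (sq_dist x) m p" if "b \<noteq> 0"
      using b(2)[OF that] w(1) wp by simp
  qed
qed

section \<open>Shape parameters\<close>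

lemma one_plus_powr_lipschitz:
  fixes y z :: real
  assumes "\<bar>y\<bar> \<le> 1/2" "\<bar>z\<bar> \<le> 1/2"
  shows "\<bar>(1 + y) powr (- 2 / 3) - (1 + z) powr (- 2 / 3)\<bar> \<le> 4 * \<bar>y - z\<bar>"
proof -
  let ?f = "\<lambda>u::real. (1 + u) powr (- 2 / 3)"
  have "norm (?f y - ?f z) \<le> 4 * norm (y - z)"
  proof (rule field_differentiable_bound[where S = "{-1/2..1/2}" and f' = "\<lambda>u. - 2 / 3 * (1 + u) powr (- 5 / 3)"])
    fix u :: real assume u: "u \<in> {-1/2..1/2}"
    have "(?f has_real_derivative (- 2 / 3) * (1 + u) powr (- 2 / 3 - 1) * 1) (at u)"
      using u by (intro DERIV_chain2[where f = "\<lambda>x. x powr (- 2 / 3)"] has_real_derivative_powr)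
        (auto intro!: derivative_eq_intros)
    then show "(?f has_field_derivative - 2 / 3 * (1 + u) powr (- 5 / 3)) (at u within {-1/2..1/2})"
      by (auto intro: DERIV_subset)
    have "(1 + u) powr (- 5 / 3) \<le> (1/2) powr (- 5 / 3)"
      using u by (intro powr_mono2') auto
    also have "\<dots> \<le> (1/2) powr (- 2)"
      by (rule powr_mono') auto
    also have "(1/2::real) powr (- 2) = 4"
      by (simp add: powr_minus powr_numeral power2_eq_square)
    finally show "norm (- 2 / 3 * (1 + u) powr (- 5 / 3)) \<le> 4"
      by simp
  qed (use assms in auto)
  then show ?thesis by simp
qed

lemma one_plus_powr_near_1:
  fixes z :: real
  assumes "\<bar>z\<bar> \<le> 1/2"
  shows "\<bar>(1 + z) powr (- 2 / 3) - 1\<bar> \<le> 4 * \<bar>z\<bar>"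
  using one_plus_powr_lipschitz[of z 0] assms by simp

text \<open>Since \<open>\<Sum> m\<^sub>i p\<^sub>i = 0\<close> the components cannot all have the same strict sign, and among three
  of them two have the same weak sign. Hence a constant plus an off-diagonal rank one matrix takes
  values on both sides of the constant.\<close>

lemma weighted_codisp_signs:
  assumes m: "\<And>i. m $ i > 0" and w: "weighted m p \<in> codisp"
  obtains i j k l :: 4 where "i \<noteq> j" "p $ i * p $ j \<le> 0" "k \<noteq> l" "p $ k * p $ l \<ge> 0"
proof -
  have "\<exists>j. 1 \<noteq> j \<and> p $ 1 * p $ j \<le> 0"
  proof (rule ccontr)
    assume "\<not> ?thesis"
    then have pos: "p $ 1 * p $ j > 0" if "j \<noteq> 1" for j
      using that by (metis not_le)
    have "0 < (\<Sum>j\<in>UNIV. m $ j * (p $ 1 * p $ j))"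
    proof (rule sum_pos2[of _ 2])
      show "0 < m $ 2 * (p $ 1 * p $ 2)"
        using pos[of 2] m[of 2] by simp
      show "0 \<le> m $ j * (p $ 1 * p $ j)" for j
        using pos[of j] m[of j] by (cases "j = 1") (auto simp: less_imp_le)
    qed auto
    also have "\<dots> = p $ 1 * (\<Sum>j\<in>UNIV. weighted m p $ j)"
      by (simp add: weighted_def sum_distrib_left mult_ac)
    also have "\<dots> = 0" using w by (simp add: codisp_iff)
    finally show False by simp
  qed
  moreover have "\<exists>k l. k \<noteq> l \<and> p $ k * p $ l \<ge> 0"
  proof (rule ccontr)
    assume "\<not> ?thesis"
    then have neg: "k \<noteq> l \<Longrightarrow> p $ k * p $ l < 0" for k l
      by (metis not_le)
    have "p $ 1 * p $ 2 < 0" "p $ 1 * p $ 3 < 0" "p $ 2 * p $ 3 < 0"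
      using neg by auto
    then show False by (auto simp: mult_less_0_iff)
  qed
  ultimately show thesis using that by blast
qed

text \<open>The constant part of the force coefficients lies between two of them, so that nearly equal
  distances (ratios of squares at most \<open>q\<close>) make the rank one part small.\<close>

theorem shape_of_relative_equilibrium:
  fixes x :: "real^3^4"
  assumes G: "G > 0" and m: "\<And>i. m $ i > 0" and x: "spatial x" and nc: "noncollision x"
    and RE: "admits_relative_equilibrium_R4 G m x"
    and ratio: "\<And>i j k l. i \<noteq> j \<Longrightarrow> k \<noteq> l \<Longrightarrow> sq_dist x i j \<le> q * sq_dist x k l"
  obtains \<kappa> \<beta> p where "\<kappa> > 0" "\<And>i j. sq_dist x i j = \<kappa> * shape \<beta> p i j"
    "\<And>i j. i \<noteq> j \<Longrightarrow> 1 + \<beta> * p $ i * p $ j > 0"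
    "\<And>i j. i \<noteq> j \<Longrightarrow> \<bar>\<beta> * p $ i * p $ j\<bar> \<le> q\<^sup>2 - 1"
    "\<beta> \<noteq> 0 \<Longrightarrow> p \<noteq> 0 \<and> weighted m p \<in> codisp \<and> eigen_direction (shape \<beta> p) m p"
proof -
  obtain \<phi> b p where f: "\<And>i j. i \<noteq> j \<Longrightarrow> force_fun G (sq_dist x i j) = \<phi> - b * p $ i * p $ j"
    and b: "b \<noteq> 0 \<Longrightarrow> p \<noteq> 0 \<and> weighted m p \<in> codisp \<and> eigen_direction (sq_dist x) m p"
    using relative_equilibrium_forces[OF m x RE] by metis
  have s: "sq_dist x i j > 0" if "i \<noteq> j" for i j
    using nc that by (simp add: noncollision_iff_sq_dist)
  have q1: "q \<ge> 1"
    using ratio[of 1 2 1 2] s[of 1 2] by simp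
  define F where "F i j = G / 2 * sq_dist x i j powr (- 3 / 2)" for i j
  have F: "F i j > 0" if "i \<noteq> j" for i j
    using s[OF that] G by (simp add: F_def)
  have Fq: "F i j \<le> q\<^sup>2 * F k l" if "i \<noteq> j" "k \<noteq> l" for i j k l
  proof -
    have "(q * sq_dist x i j) powr (- 3 / 2) \<le> sq_dist x k l powr (- 3 / 2)"
      using ratio[of k l i j] s that by (intro powr_mono2') auto
    then have "q powr (- 3 / 2) * sq_dist x i j powr (- 3 / 2) \<le> sq_dist x k l powr (- 3 / 2)"
      using q1 s[of i j] that by (simp add: powr_mult)
    then have "q powr 2 * (q powr (- 3 / 2) * sq_dist x i j powr (- 3 / 2)) \<le> q powr 2 * sq_dist x k l powr (- 3 / 2)"
      by (intro mult_left_mono) auto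
    moreover have "q powr 2 * q powr (- 3 / 2) = q powr (1 / 2)"
      by (simp flip: powr_add)
    ultimately have "q powr (1 / 2) * sq_dist x i j powr (- 3 / 2) \<le> q powr 2 * sq_dist x k l powr (- 3 / 2)"
      by (simp only: mult.assoc[symmetric])
    moreover have "1 * sq_dist x i j powr (- 3 / 2) \<le> q powr (1 / 2) * sq_dist x i j powr (- 3 / 2)"
      using q1 by (intro mult_right_mono) (auto simp: ge_one_powr_ge_zero)
    ultimately have "sq_dist x i j powr (- 3 / 2) \<le> q powr 2 * sq_dist x k l powr (- 3 / 2)"
      by simp
    then show ?thesis using G q1 by (simp add: F_def powr_numeral)
  qed
  have Fb: "F i j = - \<phi> + b * p $ i * p $ j" if "i \<noteq> j" for i j
    using f[OF that] force_fun_eq[OF s[OF that], of G] by (simp add: F_def)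
  obtain i j k l :: 4 where ij: "i \<noteq> j" "- \<phi> \<le> F i j" and kl: "k \<noteq> l" "F k l \<le> - \<phi>"
  proof (cases "b = 0")
    case True
    then show thesis using that[of 1 2 1 2] Fb[of 1 2] by simp
  next
    case False
    then obtain i j k l :: 4 where *: "i \<noteq> j" "p $ i * p $ j \<le> 0" "k \<noteq> l" "p $ k * p $ l \<ge> 0"
      using weighted_codisp_signs[OF m] b by metis
    show thesis
    proof (cases "b > 0")
      case True
      then have "b * (p $ i * p $ j) \<le> 0" "b * (p $ k * p $ l) \<ge> 0"
        using * by (auto simp: mult_nonneg_nonpos)
      then show thesis using that[of k l i j] Fb[of i j] Fb[of k l] * by (simp add: mult.assoc)
    next
      case False
      then have "b * (p $ i * p $ j) \<ge> 0" "b * (p $ k * p $ l) \<le> 0"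
        using * by (auto simp: mult_nonpos_nonneg mult_nonpos_nonpos)
      then show thesis using that[of i j k l] Fb[of i j] Fb[of k l] * by (simp add: mult.assoc)
    qed
  qed
  define F0 where "F0 = - \<phi>"
  have F0: "F0 > 0" using F[OF kl(1)] kl(2) by (simp add: F0_def)
  define \<beta> where "\<beta> = b / F0"
  define \<kappa> where "\<kappa> = (2 * F0 / G) powr (- 2 / 3)"
  have \<kappa>: "\<kappa> > 0" using F0 G by (simp add: \<kappa>_def)
  have one: "1 + \<beta> * p $ i * p $ j = F i j / F0" if "i \<noteq> j" for i j
  proof -
    have "F i j = F0 + b * p $ i * p $ j"
      using Fb[OF that] by (simp add: F0_def)
    then show ?thesis
      using F0 by (simp add: \<beta>_def add_divide_distrib)
  qed
  have sq: "sq_dist x i j = \<kappa> * shape \<beta> p i j" for i j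
  proof (cases "i = j")
    case False
    have "(2 * F i j / G) powr (- 2 / 3) = sq_dist x i j"
      using G s[OF False] by (simp add: F_def powr_powr)
    moreover have "2 * F i j / G = (2 * F0 / G) * (F i j / F0)"
      using F0 by simp
    ultimately have "sq_dist x i j = ((2 * F0 / G) * (F i j / F0)) powr (- 2 / 3)" by simp
    also have "\<dots> = \<kappa> * shape \<beta> p i j"
      using False F0 G F[OF False] by (subst powr_mult) (auto simp: \<kappa>_def shape_def one[OF False])
    finally show ?thesis .
  qed (simp add: shape_def)
  show thesis
  proof (rule that[OF \<kappa> sq])
    fix i' j' :: 4 assume ne: "i' \<noteq> j'"
    show "1 + \<beta> * p $ i' * p $ j' > 0"
      unfolding one[OF ne] using F[OF ne] F0 by simp
    have "F i' j' \<le> q\<^sup>2 * F0"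
      using Fq[OF ne kl(1)] mult_left_mono[OF kl(2), of "q\<^sup>2"] by (simp add: F0_def)
    then have up: "F i' j' / F0 \<le> q\<^sup>2"
      using F0 by (simp add: field_simps)
    have "F0 \<le> q\<^sup>2 * F i' j'"
      using Fq[OF ij(1) ne] ij(2) by (simp add: F0_def)
    then have "1 \<le> q\<^sup>2 * (F i' j' / F0)"
      using F0 by (simp add: field_simps)
    moreover have "0 \<le> (q\<^sup>2 - 1) * (q\<^sup>2 - 1)" by simp
    ultimately have "q\<^sup>2 * 2 \<le> q\<^sup>2 * (q\<^sup>2 + F i' j' / F0)"
      by (simp add: algebra_simps)
    then have "1 - F i' j' / F0 \<le> q\<^sup>2 - 1"
      using q1 by (subst (asm) mult_le_cancel_left_pos) auto
    then show "\<bar>\<beta> * p $ i' * p $ j'\<bar> \<le> q\<^sup>2 - 1"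
      using up one[OF ne] by simp
  next
    assume "\<beta> \<noteq> 0"
    then have "b \<noteq> 0" by (auto simp: \<beta>_def)
    note b = b[OF this]
    then obtain l c where lc: "\<And>i. (\<Sum>j\<in>UNIV. sq_dist x i j * (m $ j * p $ j)) = l * p $ i + c"
      unfolding eigen_direction_def by blast
    have "(\<Sum>j\<in>UNIV. shape \<beta> p i j * (m $ j * p $ j)) = (l / \<kappa>) * p $ i + c / \<kappa>" for i
      using lc[of i] \<kappa> by (simp add: sq mult.assoc field_simps flip: sum_distrib_left)
    then show "p \<noteq> 0 \<and> weighted m p \<in> codisp \<and> eigen_direction (shape \<beta> p) m p"
      using b unfolding eigen_direction_def by blast
  qed
qed

text \<open>Proportional shapes have the same rank one part: constants with off-diagonal rank one
  perturbations are proportional only if they coincide.\<close>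

lemma shape_unique:
  assumes m: "\<And>i. m $ i > 0" and wp: "weighted m p \<in> codisp" and wq: "weighted m q \<in> codisp"
    and pos: "\<And>i j. i \<noteq> j \<Longrightarrow> 1 + \<beta> * p $ i * p $ j > 0" "\<And>i j. i \<noteq> j \<Longrightarrow> 1 + \<beta>' * q $ i * q $ j > 0"
    and \<kappa>: "\<kappa> > 0" and eq: "\<And>i j. shape \<beta> p i j = \<kappa> * shape \<beta>' q i j"
  shows "\<beta> * p $ i * p $ j = \<beta>' * q $ i * q $ j"
proof -
  define k where "k = \<kappa> powr (- 3 / 2)"
  have k: "1 + \<beta> * p $ i * p $ j = k * (1 + \<beta>' * q $ i * q $ j)" if "i \<noteq> j" for i j
  proof -
    have "shape \<beta> p i j powr (- 3 / 2) = 1 + \<beta> * p $ i * p $ j"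
      "shape \<beta>' q i j powr (- 3 / 2) = 1 + \<beta>' * q $ i * q $ j"
      using that pos[OF that] by (simp_all add: shape_def powr_powr)
    moreover have "shape \<beta> p i j powr (- 3 / 2) = k * shape \<beta>' q i j powr (- 3 / 2)"
      unfolding eq k_def using \<kappa> by (simp add: powr_mult shape_def)
    ultimately show ?thesis by simp
  qed
  have "dim {1, p, q} \<le> card {1, p, q}"
    by (rule dim_le_card') auto
  also have "\<dots> < 4"
    by (simp add: card_insert_if)
  finally obtain u where u: "u \<noteq> 0" "\<And>y. y \<in> span {1, p, q} \<Longrightarrow> orthogonal u y"
    using orthogonal_to_subspace_exists[of "{1, p, q}"] by auto
  have "orthogonal u 1" "orthogonal u p" "orthogonal u q"
    by (rule u(2)[OF span_base], simp)+
  then have uc: "u \<in> codisp" and up: "p \<bullet> u = 0" and uq: "q \<bullet> u = 0"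
    by (auto simp: orthogonal_def codisp_iff inner_vec_def mult.commute)
  obtain l where l: "u $ l \<noteq> 0" using u(1) by (auto simp: vec_eq_iff)
  let ?M = "\<Sum>i\<in>UNIV. m $ i"
  have M: "?M > 0" using m by (intro sum_pos) auto
  have "?M * u $ l = (\<Sum>j\<in>UNIV. (1 + \<beta> * p $ l * p $ j) * (m $ j * u $ l - m $ l * u $ j))"
    using rank_one_sum[OF wp uc] by (simp add: up)
  also have "\<dots> = (\<Sum>j\<in>UNIV. k * ((1 + \<beta>' * q $ l * q $ j) * (m $ j * u $ l - m $ l * u $ j)))"
  proof (rule sum.cong[OF refl])
    fix j show "(1 + \<beta> * p $ l * p $ j) * (m $ j * u $ l - m $ l * u $ j) =
        k * ((1 + \<beta>' * q $ l * q $ j) * (m $ j * u $ l - m $ l * u $ j))"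
      using k[of l j] by (cases "l = j") auto
  qed
  also have "\<dots> = k * (?M * u $ l)"
    using rank_one_sum[OF wq uc] by (simp add: uq flip: sum_distrib_left)
  (* comparing the scalar parts on a codisposition annihilated by both directions *)
  finally have "k = 1" using M l by simp
  then have off: "\<beta> * p $ i * p $ j = \<beta>' * q $ i * q $ j" if "i \<noteq> j" for i j
    using k[OF that] by simp
  (* the condition on weighted sums recovers the diagonal from the rest of its row *)
  have diag: "m $ i * (\<beta> * p $ i * p $ i) = - (\<Sum>j\<in>UNIV-{i}. m $ j * (\<beta> * p $ i * p $ j))"
    if "weighted m p \<in> codisp" for i \<beta> p
  proof -
    have "(\<Sum>j\<in>UNIV. m $ j * (\<beta> * p $ i * p $ j)) = \<beta> * p $ i * (\<Sum>j\<in>UNIV. weighted m p $ j)"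
      by (simp add: weighted_def sum_distrib_left mult_ac)
    then have "(\<Sum>j\<in>UNIV. m $ j * (\<beta> * p $ i * p $ j)) = 0"
      using that by (simp add: codisp_iff)
    then show ?thesis
      by (simp add: sum.remove[of UNIV i])
  qed
  show ?thesis
  proof (cases "i = j")
    case True
    have "(\<Sum>j\<in>UNIV-{i}. m $ j * (\<beta> * p $ i * p $ j)) = (\<Sum>j\<in>UNIV-{i}. m $ j * (\<beta>' * q $ i * q $ j))"
      by (intro sum.cong refl) (auto simp: off)
    then have "m $ i * (\<beta> * p $ i * p $ i) = m $ i * (\<beta>' * q $ i * q $ i)"
      using diag[OF wp, of i \<beta>] diag[OF wq, of i \<beta>'] by simp
    then show ?thesis using True m[of i] by simp
  qed (rule off)
qed

section \<open>Realising shapes by configurations\<close>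

text \<open>Gram matrix of the positions of bodies 1, 2, 3 relative to body 4, in terms of the squared
  distances. The entries of its Cholesky factor give a configuration depending continuously on the
  squared distances.\<close>

definition chol_gram :: "(4 \<Rightarrow> 4 \<Rightarrow> real) \<Rightarrow> 4 \<Rightarrow> 4 \<Rightarrow> real" where
  "chol_gram s i j = (s i 4 + s j 4 - s i j) / 2"

definition chol11 where "chol11 s = sqrt (chol_gram s 1 1)"
definition chol21 where "chol21 s = chol_gram s 1 2 / chol11 s"
definition chol22 where "chol22 s = sqrt (chol_gram s 2 2 - (chol21 s)\<^sup>2)"
definition chol31 where "chol31 s = chol_gram s 1 3 / chol11 s"
definition chol32 where "chol32 s = (chol_gram s 2 3 - chol21 s * chol31 s) / chol22 s"
definition chol33 where "chol33 s = sqrt (chol_gram s 3 3 - (chol31 s)\<^sup>2 - (chol32 s)\<^sup>2)"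

text \<open>Body 4 is at the origin, and bodies 1, 2, 3 are the rows of the Cholesky factor.\<close>

definition chol_config :: "(4 \<Rightarrow> 4 \<Rightarrow> real) \<Rightarrow> real^3^4" where
  "chol_config s = (\<chi> i. if i = 1 then chol11 s *\<^sub>R axis 1 1
     else if i = 2 then chol21 s *\<^sub>R axis 1 1 + chol22 s *\<^sub>R axis 2 1
     else if i = 3 then chol31 s *\<^sub>R axis 1 1 + chol32 s *\<^sub>R axis 2 1 + chol33 s *\<^sub>R axis 3 1
     else 0)"

text \<open>Symmetric matrices of squared distances close to those of the unit regular tetrahedron; the
  tolerance is small enough for the Gram matrix to be positive definite.\<close>

definition nearly_unit :: "(4 \<Rightarrow> 4 \<Rightarrow> real) \<Rightarrow> bool" where
  "nearly_unit s \<longleftrightarrow> (\<forall>i. s i i = 0) \<and> (\<forall>i j. s i j = s j i) \<and> (\<forall>i j. i \<noteq> j \<longrightarrow> \<bar>s i j - 1\<bar> \<le> 1 / 100)"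

lemma chol_bounds:
  assumes "nearly_unit s"
  shows "chol_gram s 1 1 > 0" "chol_gram s 2 2 - (chol21 s)\<^sup>2 > 0"
    "chol_gram s 3 3 - (chol31 s)\<^sup>2 - (chol32 s)\<^sup>2 > 0"
proof -
  have d: "s i i = 0" "s i j = s j i" "i \<noteq> j \<Longrightarrow> \<bar>s i j - 1\<bar> \<le> 1 / 100" for i j
    using assms by (auto simp: nearly_unit_def)
  have e: "i \<noteq> j \<Longrightarrow> 99/100 \<le> s i j" "i \<noteq> j \<Longrightarrow> s i j \<le> 101/100" for i j
    using d(3)[of i j] unfolding abs_le_iff by auto
  note e' = e[of 1 4] e[of 2 4] e[of 3 4] e[of 1 2] e[of 1 3] e[of 2 3]
  let ?K = "chol_gram s"
  have K: "?K 1 1 \<ge> 99/100" "?K 1 1 \<le> 101/100" "?K 2 2 \<ge> 99/100" "?K 3 3 \<ge> 99/100"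
    using e' by (simp_all add: chol_gram_def d(1))
  have o: "\<bar>?K 1 2 - 1/2\<bar> \<le> 15/1000" "\<bar>?K 1 3 - 1/2\<bar> \<le> 15/1000" "\<bar>?K 2 3 - 1/2\<bar> \<le> 15/1000"
    using e' unfolding abs_le_iff by (simp_all add: chol_gram_def)
  show K1: "?K 1 1 > 0" using K by simp
  have prod: "u * v / ?K 1 1 \<ge> 23/100" "u * v / ?K 1 1 \<le> 27/100"
    if "\<bar>u - 1/2\<bar> \<le> 15/1000" "\<bar>v - 1/2\<bar> \<le> 15/1000" for u v
  proof -
    have u: "485/1000 \<le> u" "u \<le> 515/1000" "485/1000 \<le> v" "v \<le> 515/1000"
      using that unfolding abs_le_iff by auto
    have "485/1000 * (485/1000) \<le> u * v" "u * v \<le> 515/1000 * (515/1000)"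
      by (intro mult_mono; use u in simp)+
    then show "u * v / ?K 1 1 \<ge> 23/100" "u * v / ?K 1 1 \<le> 27/100"
      using K by (simp_all add: field_simps)
  qed
  have sq: "chol11 s * chol11 s = ?K 1 1" using K1 by (simp add: chol11_def)
  have l: "(chol21 s)\<^sup>2 = ?K 1 2 * ?K 1 2 / ?K 1 1" "(chol31 s)\<^sup>2 = ?K 1 3 * ?K 1 3 / ?K 1 1"
    "chol21 s * chol31 s = ?K 1 2 * ?K 1 3 / ?K 1 1"
    by (simp_all add: chol21_def chol31_def power2_eq_square sq)
  have b22: "?K 2 2 - (chol21 s)\<^sup>2 \<ge> 72/100"
    using prod(2)[OF o(1) o(1)] K by (simp add: l)
  then show "?K 2 2 - (chol21 s)\<^sup>2 > 0" by simp
  have "(chol22 s)\<^sup>2 = ?K 2 2 - (chol21 s)\<^sup>2"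
    using b22 by (simp add: chol22_def)
  then have "(chol32 s)\<^sup>2 = (?K 2 3 - chol21 s * chol31 s)\<^sup>2 / (?K 2 2 - (chol21 s)\<^sup>2)"
    by (simp add: chol32_def power_divide)
  also have "\<dots> \<le> (3/10)\<^sup>2 / (72/100)"
  proof (intro frac_le power_mono)
    show "?K 2 3 - chol21 s * chol31 s \<le> 3/10" "0 \<le> ?K 2 3 - chol21 s * chol31 s"
      using prod[OF o(1) o(2)] o(3) unfolding l abs_le_iff by linarith+
  qed (use b22 in auto)
  finally have "(chol32 s)\<^sup>2 \<le> 1/8" by (simp add: power2_eq_square)
  then show "?K 3 3 - (chol31 s)\<^sup>2 - (chol32 s)\<^sup>2 > 0"
    using K prod(2)[OF o(2) o(2)] by (simp add: l)
qed

lemma chol_config_sq_dist: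
  assumes "nearly_unit s"
  shows "sq_dist (chol_config s) i j = s i j"
proof -
  have d: "s i i = 0" "s i j = s j i" for i j
    using assms by (auto simp: nearly_unit_def)
  let ?K = "chol_gram s"
  note b = chol_bounds[OF assms]
  have 11: "chol11 s * chol11 s = ?K 1 1" using b(1) by (simp add: chol11_def)
  have 22: "chol22 s * chol22 s = ?K 2 2 - chol21 s * chol21 s"
    using b(2) by (simp add: chol22_def power2_eq_square)
  have 33: "chol33 s * chol33 s = ?K 3 3 - chol31 s * chol31 s - chol32 s * chol32 s"
    using b(3) by (simp add: chol33_def power2_eq_square)
  have 0: "chol11 s \<noteq> 0" "chol22 s \<noteq> 0" using b by (auto simp: chol11_def chol22_def)
  have 12: "chol11 s * chol21 s = ?K 1 2" "chol11 s * chol31 s = ?K 1 3"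
    "chol22 s * chol32 s = ?K 2 3 - chol21 s * chol31 s"
    using 0 by (simp_all add: chol21_def chol31_def chol32_def)
  have K: "?K 1 1 = s 1 4" "?K 2 2 = s 2 4" "?K 3 3 = s 3 4"
    "2 * ?K 1 2 = s 1 4 + s 2 4 - s 1 2" "2 * ?K 1 3 = s 1 4 + s 3 4 - s 1 3" "2 * ?K 2 3 = s 2 4 + s 3 4 - s 2 3"
    by (simp_all add: chol_gram_def d(1))
  have ax: "axis (a::3) (1::real) $ b = (if b = a then 1 else 0)" for a b by (simp add: axis_def)
  have sq: "sq_dist x i j = (x $ i $ 1 - x $ j $ 1)\<^sup>2 + (x $ i $ 2 - x $ j $ 2)\<^sup>2 + (x $ i $ 3 - x $ j $ 3)\<^sup>2"
    for x :: "real^3^4" and i j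
    by (simp add: sq_dist_def dist_norm power2_norm_eq_inner inner_vec_def sum_3) (simp add: power2_eq_square)
  let ?c = "chol_config s"
  have c: "?c $ 1 $ 1 = chol11 s" "?c $ 1 $ 2 = 0" "?c $ 1 $ 3 = 0"
     "?c $ 2 $ 1 = chol21 s" "?c $ 2 $ 2 = chol22 s" "?c $ 2 $ 3 = 0"
     "?c $ 3 $ 1 = chol31 s" "?c $ 3 $ 2 = chol32 s" "?c $ 3 $ 3 = chol33 s"
     "?c $ 4 $ 1 = 0" "?c $ 4 $ 2 = 0" "?c $ 4 $ 3 = 0"
    by (simp_all add: chol_config_def ax)
  have e: "sq_dist ?c 1 4 = s 1 4" "sq_dist ?c 2 4 = s 2 4" "sq_dist ?c 3 4 = s 3 4"
    unfolding sq c power2_eq_square using 11 22 33 K by simp_all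
  have f: "sq_dist ?c 1 2 = s 1 2" "sq_dist ?c 1 3 = s 1 3" "sq_dist ?c 2 3 = s 2 3"
    unfolding sq c power2_eq_square using 11 22 33 12 K by (simp_all add: algebra_simps)
  have "\<forall>i j. sq_dist ?c i j = s i j"
    unfolding forall_4
    using e f d(2)[of 1 2] d(2)[of 1 3] d(2)[of 1 4] d(2)[of 2 3] d(2)[of 2 4] d(2)[of 3 4]
      sq_dist_commute[of ?c 1 2] sq_dist_commute[of ?c 1 3] sq_dist_commute[of ?c 1 4]
      sq_dist_commute[of ?c 2 3] sq_dist_commute[of ?c 2 4] sq_dist_commute[of ?c 3 4]
    by (simp add: d(1))
  then show ?thesis by blast
qed

lemma chol_config_continuous:
  fixes s :: "real \<Rightarrow> 4 \<Rightarrow> 4 \<Rightarrow> real"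
  assumes s: "\<And>t. t \<in> S \<Longrightarrow> nearly_unit (s t)" and c: "\<And>i j. continuous_on S (\<lambda>t. s t i j)"
  shows "continuous_on S (\<lambda>t. chol_config (s t))"
proof -
  note b = chol_bounds[OF s]
  have K: "continuous_on S (\<lambda>t. chol_gram (s t) i j)" for i j
    unfolding chol_gram_def by (intro continuous_intros c) auto
  have 0: "\<And>t. t \<in> S \<Longrightarrow> chol11 (s t) \<noteq> 0" "\<And>t. t \<in> S \<Longrightarrow> chol22 (s t) \<noteq> 0"
    using b unfolding chol11_def chol22_def by (metis less_irrefl real_sqrt_eq_zero_cancel_iff)+
  have 11: "continuous_on S (\<lambda>t. chol11 (s t))"
    unfolding chol11_def by (intro continuous_intros K)
  have 21: "continuous_on S (\<lambda>t. chol21 (s t))"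
    unfolding chol21_def using 0 by (intro continuous_intros K 11) auto
  have 31: "continuous_on S (\<lambda>t. chol31 (s t))"
    unfolding chol31_def using 0 by (intro continuous_intros K 11) auto
  have 22: "continuous_on S (\<lambda>t. chol22 (s t))"
    unfolding chol22_def by (intro continuous_intros K 21)
  have 32: "continuous_on S (\<lambda>t. chol32 (s t))"
    unfolding chol32_def using 0 by (intro continuous_intros K 21 31 22) auto
  have 33: "continuous_on S (\<lambda>t. chol33 (s t))"
    unfolding chol33_def by (intro continuous_intros K 31 32)
  show ?thesis
    unfolding chol_config_def
  proof (rule continuous_on_vec_lambda)
    fix i :: 4
    show "continuous_on S (\<lambda>t. if i = 1 then chol11 (s t) *\<^sub>R (axis 1 1 :: real^3)
       else if i = 2 then chol21 (s t) *\<^sub>R axis 1 1 + chol22 (s t) *\<^sub>R axis 2 1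
       else if i = 3 then chol31 (s t) *\<^sub>R axis 1 1 + chol32 (s t) *\<^sub>R axis 2 1 + chol33 (s t) *\<^sub>R axis 3 1
       else 0)"
      by (cases "i = 1"; cases "i = 2"; cases "i = 3")
         (auto intro!: continuous_intros 11 21 22 31 32 33)
  qed
qed

lemma nearly_unit_spatial:
  assumes "nearly_unit s" "\<kappa> > 0" "\<And>i j. sq_dist x i j = \<kappa> * s i j"
  shows "spatial x"
  unfolding spatial_def
proof (intro ballI impI)
  fix \<xi> :: "real^4" assume \<xi>: "\<xi> \<in> codisp" "config_map x \<xi> = 0"
  show "\<xi> = 0"
  proof (rule nearly_regular_inj[OF assms(2) _ \<xi>])
    fix i j :: 4 assume "i \<noteq> j"
    then have "\<bar>s i j - 1\<bar> \<le> 1 / 8" using assms(1) by (fastforce simp: nearly_unit_def)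
    then have "\<kappa> * \<bar>s i j - 1\<bar> \<le> \<kappa> * (1 / 8)"
      using assms(2) by (intro mult_left_mono) auto
    moreover have "\<bar>sq_dist x i j - \<kappa>\<bar> = \<kappa> * \<bar>s i j - 1\<bar>"
    proof -
      have "sq_dist x i j - \<kappa> = \<kappa> * (s i j - 1)"
        by (simp add: assms(3) algebra_simps)
      then show ?thesis using assms(2) by (simp add: abs_mult)
    qed
    ultimately show "\<bar>sq_dist x i j - \<kappa>\<bar> \<le> \<kappa> / 8" by simp
  qed
qed

text \<open>A curve of nearly equal squared distances is realised, up to scale, by a curve of
  configurations through a given regular tetrahedron.\<close>

lemma realise_squared_distances:
  fixes T :: "real^3^4" and s :: "real \<Rightarrow> 4 \<Rightarrow> 4 \<Rightarrow> real"
  assumes T: "regular_tetrahedron T"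
    and s: "\<And>t. t \<in> S \<Longrightarrow> nearly_unit (s t)" and c: "\<And>i j. continuous_on S (\<lambda>t. s t i j)"
    and s0: "0 \<in> S" "\<And>i j. i \<noteq> j \<Longrightarrow> s 0 i j = 1"
  obtains \<gamma> \<kappa> where "continuous_on S \<gamma>" "\<gamma> 0 = T" "\<kappa> > 0"
    "\<And>t i j. t \<in> S \<Longrightarrow> sq_dist (\<gamma> t) i j = \<kappa> * s t i j"
proof -
  obtain d where d: "d > 0" "\<And>i j. i \<noteq> j \<Longrightarrow> dist (T $ i) (T $ j) = d"
    using T unfolding regular_tetrahedron_def by blast
  have "sq_dist T i j = d\<^sup>2 * sq_dist (chol_config (s 0)) i j" for i j
    using d s[OF s0(1)] s0(2) by (cases "i = j") (auto simp: chol_config_sq_dist sq_dist_def[of T])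
  moreover have "spatial (chol_config (s 0))"
    by (rule nearly_unit_spatial[OF s[OF s0(1)], of 1]) (simp_all add: chol_config_sq_dist s[OF s0(1)])
  ultimately have "similar_config (chol_config (s 0)) T"
    using d(1) by (intro similar_config_of_sq_dist[of _ "d\<^sup>2"]) auto
  then obtain r f b where r: "r > 0" and f: "orthogonal_transformation f"
    and Tf: "\<And>i. T $ i = r *\<^sub>R f (chol_config (s 0) $ i) + b"
    unfolding similar_config_def by blast
  define \<gamma> where "\<gamma> t = (\<chi> i. r *\<^sub>R f (chol_config (s t) $ i) + b)" for t
  have lin: "linear f" by (rule orthogonal_transformation_linear[OF f])
  show thesis
  proof (rule that[of \<gamma> "r\<^sup>2"])
    have "continuous_on S (\<lambda>t. f (chol_config (s t) $ i))" for i
      by (intro linear_continuous_on_compose[OF _ lin] continuous_on_component chol_config_continuous s c)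
    then show "continuous_on S \<gamma>"
      unfolding \<gamma>_def by (intro continuous_on_vec_lambda continuous_intros)
    show "\<gamma> 0 = T" by (simp add: \<gamma>_def vec_eq_iff Tf)
    show "r\<^sup>2 > 0" using r by simp
    fix t i j assume t: "t \<in> S"
    have "\<gamma> t $ i - \<gamma> t $ j = r *\<^sub>R f (chol_config (s t) $ i - chol_config (s t) $ j)"
      by (simp add: \<gamma>_def linear_diff[OF lin] algebra_simps)
    then have "sq_dist (\<gamma> t) i j = r\<^sup>2 * sq_dist (chol_config (s t)) i j"
      using r by (simp add: sq_dist_def dist_norm power_mult_distrib orthogonal_transformation_norm[OF f])
    then show "sq_dist (\<gamma> t) i j = r\<^sup>2 * s t i j"
      by (simp add: chol_config_sq_dist s[OF t])
  qed
qed

text \<open>A curve of solutions of the eigenvector condition gives a family of configurations.\<close>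

lemma family_of_directions:
  fixes T :: "real^3^4" and p :: "real \<Rightarrow> real^4"
  assumes G: "G > 0" and m: "\<And>i. m $ i > 0" and T: "regular_tetrahedron T"
    and cont: "continuous_on {-1..1} p"
    and p: "\<And>t. t \<in> {-1..1} \<Longrightarrow> p t \<noteq> 0 \<and> weighted m (p t) \<in> codisp \<and>
        eigen_direction (shape (\<delta> * t) (p t)) m (p t)"
    and small: "\<And>t i j. t \<in> {-1..1} \<Longrightarrow> \<bar>\<delta> * t * p t $ i * p t $ j\<bar> \<le> 1 / 1000"
    and inj: "\<And>t u. t \<in> {-1..1} \<Longrightarrow> u \<in> {-1..1} \<Longrightarrow>
        (\<And>i j. \<delta> * t * p t $ i * p t $ j = \<delta> * u * p u $ i * p u $ j) \<Longrightarrow> t = u"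
  obtains \<gamma> \<kappa> where "family_through G m T \<gamma>" "\<kappa> > 0" "\<And>t. t \<in> {-1..1} \<Longrightarrow> spatial (\<gamma> t)"
    "\<And>t i j. t \<in> {-1..1} \<Longrightarrow> sq_dist (\<gamma> t) i j = \<kappa> * shape (\<delta> * t) (p t) i j"
proof -
  let ?I = "{-1..1::real}"
  have pos: "1 + \<delta> * t * p t $ i * p t $ j > 0" if "t \<in> ?I" for t i j
    using small[OF that, of i j] by (simp add: abs_le_iff)
  have unit: "nearly_unit (shape (\<delta> * t) (p t))" if "t \<in> ?I" for t
  proof -
    have "\<bar>(1 + \<delta> * t * p t $ i * p t $ j) powr (- 2 / 3) - 1\<bar> \<le> 1 / 100" for i j
      using one_plus_powr_near_1[of "\<delta> * t * p t $ i * p t $ j"] small[OF that, of i j] by simp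
    then show ?thesis by (auto simp: nearly_unit_def shape_def mult_ac)
  qed
  have comp: "continuous_on ?I (\<lambda>t. p t $ i)" for i
    by (intro continuous_intros cont)
  have cs: "continuous_on ?I (\<lambda>t. shape (\<delta> * t) (p t) i j)" for i j
  proof (cases "i = j")
    case False
    have "continuous_on ?I (\<lambda>t. (1 + \<delta> * t * p t $ i * p t $ j) powr (- 2 / 3))"
      using pos by (intro continuous_on_powr continuous_intros comp) (metis less_irrefl)
    then show ?thesis using False by (simp add: shape_def)
  qed (simp add: shape_def)
  have s0: "0 \<in> ?I" "\<And>i j. i \<noteq> j \<Longrightarrow> shape (\<delta> * 0) (p 0) i j = 1"
    by (simp_all add: shape_def)
  obtain \<gamma> \<kappa> where \<gamma>: "continuous_on ?I \<gamma>" "\<gamma> 0 = T" "\<kappa> > 0"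
    "\<And>t i j. t \<in> ?I \<Longrightarrow> sq_dist (\<gamma> t) i j = \<kappa> * shape (\<delta> * t) (p t) i j"
    by (rule realise_squared_distances[OF T, of ?I "\<lambda>t. shape (\<delta> * t) (p t)"])
       (use unit cs s0 in blast)+
  have sp: "spatial (\<gamma> t)" if "t \<in> ?I" for t
    by (rule nearly_unit_spatial[OF unit[OF that] \<gamma>(3) \<gamma>(4)[OF that]])
  have "family_through G m T \<gamma>"
    unfolding family_through_def
  proof (intro conjI ballI impI \<gamma>(1,2))
    fix t assume t: "t \<in> ?I"
    show "balanced_RE4 G m (\<gamma> t)"
      using balanced_RE4_of_shape[OF G m sp[OF t] \<gamma>(3) \<gamma>(4)[OF t] pos[OF t]] p[OF t] by blast
    fix u assume u: "u \<in> ?I" and ne: "t \<noteq> u"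
    show "\<not> similar_config (\<gamma> t) (\<gamma> u)"
    proof
      assume "similar_config (\<gamma> t) (\<gamma> u)"
      then obtain c where c: "c > 0" "\<And>i j. sq_dist (\<gamma> u) i j = c * sq_dist (\<gamma> t) i j"
        by (rule similar_config_sq_dist) blast
      have "shape (\<delta> * u) (p u) i j = c * shape (\<delta> * t) (p t) i j" for i j
        using c(2)[of i j] \<gamma>(3) unfolding \<gamma>(4)[OF t] \<gamma>(4)[OF u] by (simp add: mult.left_commute[of c])
      from shape_unique[OF m _ _ pos[OF u] pos[OF t] c(1) this] p[OF t] p[OF u]
      have "u = t" by (intro inj[OF u t]) blast
      then show False using ne by simp
    qed
  qed
  then show thesis using that \<gamma>(3,4) sp by blast
qed

section \<open>Simultaneous diagonalisation of the two inertia forms\<close>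

lemma weighted_self_adjoint: "weighted m p \<bullet> q = p \<bullet> weighted m q"
  by (simp add: weighted_def inner_vec_def mult_ac)

lemma weighted_linear: "linear (weighted m)"
  by (rule linearI) (simp_all add: weighted_def vec_eq_iff algebra_simps)

text \<open>Maximising the Rayleigh quotient gives an eigenvector of a quadratic form restricted to a
  subspace.\<close>

lemma rayleigh_eigenvector:
  fixes D :: "'a::euclidean_space \<Rightarrow> 'a"
  assumes D: "linear D" and sym: "\<And>u v. D u \<bullet> v = u \<bullet> D v"
    and S: "subspace S" and y: "y \<in> S" "y \<noteq> 0"
  obtains q where "q \<in> S" "norm q = 1" "\<And>u. u \<in> S \<Longrightarrow> u \<bullet> q = 0 \<Longrightarrow> u \<bullet> D q = 0"
proof -
  let ?K = "sphere 0 1 \<inter> S"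
  have "compact ?K"
    using closed_subspace[OF S] by (simp add: compact_Int_closed)
  moreover have "y /\<^sub>R norm y \<in> ?K"
    using y S by (simp add: subspace_scale)
  moreover have "continuous_on ?K (\<lambda>u. u \<bullet> D u)"
    using D by (intro continuous_intros linear_continuous_on) (simp add: linear_conv_bounded_linear)
  ultimately obtain q where q: "q \<in> ?K" and max: "\<And>u. u \<in> ?K \<Longrightarrow> u \<bullet> D u \<le> q \<bullet> D q"
    using continuous_attains_sup[of ?K "\<lambda>u. u \<bullet> D u"] by blast
  have q1: "q \<bullet> q = 1" using q by (simp add: dot_square_norm)
  have le: "u \<bullet> D u \<le> (q \<bullet> D q) * (u \<bullet> u)" if "u \<in> S" for u
  proof (cases "u = 0")
    case False
    have "(u /\<^sub>R norm u) \<bullet> D (u /\<^sub>R norm u) \<le> q \<bullet> D q"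
      using False that S by (intro max) (simp add: subspace_scale)
    then have "(u \<bullet> D u) / (norm u * norm u) \<le> q \<bullet> D q"
      by (simp add: linear_cmul[OF D] divide_inverse mult_ac)
    then have "u \<bullet> D u \<le> (q \<bullet> D q) * (norm u * norm u)"
      using False by (simp add: pos_divide_le_eq)
    then show ?thesis by (simp add: dot_square_norm power2_eq_square)
  qed (simp add: linear_0[OF D])
  show thesis
  proof (rule that[of q])
    fix u assume u: "u \<in> S" "u \<bullet> q = 0"
    define a where "a = u \<bullet> D q"
    define C where "C = (q \<bullet> D q) * (u \<bullet> u) - u \<bullet> D u"
    have *: "2 * t * a \<le> t\<^sup>2 * C" for t
    proof -
      have "q + t *\<^sub>R u \<in> S" using q u S by (simp add: subspace_add subspace_scale)
      from le[OF this] show ?thesis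
        using u(2) sym[of q u]
        by (simp add: C_def a_def linear_add[OF D] linear_cmul[OF D] inner_add_left inner_add_right
            q1 power2_eq_square inner_commute algebra_simps)
    qed
    have "2 * a\<^sup>2 \<le> a\<^sup>2 * (C / (1 + \<bar>C\<bar>))"
    proof -
      have "(1 / (1 + \<bar>C\<bar>)) * (2 * a\<^sup>2) \<le> (1 / (1 + \<bar>C\<bar>)) * (a\<^sup>2 * (C / (1 + \<bar>C\<bar>)))"
        using *[of "a / (1 + \<bar>C\<bar>)"] by (simp add: power2_eq_square field_simps)
      then show ?thesis by (subst (asm) mult_le_cancel_left_pos) auto
    qed
    also have "\<dots> \<le> a\<^sup>2 * 1"
      by (intro mult_left_mono) (auto simp: field_simps)
    finally show "u \<bullet> D q = 0" by (simp add: a_def)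
  qed (use q in auto)
qed

text \<open>A basis of the hyperplane of directions that diagonalises the forms
  \<open>\<Sum> m\<^sub>i p\<^sub>i\<^sup>2\<close> and \<open>\<Sum> m\<^sub>i\<^sup>2 p\<^sub>i\<^sup>2\<close> simultaneously, with simple spectrum.\<close>

locale inertia_frame =
  fixes m :: "real^4" and v :: "3 \<Rightarrow> real^4" and L :: "3 \<Rightarrow> real"
  assumes m_pos: "\<And>i. m $ i > 0"
    and v_codisp: "\<And>l. weighted m (v l) \<in> codisp"
    and v_orth: "\<And>l l'. weighted m (v l) \<bullet> v l' = of_bool (l = l')"
    and v_diag: "\<And>l l'. weighted m (weighted m (v l)) \<bullet> v l' = L l * of_bool (l = l')"
    and v_span: "\<And>p. weighted m p \<in> codisp \<Longrightarrow> \<exists>c :: real^3. p = (\<Sum>l\<in>UNIV. c $ l *\<^sub>R v l)"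
    and L_inj: "\<And>l l'. l \<noteq> l' \<Longrightarrow> L l \<noteq> L l'"

lemma exists_orthogonal_nonzero:
  fixes S :: "(real^4) set"
  assumes "finite S" "card S < 4"
  obtains y where "y \<noteq> 0" "\<And>u. u \<in> S \<Longrightarrow> y \<bullet> u = 0"
proof -
  have "dim S < DIM(real^4)" using dim_le_card'[OF assms(1)] assms(2) by simp
  then show thesis
    using orthogonal_to_subspace_exists[of S] that by (metis orthogonal_def span_base)
qed

lemma orthogonal_frame_of_hyperplane:
  fixes r :: "real^4" and D :: "real^4 \<Rightarrow> real^4"
  assumes r: "r \<noteq> 0" and D: "linear D" and sym: "\<And>u v. D u \<bullet> v = u \<bullet> D v"
  obtains q :: "3 \<Rightarrow> real^4" where "\<And>l. r \<bullet> q l = 0" "\<And>l l'. q l \<bullet> q l' = of_bool (l = l')"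
    "\<And>l l'. l \<noteq> l' \<Longrightarrow> q l \<bullet> D (q l') = 0"
    "\<And>y. r \<bullet> y = 0 \<Longrightarrow> (\<And>l. q l \<bullet> y = 0) \<Longrightarrow> y = 0"
proof -
  have sub: "subspace {y :: real^4. \<forall>u\<in>S. u \<bullet> y = 0}" for S
    by (auto simp: subspace_def inner_add_right)
  have step: "\<exists>q. (\<forall>u\<in>S. u \<bullet> q = 0) \<and> norm q = 1 \<and>
      (\<forall>u. (\<forall>w\<in>S. w \<bullet> u = 0) \<longrightarrow> u \<bullet> q = 0 \<longrightarrow> u \<bullet> D q = 0)" if "S = set xs" "length xs < 4" for S xs
  proof -
    have small: "finite S" "card S < 4"
      using that card_length[of xs] by auto
    obtain y where "y \<noteq> 0" "\<And>u. u \<in> S \<Longrightarrow> y \<bullet> u = 0"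
      using exists_orthogonal_nonzero[OF small] by blast
    then obtain q where "q \<in> {y. \<forall>u\<in>S. u \<bullet> y = 0}" "norm q = 1"
      "\<And>u. u \<in> {y. \<forall>u\<in>S. u \<bullet> y = 0} \<Longrightarrow> u \<bullet> q = 0 \<Longrightarrow> u \<bullet> D q = 0"
      using rayleigh_eigenvector[OF D sym sub, of y S] by (auto simp: inner_commute)
    then show ?thesis by auto
  qed
  obtain q1 where q1: "r \<bullet> q1 = 0" "norm q1 = 1" "\<And>u. r \<bullet> u = 0 \<Longrightarrow> u \<bullet> q1 = 0 \<Longrightarrow> u \<bullet> D q1 = 0"
    using step[of "{r}" "[r]"] by auto
  obtain q2 where q2: "r \<bullet> q2 = 0" "q1 \<bullet> q2 = 0" "norm q2 = 1"
    "\<And>u. r \<bullet> u = 0 \<Longrightarrow> q1 \<bullet> u = 0 \<Longrightarrow> u \<bullet> q2 = 0 \<Longrightarrow> u \<bullet> D q2 = 0"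
    using step[of "{r, q1}" "[r, q1]"] by auto
  obtain q3 where q3: "r \<bullet> q3 = 0" "q1 \<bullet> q3 = 0" "q2 \<bullet> q3 = 0" "norm q3 = 1"
    using step[of "{r, q1, q2}" "[r, q1, q2]"] by auto
  have n: "q1 \<bullet> q1 = 1" "q2 \<bullet> q2 = 1" "q3 \<bullet> q3 = 1"
    using q1 q2 q3 by (simp_all add: dot_square_norm)
  have c: "q2 \<bullet> q1 = 0" "q3 \<bullet> q1 = 0" "q3 \<bullet> q2 = 0"
    using q2 q3 by (simp_all add: inner_commute)
  have d: "q2 \<bullet> D q1 = 0" "q3 \<bullet> D q1 = 0" "q3 \<bullet> D q2 = 0"
    using q1(3) q2 q3 c by auto
  then have d': "q1 \<bullet> D q2 = 0" "q1 \<bullet> D q3 = 0" "q2 \<bullet> D q3 = 0"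
    by (metis sym inner_commute)+
  define q where "q l = (if l = 1 then q1 else if l = 2 then q2 else q3)" for l :: 3
  have q: "q 1 = q1" "q 2 = q2" "q 3 = q3" by (simp_all add: q_def)
  show thesis
  proof (rule that[of q])
    have "\<forall>l. r \<bullet> q l = 0" unfolding forall_3 q using q1 q2 q3 by simp
    then show "\<And>l. r \<bullet> q l = 0" by blast
    have "\<forall>l l'. q l \<bullet> q l' = of_bool (l = l')"
      unfolding forall_3 q using n c q2 q3 by simp
    then show "\<And>l l'. q l \<bullet> q l' = of_bool (l = l')" by blast
    have "\<forall>l l'. l \<noteq> l' \<longrightarrow> q l \<bullet> D (q l') = 0"
      unfolding forall_3 q using d d' by simp
    then show "\<And>l l'. l \<noteq> l' \<Longrightarrow> q l \<bullet> D (q l') = 0" by blast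
    fix y assume y: "r \<bullet> y = 0" "\<And>l. q l \<bullet> y = 0"
    have y': "q1 \<bullet> y = 0" "q2 \<bullet> y = 0" "q3 \<bullet> y = 0"
      using y(2)[of 1] y(2)[of 2] y(2)[of 3] by (simp_all add: q)
    let ?B = "{r, q1, q2, q3}"
    have z: "r \<noteq> 0" "q1 \<noteq> 0" "q2 \<noteq> 0" "q3 \<noteq> 0" using r n by auto
    have rc: "q1 \<bullet> r = 0" "q2 \<bullet> r = 0" "q3 \<bullet> r = 0"
      using q1 q2 q3 by (simp_all add: inner_commute)
    have ne: "r \<noteq> q1" "r \<noteq> q2" "r \<noteq> q3" "q1 \<noteq> q2" "q1 \<noteq> q3" "q2 \<noteq> q3"
      using n q1(1) q2 q3 by auto
    have "independent ?B"
    proof (rule pairwise_orthogonal_independent)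
      show "pairwise orthogonal ?B"
        using c q1(1) q2 q3 rc by (auto simp: pairwise_def orthogonal_def)
      show "0 \<notin> ?B" using z by auto
    qed
    then have "dim ?B = 4"
      using ne by (simp add: dim_eq_card_independent)
    then have "span ?B = UNIV" by (simp flip: dim_eq_full)
    then have "orthogonal y y"
      by (intro orthogonal_to_span[of y ?B])
         (use y(1) y' in \<open>auto simp: orthogonal_def inner_commute[of y]\<close>)
    then show "y = 0" by (simp add: orthogonal_self)
  qed
qed

text \<open>If two eigenvalues equal \<open>e\<close>, every vector \<open>q\<close> of their plane satisfies
  \<open>(m\<^sub>i - e) q\<^sub>i = c \<cdot> sqrt m\<^sub>i\<close> with \<open>c\<close> depending linearly on \<open>q\<close>. If some mass equals \<open>e\<close>, then \<open>c = 0\<close>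
  and the plane is supported on the at most two bodies of that mass, where the hyperplane leaves at
  most a line. Otherwise a nonzero vector of the plane with \<open>c = 0\<close> would have to vanish.\<close>

lemma inertia_frame_exists:
  assumes m: "\<And>i. m $ i > 0"
    and no3: "\<not> (\<exists>i j k. i \<noteq> j \<and> j \<noteq> k \<and> i \<noteq> k \<and> m $ i = m $ j \<and> m $ j = m $ k)"
  obtains v L where "inertia_frame m v L"
proof -
  define r :: "real^4" where "r = (\<chi> i. sqrt (m $ i))"
  have r: "r $ i > 0" "r $ i * r $ i = m $ i" for i using m[of i] by (auto simp: r_def)
  have "r \<noteq> 0" using r(1)[of 1] by auto
  then obtain q :: "3 \<Rightarrow> real^4" where rq: "\<And>l. r \<bullet> q l = 0"
    and qq: "\<And>l l'. q l \<bullet> q l' = of_bool (l = l')"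
    and qD: "\<And>l l'. l \<noteq> l' \<Longrightarrow> q l \<bullet> weighted m (q l') = 0"
    and zero: "\<And>y. r \<bullet> y = 0 \<Longrightarrow> (\<And>l. q l \<bullet> y = 0) \<Longrightarrow> y = 0"
    by (rule orthogonal_frame_of_hyperplane[OF _ weighted_linear weighted_self_adjoint, of r m]) blast
  define L where "L l = q l \<bullet> weighted m (q l)" for l
  define v where "v l = (\<chi> i. q l $ i / r $ i)" for l
  have rn: "r $ i \<noteq> 0" for i using r(1)[of i] by simp
  have r0: "r \<bullet> r > 0" using \<open>r \<noteq> 0\<close> by simp
  have distinct: "L l \<noteq> L l'" if ne: "l \<noteq> l'" for l l'
  proof
    assume LL: "L l = L l'"
    let ?e = "L l"
    have ex: "\<exists>c. \<forall>i. (m $ i - ?e) * q k $ i = c * r $ i" if "k = l \<or> k = l'" for k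
    proof -
      let ?y = "weighted m (q k) - ?e *\<^sub>R q k"
      let ?c = "(r \<bullet> ?y) / (r \<bullet> r)"
      have "?y - ?c *\<^sub>R r = 0"
      proof (rule zero)
        show "r \<bullet> (?y - ?c *\<^sub>R r) = 0" using r0 by (simp add: inner_diff_right)
        fix h
        have "q h \<bullet> r = 0" using rq[of h] by (simp add: inner_commute)
        moreover have "q h \<bullet> weighted m (q k) = ?e * (q h \<bullet> q k)"
          using qD[of h k] that LL by (cases "h = k") (auto simp: L_def qq)
        ultimately show "q h \<bullet> (?y - ?c *\<^sub>R r) = 0"
          by (simp add: inner_diff_right)
      qed
      then have "(?y - ?c *\<^sub>R r) $ i = 0" for i by simp
      then show ?thesis
        by (intro exI[of _ ?c]) (simp add: weighted_def left_diff_distrib)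
    qed
    obtain c where c: "\<And>i. (m $ i - ?e) * q l $ i = c * r $ i" using ex[of l] by blast
    obtain c' where c': "\<And>i. (m $ i - ?e) * q l' $ i = c' * r $ i" using ex[of l'] by blast
    have q0: "q k \<noteq> 0" for k using qq[of k k] by auto
    have qll: "q l \<bullet> q l' = 0" "q l \<bullet> q l = 1" "q l' \<bullet> q l' = 1" using qq ne by auto
    show False
    proof (cases "\<exists>a. m $ a = ?e")
      case False
      have "c' * q l $ i - c * q l' $ i = 0" for i
      proof -
        have "(m $ i - ?e) * (c' * q l $ i - c * q l' $ i) = c' * (c * r $ i) - c * (c' * r $ i)"
          unfolding c[of i, symmetric] c'[of i, symmetric] by (simp add: algebra_simps)
        then show ?thesis using False by simp
      qed
      then have eq: "c' *\<^sub>R q l - c *\<^sub>R q l' = 0" by (simp add: vec_eq_iff)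
      have "c' = q l \<bullet> (c' *\<^sub>R q l - c *\<^sub>R q l')"
        using qll by (simp add: inner_diff_right)
      then have "c' = 0" unfolding eq by simp
      then have "(m $ i - ?e) * q l' $ i = 0" for i using c' by simp
      then have "q l' = 0" using False by (auto simp: vec_eq_iff)
      then show False using q0 by blast
    next
      case True
      then obtain a where a: "m $ a = ?e" by blast
      have "c = 0" "c' = 0" using c[of a] c'[of a] a rn[of a] by auto
      then have supp: "m $ i = ?e" if "q l $ i \<noteq> 0 \<or> q l' $ i \<noteq> 0" for i
        using c[of i] c'[of i] that by auto
      obtain b where b: "b \<noteq> a" "\<And>i. m $ i = ?e \<Longrightarrow> i = a \<or> i = b"
      proof (cases "\<exists>b. b \<noteq> a \<and> m $ b = ?e")
        case True
        then obtain b where "b \<noteq> a" "m $ b = ?e" by blast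
        then show thesis using that[of b] no3 a by metis
      next
        case False
        have "\<exists>b::4. b \<noteq> a" using forall_4[of "\<lambda>b. b = a"] by auto
        then show thesis using that False by blast
      qed
      have out: "q l $ i = 0 \<and> q l' $ i = 0" if "i \<notin> {a, b}" for i
        using supp[of i] b(2)[of i] that by auto
      have sum2: "(\<Sum>i\<in>UNIV. f i) = f a + f b" if "\<And>i. i \<notin> {a, b} \<Longrightarrow> f i = 0" for f :: "4 \<Rightarrow> real"
      proof -
        have "(\<Sum>i\<in>UNIV. f i) = (\<Sum>i\<in>{a, b}. f i)"
          using that by (intro sum.mono_neutral_right) auto
        then show ?thesis using b(1) by simp
      qed
      have in2: "u \<bullet> q l = u $ a * q l $ a + u $ b * q l $ b"
        "u \<bullet> q l' = u $ a * q l' $ a + u $ b * q l' $ b" for u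
        unfolding inner_vec_def by (subst sum2; simp add: out)+
      have qa: "q l $ b = - (r $ a / r $ b) * q l $ a" "q l' $ b = - (r $ a / r $ b) * q l' $ a"
        using rq[of l] rq[of l'] rn[of b] unfolding in2 by (auto simp: field_simps)
      have "0 = q l $ a * q l' $ a * (1 + (r $ a / r $ b)\<^sup>2)"
        using qll(1) unfolding in2 qa by (simp add: power2_eq_square algebra_simps)
      moreover have "1 + (r $ a / r $ b)\<^sup>2 > 0" by (simp add: add_pos_nonneg)
      ultimately have "q l $ a = 0 \<or> q l' $ a = 0" by auto
      then show False
        using qll(2,3) unfolding in2 qa by auto
    qed
  qed
  have "inertia_frame m v L"
  proof
    show "m $ i > 0" for i by (rule m)
    have wv: "weighted m (v l) $ i = r $ i * q l $ i" for l i
      using rn[of i] by (simp add: weighted_def v_def flip: r(2))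
    show "weighted m (v l) \<in> codisp" for l
      using rq[of l] by (simp add: codisp_iff wv inner_vec_def)
    show "weighted m (v l) \<bullet> v l' = of_bool (l = l')" for l l'
    proof -
      have "weighted m (v l) \<bullet> v l' = q l \<bullet> q l'"
        using rn by (simp add: inner_vec_def wv) (simp add: v_def)
      then show ?thesis by (simp add: qq)
    qed
    show "weighted m (weighted m (v l)) \<bullet> v l' = L l * of_bool (l = l')" for l l'
    proof -
      have "weighted m (weighted m (v l)) \<bullet> v l' = weighted m (q l) \<bullet> q l'"
        using rn by (simp add: inner_vec_def weighted_def v_def mult_ac flip: r(2))
      then show ?thesis
        using qD[of l' l] by (cases "l = l'") (auto simp: L_def inner_commute)
    qed
    show "l \<noteq> l' \<Longrightarrow> L l \<noteq> L l'" for l l' by (rule distinct)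
    fix p assume p: "weighted m p \<in> codisp"
    define y where "y = (\<chi> i. r $ i * p $ i)"
    define c :: "real^3" where "c = (\<chi> l. q l \<bullet> y)"
    have "y - (\<Sum>l\<in>UNIV. c $ l *\<^sub>R q l) = 0"
    proof (rule zero)
      have "r \<bullet> y = (\<Sum>i\<in>UNIV. weighted m p $ i)"
        by (simp add: y_def inner_vec_def weighted_def flip: r(2) mult.assoc)
      then have "r \<bullet> y = 0" using p by (simp add: codisp_iff)
      then show "r \<bullet> (y - (\<Sum>l\<in>UNIV. c $ l *\<^sub>R q l)) = 0"
        by (simp add: inner_diff_right inner_sum_right rq)
      fix l show "q l \<bullet> (y - (\<Sum>l\<in>UNIV. c $ l *\<^sub>R q l)) = 0"
        by (simp add: inner_diff_right inner_sum_right qq c_def)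
    qed
    then have y: "y $ i = (\<Sum>l\<in>UNIV. c $ l * q l $ i)" for i
      by (simp add: vec_eq_iff sum_component)
    have "p $ i = (\<Sum>l\<in>UNIV. c $ l *\<^sub>R v l) $ i" for i
    proof -
      have "p $ i = y $ i / r $ i" using rn[of i] by (simp add: y_def)
      then show ?thesis by (simp add: y v_def sum_divide_distrib)
    qed
    then show "\<exists>c :: real^3. p = (\<Sum>l\<in>UNIV. c $ l *\<^sub>R v l)"
      by (auto simp: vec_eq_iff)
  qed
  then show thesis by (rule that)
qed

section \<open>Charts for the eigenvector equation\<close>

text \<open>Equal quadratic data agree after pairing with any two functionals.\<close>

lemma quadratic_eq_pairing:
  fixes p q f g :: "real^4"
  assumes "\<And>i j. \<beta> * p $ i * p $ j = \<beta>' * q $ i * q $ j"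
  shows "\<beta> * (f \<bullet> p) * (g \<bullet> p) = \<beta>' * (f \<bullet> q) * (g \<bullet> q)"
proof -
  have pair: "\<beta> * (f \<bullet> p) * (g \<bullet> p) = (\<Sum>i\<in>UNIV. \<Sum>j\<in>UNIV. f $ i * g $ j * (\<beta> * p $ i * p $ j))" for \<beta> p
    by (simp add: inner_vec_def mult.assoc sum_product) (simp add: sum_distrib_left mult_ac)
  show ?thesis unfolding pair assms ..
qed

context inertia_frame
begin

text \<open>The direction with coordinates \<open>a\<close> in the frame.\<close>

definition dir :: "real^3 \<Rightarrow> real^4" where
  "dir a = (\<Sum>l\<in>UNIV. a $ l *\<^sub>R v l)"

lemma dir_component: "dir a $ i = (\<Sum>l\<in>UNIV. a $ l * v l $ i)"
  by (simp add: dir_def sum_component)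

lemma dir_scale: "dir (c *\<^sub>R a) = c *\<^sub>R dir a"
  by (simp add: dir_def scaleR_sum_right)

lemma weighted_dir_codisp: "weighted m (dir a) \<in> codisp"
  unfolding dir_def linear_sum[OF weighted_linear] linear_cmul[OF weighted_linear]
  by (intro subspace_sum subspace_scale subspace_codisp v_codisp)

lemma coord_dir: "weighted m (v l) \<bullet> dir a = a $ l"
  by (simp add: dir_def inner_sum_right v_orth of_bool_def if_distrib[of "\<lambda>c. _ * c"] cong: if_cong)

lemma inertia_dir: "weighted m (weighted m (v l)) \<bullet> dir a = L l * a $ l"
  by (simp add: dir_def inner_sum_right v_diag of_bool_def if_distrib[of "\<lambda>c. _ * c"] cong: if_cong)

lemma dir_nonzero: "a $ k = 1 \<Longrightarrow> dir a \<noteq> 0"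
  using coord_dir[of k a] by auto

lemma dir_surj:
  assumes "weighted m p \<in> codisp"
  obtains a where "p = dir a"
  using v_span[OF assms] unfolding dir_def by blast

text \<open>Coordinates of the left-hand side of the eigenvector condition.\<close>

definition moment :: "real \<Rightarrow> real^3 \<Rightarrow> 3 \<Rightarrow> real" where
  "moment \<beta> a l = weighted m (v l) \<bullet> (\<chi> i. \<Sum>j\<in>UNIV. shape \<beta> (dir a) i j * (m $ j * dir a $ j))"

text \<open>Testing the eigenvector condition against the frame removes the constant.\<close>

lemma eigen_direction_iff:
  assumes a: "a $ k = 1"
  shows "eigen_direction (shape \<beta> (dir a)) m (dir a) \<longleftrightarrow> (\<forall>l. moment \<beta> a l = moment \<beta> a k * a $ l)"
proof -
  let ?f = "\<chi> i. \<Sum>j\<in>UNIV. shape \<beta> (dir a) i j * (m $ j * dir a $ j)"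
  have v0: "weighted m (v l) \<bullet> (\<chi> i. c) = 0" for l c
    using v_codisp[of l] by (simp add: inner_vec_def codisp_iff flip: sum_distrib_right)
  show ?thesis
  proof
    assume "eigen_direction (shape \<beta> (dir a)) m (dir a)"
    then obtain \<mu> c where "\<And>i. ?f $ i = \<mu> * dir a $ i + c"
      unfolding eigen_direction_def by auto
    then have f: "?f = \<mu> *\<^sub>R dir a + (\<chi> i. c)" by (simp add: vec_eq_iff)
    have "moment \<beta> a l = \<mu> * a $ l" for l
      unfolding moment_def f by (simp add: inner_add_right coord_dir v0)
    then show "\<forall>l. moment \<beta> a l = moment \<beta> a k * a $ l" using a by simp
  next
    assume *: "\<forall>l. moment \<beta> a l = moment \<beta> a k * a $ l"
    let ?M = "\<Sum>i\<in>UNIV. m $ i"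
    have M: "?M > 0" using m_pos by (intro sum_pos) auto
    define g where "g = ?f - moment \<beta> a k *\<^sub>R dir a"
    define c where "c = (\<Sum>i\<in>UNIV. m $ i * g $ i) / ?M"
    have vg: "weighted m (v l) \<bullet> (g - (\<chi> i. c)) = 0" for l
      using *[rule_format, of l] unfolding g_def inner_diff_right inner_scaleR_right coord_dir v0
      by (simp only: moment_def)
    have "weighted m (g - (\<chi> i. c)) \<in> codisp"
    proof -
      have "(\<Sum>i\<in>UNIV. m $ i * (g $ i - c)) = (\<Sum>i\<in>UNIV. m $ i * g $ i) - ?M * c"
        by (simp only: right_diff_distrib sum_subtractf sum_distrib_right)
      also have "\<dots> = 0" using M by (simp add: c_def)
      finally show ?thesis by (simp add: codisp_iff weighted_def)
    qed
    then obtain b where b: "g - (\<chi> i. c) = dir b" by (rule dir_surj)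
    have "b = 0"
      using vg by (simp add: b coord_dir vec_eq_iff)
    then have "g - (\<chi> i. c) = 0" using b by (simp add: dir_def)
    then have "g $ i = c" for i by (simp add: vec_eq_iff)
    then have "?f $ i = moment \<beta> a k * dir a $ i + c" for i
      by (simp add: g_def algebra_simps)
    then show "eigen_direction (shape \<beta> (dir a)) m (dir a)"
      unfolding eigen_direction_def by auto
  qed
qed

text \<open>At \<open>\<beta> = 0\<close> the moments are \<open>- L l * a $ l\<close>; this is the deviation from that value.\<close>

definition pert :: "real \<Rightarrow> real^3 \<Rightarrow> 3 \<Rightarrow> real" where
  "pert \<beta> a l = moment \<beta> a l + L l * a $ l"

lemma pert_eq:
  "pert \<beta> a l = (\<Sum>i\<in>UNIV. \<Sum>j\<in>UNIV. if i = j then 0 else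
     m $ i * v l $ i * m $ j * (dir a $ j * ((1 + \<beta> * (dir a $ i * dir a $ j)) powr (- 2 / 3) - 1)))"
  (is "_ = (\<Sum>i\<in>UNIV. \<Sum>j\<in>UNIV. ?t i j)")
proof -
  let ?p = "dir a"
  have p0: "(\<Sum>j\<in>UNIV. m $ j * ?p $ j) = 0"
    using weighted_dir_codisp[of a] by (simp add: codisp_iff weighted_def)
  have "(\<Sum>j\<in>UNIV. ?t i j) = m $ i * v l $ i * (\<Sum>j\<in>UNIV. shape \<beta> ?p i j * (m $ j * ?p $ j))
      + m $ i * (m $ i * v l $ i) * ?p $ i" for i
  proof -
    have "(\<Sum>j\<in>UNIV. ?t i j) = (\<Sum>j\<in>UNIV. m $ i * v l $ i * (shape \<beta> ?p i j * (m $ j * ?p $ j))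
        - m $ i * v l $ i * (m $ j * ?p $ j) + (if i = j then m $ i * (m $ i * v l $ i) * ?p $ i else 0))"
      by (intro sum.cong refl) (simp add: shape_def algebra_simps)
    also have "\<dots> = m $ i * v l $ i * (\<Sum>j\<in>UNIV. shape \<beta> ?p i j * (m $ j * ?p $ j))
        - m $ i * v l $ i * (\<Sum>j\<in>UNIV. m $ j * ?p $ j) + m $ i * (m $ i * v l $ i) * ?p $ i"
      by (simp add: sum.distrib sum_subtractf sum_distrib_left)
    finally show ?thesis by (simp add: p0)
  qed
  moreover have "L l * a $ l = (\<Sum>i\<in>UNIV. m $ i * (m $ i * v l $ i) * ?p $ i)"
    unfolding inertia_dir[symmetric] by (simp add: inner_vec_def weighted_def)
  ultimately show ?thesis
    by (simp add: pert_def moment_def inner_vec_def weighted_def sum.distrib)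
qed

text \<open>The chart coordinates range over this cube.\<close>

definition cube :: "(real^3) set" where
  "cube = {a. \<forall>l. \<bar>a $ l\<bar> \<le> 1}"

text \<open>A bound for the entries of directions in the cube and for their Lipschitz constants.\<close>

definition vbound :: real where
  "vbound = 1 + (\<Sum>i\<in>UNIV. \<Sum>l\<in>UNIV. \<bar>v l $ i\<bar>)"

lemma vbound_ge_1: "vbound \<ge> 1"
  by (simp add: vbound_def sum_nonneg)

lemma dir_bound:
  assumes "\<And>l. \<bar>a $ l\<bar> \<le> c"
  shows "\<bar>dir a $ i\<bar> \<le> vbound * c"
proof -
  have c: "c \<ge> 0" using assms[of 1] by linarith
  have "\<bar>dir a $ i\<bar> \<le> (\<Sum>l\<in>UNIV. \<bar>a $ l * v l $ i\<bar>)"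
    unfolding dir_component by (rule sum_abs)
  also have "\<dots> \<le> (\<Sum>l\<in>UNIV. c * \<bar>v l $ i\<bar>)"
    by (intro sum_mono) (simp add: abs_mult mult_right_mono assms)
  also have "\<dots> = c * (\<Sum>l\<in>UNIV. \<bar>v l $ i\<bar>)" by (simp add: sum_distrib_left)
  also have "\<dots> \<le> c * vbound"
  proof (rule mult_left_mono[OF _ c])
    have "(\<Sum>l\<in>UNIV. \<bar>v l $ i\<bar>) \<le> (\<Sum>i\<in>UNIV. \<Sum>l\<in>UNIV. \<bar>v l $ i\<bar>)"
      by (rule member_le_sum) (auto intro: sum_nonneg)
    then show "(\<Sum>l\<in>UNIV. \<bar>v l $ i\<bar>) \<le> vbound" by (simp add: vbound_def)
  qed
  finally show ?thesis by (simp add: mult.commute)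
qed

lemma dir_cube: "a \<in> cube \<Longrightarrow> \<bar>dir a $ i\<bar> \<le> vbound"
  using dir_bound[of a 1 i] by (simp add: cube_def)

lemma dir_lipschitz: "\<bar>dir a $ i - dir b $ i\<bar> \<le> vbound * dist a b"
proof -
  have "dir a $ i - dir b $ i = dir (a - b) $ i"
    by (simp add: dir_component left_diff_distrib sum_subtractf)
  also have "\<bar>\<dots>\<bar> \<le> vbound * dist a b"
    using component_le_norm_cart[of "a - b"] by (intro dir_bound) (simp add: dist_norm)
  finally show ?thesis .
qed

lemma dir_product_small:
  assumes "a \<in> cube" "\<bar>\<beta>\<bar> * vbound\<^sup>2 \<le> e"
  shows "\<bar>\<beta> * (dir a $ i * dir a $ j)\<bar> \<le> e"
proof -
  have "\<bar>\<beta>\<bar> * (\<bar>dir a $ i\<bar> * \<bar>dir a $ j\<bar>) \<le> \<bar>\<beta>\<bar> * (vbound * vbound)"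
    using dir_cube[OF assms(1)] vbound_ge_1 by (intro mult_left_mono mult_mono) auto
  then show ?thesis using assms(2) by (simp add: abs_mult power2_eq_square)
qed

text \<open>The perturbation is bounded by \<open>pbound * \<bar>\<beta>\<bar>\<close> and has this Lipschitz constant on the cube.\<close>

definition pbound :: real where
  "pbound = 12 * vbound ^ 3 * (1 + (\<Sum>l\<in>UNIV. \<Sum>i\<in>UNIV. \<Sum>j\<in>UNIV. \<bar>m $ i * v l $ i * m $ j\<bar>))"

lemma pbound_ge_1: "pbound \<ge> 1"
proof -
  have "1 \<le> vbound ^ 3" by (rule one_le_power[OF vbound_ge_1])
  then have 12: "1 \<le> 12 * vbound ^ 3" by linarith
  have "1 * 1 \<le> (12 * vbound ^ 3) * (1 + (\<Sum>l\<in>UNIV. \<Sum>i\<in>UNIV. \<Sum>j\<in>UNIV. \<bar>m $ i * v l $ i * m $ j\<bar>))"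
    by (rule mult_mono[OF 12]) (use 12 vbound_ge_1 in \<open>auto simp: sum_nonneg\<close>)
  then show ?thesis by (simp add: pbound_def)
qed

lemma pert_sum_bound:
  assumes "c \<ge> 0" "\<And>i j. \<bar>g i j\<bar> \<le> 12 * vbound ^ 3 * c"
  shows "\<bar>\<Sum>i\<in>UNIV. \<Sum>j\<in>UNIV. if i = j then 0 else m $ i * v l $ i * m $ j * g i j\<bar> \<le> pbound * c"
proof -
  let ?w = "\<lambda>l i j. \<bar>m $ i * v l $ i * m $ j\<bar>"
  have "\<bar>\<Sum>i\<in>UNIV. \<Sum>j\<in>UNIV. if i = j then 0 else m $ i * v l $ i * m $ j * g i j\<bar> \<le>
      (\<Sum>i\<in>UNIV. \<bar>\<Sum>j\<in>UNIV. if i = j then 0 else m $ i * v l $ i * m $ j * g i j\<bar>)"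
    by (rule sum_abs)
  also have "\<dots> \<le> (\<Sum>i\<in>UNIV. \<Sum>j\<in>UNIV. \<bar>if i = j then 0 else m $ i * v l $ i * m $ j * g i j\<bar>)"
    by (intro sum_mono sum_abs)
  also have "\<dots> \<le> (\<Sum>i\<in>UNIV. \<Sum>j\<in>UNIV. ?w l i j * (12 * vbound ^ 3 * c))"
  proof (intro sum_mono)
    fix i j
    have "\<bar>m $ i * v l $ i * m $ j * g i j\<bar> \<le> ?w l i j * (12 * vbound ^ 3 * c)"
      unfolding abs_mult[of _ "g i j"] by (intro mult_left_mono assms) simp
    moreover have "0 \<le> ?w l i j * (12 * vbound ^ 3 * c)"
      using assms(1) vbound_ge_1 by (intro mult_nonneg_nonneg) auto
    ultimately show "\<bar>if i = j then 0 else m $ i * v l $ i * m $ j * g i j\<bar> \<le> ?w l i j * (12 * vbound ^ 3 * c)"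
      by (cases "i = j") auto
  qed
  also have "\<dots> = (\<Sum>i\<in>UNIV. \<Sum>j\<in>UNIV. ?w l i j) * (12 * vbound ^ 3 * c)"
    by (simp add: sum_distrib_right)
  also have "\<dots> \<le> (1 + (\<Sum>l\<in>UNIV. \<Sum>i\<in>UNIV. \<Sum>j\<in>UNIV. ?w l i j)) * (12 * vbound ^ 3 * c)"
  proof (rule mult_right_mono)
    have "(\<Sum>i\<in>UNIV. \<Sum>j\<in>UNIV. ?w l i j) \<le> (\<Sum>l\<in>UNIV. \<Sum>i\<in>UNIV. \<Sum>j\<in>UNIV. ?w l i j)"
      by (rule member_le_sum[of l UNIV "\<lambda>l. \<Sum>i\<in>UNIV. \<Sum>j\<in>UNIV. ?w l i j"]) (auto intro!: sum_nonneg)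
    then show "(\<Sum>i\<in>UNIV. \<Sum>j\<in>UNIV. ?w l i j) \<le> 1 + (\<Sum>l\<in>UNIV. \<Sum>i\<in>UNIV. \<Sum>j\<in>UNIV. ?w l i j)"
      by simp
    show "0 \<le> 12 * vbound ^ 3 * c" using assms(1) vbound_ge_1 by simp
  qed
  also have "\<dots> = pbound * c" by (simp add: pbound_def mult_ac)
  finally show ?thesis .
qed

lemma pert_bound:
  assumes a: "a \<in> cube" and \<beta>: "\<bar>\<beta>\<bar> * vbound\<^sup>2 \<le> 1/2"
  shows "\<bar>pert \<beta> a l\<bar> \<le> pbound * \<bar>\<beta>\<bar>"
  unfolding pert_eq
proof (rule pert_sum_bound)
  fix i j
  let ?z = "\<beta> * (dir a $ i * dir a $ j)"
  have "\<bar>(1 + ?z) powr (- 2 / 3) - 1\<bar> \<le> 4 * \<bar>?z\<bar>"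
    by (rule one_plus_powr_near_1[OF dir_product_small[OF a \<beta>]])
  also have "\<dots> \<le> 4 * (\<bar>\<beta>\<bar> * vbound\<^sup>2)"
    using dir_product_small[OF a order_refl] by (intro mult_left_mono) auto
  finally have "\<bar>dir a $ j\<bar> * \<bar>(1 + ?z) powr (- 2 / 3) - 1\<bar> \<le> vbound * (4 * (\<bar>\<beta>\<bar> * vbound\<^sup>2))"
    using vbound_ge_1 by (intro mult_mono dir_cube a) auto
  also have "\<dots> \<le> 12 * vbound ^ 3 * \<bar>\<beta>\<bar>"
    using vbound_ge_1 by (simp add: power2_eq_square power3_eq_cube mult_ac)
  finally show "\<bar>dir a $ j * ((1 + ?z) powr (- 2 / 3) - 1)\<bar> \<le> 12 * vbound ^ 3 * \<bar>\<beta>\<bar>"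
    by (simp add: abs_mult)
qed simp

lemma pert_lipschitz:
  assumes a: "a \<in> cube" and b: "b \<in> cube" and \<beta>: "\<bar>\<beta>\<bar> * vbound\<^sup>2 \<le> 1/2"
  shows "\<bar>pert \<beta> a l - pert \<beta> b l\<bar> \<le> pbound * (\<bar>\<beta>\<bar> * dist a b)"
proof -
  let ?h = "\<lambda>a i j. dir a $ j * ((1 + \<beta> * (dir a $ i * dir a $ j)) powr (- 2 / 3) - 1)"
  have "pert \<beta> a l - pert \<beta> b l = (\<Sum>i\<in>UNIV. \<Sum>j\<in>UNIV. if i = j then 0 else
      m $ i * v l $ i * m $ j * (?h a i j - ?h b i j))"
    unfolding pert_eq sum_subtractf[symmetric]
    by (intro sum.cong refl) (auto simp: right_diff_distrib)
  also have "\<bar>\<dots>\<bar> \<le> pbound * (\<bar>\<beta>\<bar> * dist a b)"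
  proof (rule pert_sum_bound)
    fix i j
    let ?V = vbound and ?d = "dist a b"
    let ?z = "\<lambda>a. dir a $ i * dir a $ j"
    let ?\<psi> = "\<lambda>a. (1 + \<beta> * ?z a) powr (- 2 / 3) - 1"
    have V: "?V \<ge> 0" using vbound_ge_1 by simp
    have zl: "\<bar>?z a - ?z b\<bar> \<le> 2 * (?V * ?V * ?d)"
    proof -
      have "?z a - ?z b = (dir a $ i - dir b $ i) * dir a $ j + dir b $ i * (dir a $ j - dir b $ j)"
        by (simp add: algebra_simps)
      also have "\<bar>\<dots>\<bar> \<le> \<bar>dir a $ i - dir b $ i\<bar> * \<bar>dir a $ j\<bar> + \<bar>dir b $ i\<bar> * \<bar>dir a $ j - dir b $ j\<bar>"
        by (rule order_trans[OF abs_triangle_ineq]) (simp only: abs_mult order_refl)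
      also have "\<dots> \<le> (?V * ?d) * ?V + ?V * (?V * ?d)"
        using V by (intro add_mono mult_mono dir_cube dir_lipschitz a b) auto
      finally show ?thesis by (simp add: mult_ac)
    qed
    have \<psi>: "\<bar>?\<psi> a\<bar> \<le> 4 * (\<bar>\<beta>\<bar> * ?V\<^sup>2)"
    proof -
      have "\<bar>?\<psi> a\<bar> \<le> 4 * \<bar>\<beta> * ?z a\<bar>"
        by (rule one_plus_powr_near_1[OF dir_product_small[OF a \<beta>]])
      also have "\<dots> \<le> 4 * (\<bar>\<beta>\<bar> * ?V\<^sup>2)"
        using dir_product_small[OF a order_refl] by (intro mult_left_mono) auto
      finally show ?thesis .
    qed
    have \<psi>l: "\<bar>?\<psi> a - ?\<psi> b\<bar> \<le> 4 * (\<bar>\<beta>\<bar> * (2 * (?V * ?V * ?d)))"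
    proof -
      have "\<bar>?\<psi> a - ?\<psi> b\<bar> \<le> 4 * \<bar>\<beta> * ?z a - \<beta> * ?z b\<bar>"
        using one_plus_powr_lipschitz[OF dir_product_small[OF a \<beta>] dir_product_small[OF b \<beta>]] by simp
      also have "\<dots> = 4 * (\<bar>\<beta>\<bar> * \<bar>?z a - ?z b\<bar>)"
        by (simp add: abs_mult flip: right_diff_distrib)
      also have "\<dots> \<le> 4 * (\<bar>\<beta>\<bar> * (2 * (?V * ?V * ?d)))"
        by (intro mult_left_mono zl) auto
      finally show ?thesis .
    qed
    have "?h a i j - ?h b i j = (dir a $ j - dir b $ j) * ?\<psi> a + dir b $ j * (?\<psi> a - ?\<psi> b)"
      by (simp add: algebra_simps)
    also have "\<bar>\<dots>\<bar> \<le> \<bar>dir a $ j - dir b $ j\<bar> * \<bar>?\<psi> a\<bar> + \<bar>dir b $ j\<bar> * \<bar>?\<psi> a - ?\<psi> b\<bar>"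
      by (rule order_trans[OF abs_triangle_ineq]) (simp only: abs_mult order_refl)
    also have "\<dots> \<le> (?V * ?d) * (4 * (\<bar>\<beta>\<bar> * ?V\<^sup>2)) + ?V * (4 * (\<bar>\<beta>\<bar> * (2 * (?V * ?V * ?d))))"
      using V by (intro add_mono mult_mono dir_cube dir_lipschitz a b \<psi> \<psi>l) auto
    also have "\<dots> = 12 * ?V ^ 3 * (\<bar>\<beta>\<bar> * ?d)"
      by (simp add: power2_eq_square power3_eq_cube mult_ac)
    finally show "\<bar>?h a i j - ?h b i j\<bar> \<le> 12 * ?V ^ 3 * (\<bar>\<beta>\<bar> * ?d)" .
  qed simp
  finally show ?thesis .
qed

lemma pert_continuous:
  assumes a: "a \<in> cube" and \<beta>: "\<And>\<beta>. \<beta> \<in> S \<Longrightarrow> \<bar>\<beta>\<bar> * vbound\<^sup>2 \<le> 1/2"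
  shows "continuous_on S (\<lambda>\<beta>. pert \<beta> a l)"
proof -
  have nz: "1 + \<beta> * (dir a $ i * dir a $ j) \<noteq> 0" if "\<beta> \<in> S" for \<beta> i j
    using dir_product_small[OF a \<beta>[OF that], of i j] by (simp add: abs_le_iff)
  have "continuous_on S (\<lambda>\<beta>. if i = j then 0 else
     m $ i * v l $ i * m $ j * (dir a $ j * ((1 + \<beta> * (dir a $ i * dir a $ j)) powr (- 2 / 3) - 1)))" for i j
    using nz by (cases "i = j") (auto intro!: continuous_intros)
  then show ?thesis unfolding pert_eq by (intro continuous_on_sum)
qed

end

section \<open>The three branches of solutions\<close>

context inertia_frame
begin

text \<open>Directions normalised to have \<open>k\<close>-th coordinate one, which is also a largest one.\<close>

definition chart :: "3 \<Rightarrow> (real^3) set" where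
  "chart k = {a \<in> cube. a $ k = 1}"

text \<open>The eigenvector condition solved for the unperturbed linear part; its fixed points in the chart
  are the solutions.\<close>

definition chart_map :: "3 \<Rightarrow> real \<Rightarrow> real^3 \<Rightarrow> real^3" where
  "chart_map k \<beta> a = (\<chi> l. if l = k then 1 else (pert \<beta> a k * a $ l - pert \<beta> a l) / (L k - L l))"

lemma chart_map_fixed_point:
  assumes a: "a $ k = 1"
  shows "chart_map k \<beta> a = a \<longleftrightarrow> eigen_direction (shape \<beta> (dir a)) m (dir a)"
proof -
  have "chart_map k \<beta> a $ l = a $ l \<longleftrightarrow> moment \<beta> a l = moment \<beta> a k * a $ l" for l
  proof (cases "l = k")
    case False
    then have "L k - L l \<noteq> 0" using L_inj[of k l] by simp
    then show ?thesis
      using False a by (auto simp: chart_map_def pert_def field_simps)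
  qed (use a in \<open>simp add: chart_map_def\<close>)
  then show ?thesis
    unfolding eigen_direction_iff[OF a] by (simp add: vec_eq_iff)
qed

text \<open>The spectral gap, positive because the spectrum is simple.\<close>

definition gap :: real where
  "gap = Min ((\<lambda>(k, l). \<bar>L k - L l\<bar>) ` {(k, l). k \<noteq> l})"

lemma gap: "gap > 0" "k \<noteq> l \<Longrightarrow> gap \<le> \<bar>L k - L l\<bar>"
proof -
  have fin: "finite ((\<lambda>(k, l). \<bar>L k - L l\<bar>) ` {(k, l). k \<noteq> l})" by simp
  have "(1::3, 2::3) \<in> {(k, l). k \<noteq> l}" by simp
  then have ne: "(\<lambda>(k, l). \<bar>L k - L l\<bar>) ` {(k, l). k \<noteq> l} \<noteq> {}" by blast
  show "gap > 0"
    unfolding gap_def using L_inj by (subst Min_gr_iff[OF fin ne]) auto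
  show "k \<noteq> l \<Longrightarrow> gap \<le> \<bar>L k - L l\<bar>"
    unfolding gap_def by (intro Min_le[OF fin]) auto
qed

text \<open>For parameters up to this radius the products \<open>\<beta> p\<^sub>i p\<^sub>j\<close> are at most one thousandth in modulus,
  and the chart map contracts by the factor one half.\<close>

definition radius :: real where
  "radius = min (1 / (1000 * vbound\<^sup>2)) (gap / (18 * pbound))"

lemma radius_pos: "radius > 0"
  using vbound_ge_1 pbound_ge_1 gap(1) by (simp add: radius_def)

lemma radius_small:
  assumes "\<bar>\<beta>\<bar> \<le> radius"
  shows "\<bar>\<beta>\<bar> * vbound\<^sup>2 \<le> 1 / 1000" "\<bar>\<beta>\<bar> * vbound\<^sup>2 \<le> 1 / 2" "18 * (pbound * \<bar>\<beta>\<bar>) \<le> gap"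
proof -
  have "\<bar>\<beta>\<bar> \<le> 1 / (1000 * vbound\<^sup>2)" using assms by (simp add: radius_def)
  then show "\<bar>\<beta>\<bar> * vbound\<^sup>2 \<le> 1 / 1000"
    using vbound_ge_1 by (simp add: field_simps)
  then show "\<bar>\<beta>\<bar> * vbound\<^sup>2 \<le> 1 / 2" by simp
  have "\<bar>\<beta>\<bar> \<le> gap / (18 * pbound)" using assms by (simp add: radius_def)
  then show "18 * (pbound * \<bar>\<beta>\<bar>) \<le> gap"
    using pbound_ge_1 by (simp add: field_simps)
qed

lemma quotient_gap_le:
  assumes "k \<noteq> l" "\<bar>y\<bar> \<le> c"
  shows "\<bar>y / (L k - L l)\<bar> \<le> c / gap"
proof -
  have "\<bar>y\<bar> / \<bar>L k - L l\<bar> \<le> c / gap"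
    using assms gap(1) gap(2)[OF assms(1)] by (intro frac_le) auto
  then show ?thesis by (simp add: abs_divide)
qed

lemma chart_map_half:
  assumes a: "a \<in> chart k" and \<beta>: "\<bar>\<beta>\<bar> \<le> radius" and l: "l \<noteq> k"
  shows "\<bar>chart_map k \<beta> a $ l\<bar> \<le> 1 / 2"
proof -
  have cube: "a \<in> cube" using a by (simp add: chart_def)
  have "\<bar>pert \<beta> a k * a $ l - pert \<beta> a l\<bar> \<le> \<bar>pert \<beta> a k\<bar> * \<bar>a $ l\<bar> + \<bar>pert \<beta> a l\<bar>"
    by (rule order_trans[OF abs_triangle_ineq4]) (simp only: abs_mult order_refl)
  also have "\<dots> \<le> (pbound * \<bar>\<beta>\<bar>) * 1 + pbound * \<bar>\<beta>\<bar>"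
    using cube pbound_ge_1 by (intro add_mono mult_mono pert_bound radius_small \<beta>) (auto simp: cube_def)
  finally have "\<bar>(pert \<beta> a k * a $ l - pert \<beta> a l) / (L k - L l)\<bar> \<le> (2 * (pbound * \<bar>\<beta>\<bar>)) / gap"
    using l by (intro quotient_gap_le) (auto simp: mult.commute)
  also have "\<dots> \<le> 1 / 2"
    using radius_small(3)[OF \<beta>] gap(1) by (simp add: field_simps)
  finally show ?thesis using l by (simp add: chart_map_def)
qed

lemma chart_map_in_chart:
  assumes "a \<in> chart k" "\<bar>\<beta>\<bar> \<le> radius"
  shows "chart_map k \<beta> a \<in> chart k"
proof -
  have "\<bar>chart_map k \<beta> a $ l\<bar> \<le> 1" for l
  proof (cases "l = k")
    case False
    show ?thesis using chart_map_half[OF assms False] by linarith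
  qed (simp add: chart_map_def)
  then show ?thesis by (simp add: chart_def cube_def) (simp add: chart_map_def)
qed

lemma chart_map_contraction:
  assumes a: "a \<in> chart k" and b: "b \<in> chart k" and \<beta>: "\<bar>\<beta>\<bar> \<le> radius"
  shows "dist (chart_map k \<beta> a) (chart_map k \<beta> b) \<le> 1 / 2 * dist a b"
proof -
  let ?d = "dist a b" and ?P = "pbound * \<bar>\<beta>\<bar>"
  have cube: "a \<in> cube" "b \<in> cube" using a b by (auto simp: chart_def)
  have P: "?P \<ge> 0" using pbound_ge_1 by simp
  have "\<bar>chart_map k \<beta> a $ l - chart_map k \<beta> b $ l\<bar> \<le> ?d / 6" for l
  proof (cases "l = k")
    case False
    have ab: "\<bar>a $ l - b $ l\<bar> \<le> ?d"
      using component_le_norm_cart[of "a - b" l] by (simp add: dist_norm)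
    have "pert \<beta> a k * a $ l - pert \<beta> a l - (pert \<beta> b k * b $ l - pert \<beta> b l) =
       (pert \<beta> a k - pert \<beta> b k) * a $ l + pert \<beta> b k * (a $ l - b $ l) - (pert \<beta> a l - pert \<beta> b l)"
      by (simp add: algebra_simps)
    also have "\<bar>\<dots>\<bar> \<le> \<bar>pert \<beta> a k - pert \<beta> b k\<bar> * \<bar>a $ l\<bar> + \<bar>pert \<beta> b k\<bar> * \<bar>a $ l - b $ l\<bar> + \<bar>pert \<beta> a l - pert \<beta> b l\<bar>"
      unfolding abs_mult[symmetric] by linarith
    also have "\<dots> \<le> (pbound * (\<bar>\<beta>\<bar> * ?d)) * 1 + ?P * ?d + pbound * (\<bar>\<beta>\<bar> * ?d)"
      using cube P pbound_ge_1
      by (intro add_mono mult_mono pert_bound pert_lipschitz radius_small \<beta> ab) (auto simp: cube_def)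
    also have "\<dots> = 3 * ?P * ?d" by simp
    finally have "\<bar>(pert \<beta> a k * a $ l - pert \<beta> a l - (pert \<beta> b k * b $ l - pert \<beta> b l)) / (L k - L l)\<bar> \<le> (3 * ?P * ?d) / gap"
      using False by (intro quotient_gap_le) auto
    also have "\<dots> \<le> ?d / 6"
    proof -
      have "18 * ?P * ?d \<le> gap * ?d"
        using radius_small(3)[OF \<beta>] by (intro mult_right_mono) auto
      then show ?thesis using gap(1) by (simp add: field_simps)
    qed
    finally show ?thesis using False by (simp add: chart_map_def diff_divide_distrib)
  qed (simp add: chart_map_def)
  then have "(\<Sum>l\<in>UNIV. \<bar>(chart_map k \<beta> a - chart_map k \<beta> b) $ l\<bar>) \<le> (\<Sum>l\<in>(UNIV::3 set). ?d / 6)"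
    by (intro sum_mono) simp
  then show ?thesis
    using norm_le_l1_cart[of "chart_map k \<beta> a - chart_map k \<beta> b"] by (simp add: dist_norm)
qed

lemma chart_nonempty: "axis k 1 \<in> chart k"
  by (simp add: chart_def cube_def axis_def)

lemma complete_chart: "complete (chart k)"
proof -
  have "closed (chart k)"
  proof -
    have "chart k = (\<Inter>l. {a. \<bar>a $ l\<bar> \<le> 1}) \<inter> {a. a $ k = 1}"
      by (auto simp: chart_def cube_def)
    moreover have "closed {a :: real^3. \<bar>a $ l\<bar> \<le> 1}" for l
      by (intro closed_Collect_le continuous_intros)
    moreover have "closed {a :: real^3. a $ k = 1}"
      by (intro closed_Collect_eq continuous_intros)
    ultimately show ?thesis by (simp only:) (intro closed_Int closed_INT ballI)
  qed
  then show ?thesis by (simp add: complete_eq_closed)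
qed

lemma chart_fixed_point_ex1:
  assumes "\<bar>\<beta>\<bar> \<le> radius"
  shows "\<exists>!a. a \<in> chart k \<and> chart_map k \<beta> a = a"
proof -
  have "\<exists>!a\<in>chart k. chart_map k \<beta> a = a"
    using chart_nonempty[of k] chart_map_in_chart[OF _ assms] chart_map_contraction[OF _ _ assms]
    by (intro Banach_fix[OF complete_chart, of k "1 / 2"]) auto
  then show ?thesis .
qed

text \<open>The solution in the chart \<open>k\<close> with parameter \<open>\<beta>\<close>, meaningful for \<open>\<bar>\<beta>\<bar> \<le> radius\<close>.\<close>

definition branch :: "3 \<Rightarrow> real \<Rightarrow> real^3" where
  "branch k \<beta> = (THE a. a \<in> chart k \<and> chart_map k \<beta> a = a)"

context
  fixes \<beta> :: real assumes \<beta>: "\<bar>\<beta>\<bar> \<le> radius"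
begin

lemma branch_fixed: "branch k \<beta> \<in> chart k" "chart_map k \<beta> (branch k \<beta>) = branch k \<beta>"
  using theI'[OF chart_fixed_point_ex1[OF \<beta>, of k]] unfolding branch_def by auto

lemma branch_one: "branch k \<beta> $ k = 1"
  using branch_fixed(1) by (simp add: chart_def)

text \<open>Off the normalised coordinate the branches stay well inside the cube; therefore different
  branches have no direction in common.\<close>

lemma branch_half: "l \<noteq> k \<Longrightarrow> \<bar>branch k \<beta> $ l\<bar> \<le> 1 / 2"
  using chart_map_half[OF branch_fixed(1) \<beta>, of l k] by (simp add: branch_fixed(2))

lemma branch_eigen: "eigen_direction (shape \<beta> (dir (branch k \<beta>))) m (dir (branch k \<beta>))"
  using chart_map_fixed_point[OF branch_one] branch_fixed(2) by blast

lemma branch_unique: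
  assumes "a \<in> chart k" "eigen_direction (shape \<beta> (dir a)) m (dir a)"
  shows "a = branch k \<beta>"
proof -
  have "chart_map k \<beta> a = a"
    using chart_map_fixed_point[of a k] assms by (auto simp: chart_def)
  then show ?thesis
    using chart_fixed_point_ex1[OF \<beta>, of k] branch_fixed[of k] assms(1) by blast
qed

end

text \<open>The contraction property bounds the change of the fixed point by twice the change of the map at
  a fixed argument.\<close>

lemma branch_continuous: "continuous_on {- radius..radius} (branch k)"
proof -
  let ?I = "{- radius..radius}"
  have "(branch k \<longlongrightarrow> branch k b) (at b within ?I)" if b: "b \<in> ?I" for b
  proof -
    have bb: "\<bar>\<beta>\<bar> \<le> radius" if "\<beta> \<in> ?I" for \<beta> using that by auto
    note B = branch_fixed[OF bb]
    let ?a = "branch k b"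
    have cube: "?a \<in> cube" using B(1)[OF b, of k] by (simp add: chart_def)
    have "continuous_on ?I (\<lambda>\<beta>. chart_map k \<beta> ?a)"
      unfolding chart_map_def
    proof (rule continuous_on_vec_lambda)
      fix l
      show "continuous_on ?I (\<lambda>\<beta>. if l = k then 1 else (pert \<beta> ?a k * ?a $ l - pert \<beta> ?a l) / (L k - L l))"
        using L_inj[of k l]
        by (cases "l = k") (auto intro!: continuous_intros pert_continuous[OF cube] radius_small(2))
    qed
    then have "((\<lambda>\<beta>. chart_map k \<beta> ?a) \<longlongrightarrow> chart_map k b ?a) (at b within ?I)"
      using b by (simp add: continuous_on_def)
    then have "((\<lambda>\<beta>. chart_map k \<beta> ?a) \<longlongrightarrow> ?a) (at b within ?I)"
      unfolding B(2)[OF b] .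
    from tendsto_mult_right_zero[OF this[THEN iffD1[OF tendsto_dist_iff]], of 2]
    have lim: "((\<lambda>\<beta>. 2 * dist (chart_map k \<beta> ?a) ?a) \<longlongrightarrow> 0) (at b within ?I)" .
    have le: "dist (branch k \<beta>) ?a \<le> 2 * dist (chart_map k \<beta> ?a) ?a" if "\<beta> \<in> ?I" for \<beta>
    proof -
      have "dist (branch k \<beta>) ?a \<le> dist (chart_map k \<beta> (branch k \<beta>)) (chart_map k \<beta> ?a) + dist (chart_map k \<beta> ?a) ?a"
        unfolding B(2)[OF that] by (rule dist_triangle)
      also have "\<dots> \<le> 1 / 2 * dist (branch k \<beta>) ?a + dist (chart_map k \<beta> ?a) ?a"
        using chart_map_contraction[OF B(1)[OF that] B(1)[OF b] bb[OF that]] by simp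
      finally show ?thesis by simp
    qed
    have "((\<lambda>\<beta>. dist (branch k \<beta>) ?a) \<longlongrightarrow> 0) (at b within ?I)"
      by (rule tendsto_sandwich[OF _ _ tendsto_const lim])
         (auto simp: eventually_at_filter le)
    then show ?thesis by (rule iffD2[OF tendsto_dist_iff])
  qed
  then show ?thesis by (simp add: continuous_on_def)
qed

lemma dir_continuous: "continuous_on S f \<Longrightarrow> continuous_on S (\<lambda>t. dir (f t))"
  unfolding dir_def by (intro continuous_intros)

end

section \<open>Families through the regular tetrahedron\<close>

text \<open>Curves of solutions with different quadratic data \<open>\<beta> p\<^sub>i p\<^sub>j\<close> give distinct families.\<close>

lemma distinct_families_of_directions:
  fixes T :: "real^3^4" and p :: "nat \<Rightarrow> real \<Rightarrow> real^4"
  assumes G: "G > 0" and m: "\<And>i. m $ i > 0" and T: "regular_tetrahedron T"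
    and cont: "\<And>k. k < n \<Longrightarrow> continuous_on {-1..1} (p k)"
    and p: "\<And>k t. k < n \<Longrightarrow> t \<in> {-1..1} \<Longrightarrow> p k t \<noteq> 0 \<and> weighted m (p k t) \<in> codisp \<and>
        eigen_direction (shape (\<delta> * t) (p k t)) m (p k t)"
    and small: "\<And>k t i j. k < n \<Longrightarrow> t \<in> {-1..1} \<Longrightarrow> \<bar>\<delta> * t * p k t $ i * p k t $ j\<bar> \<le> 1 / 1000"
    and inj: "\<And>k t u. k < n \<Longrightarrow> t \<in> {-1..1} \<Longrightarrow> u \<in> {-1..1} \<Longrightarrow>
        (\<And>i j. \<delta> * t * p k t $ i * p k t $ j = \<delta> * u * p k u $ i * p k u $ j) \<Longrightarrow> t = u"
    and cross: "\<And>k l t u. k < n \<Longrightarrow> l < n \<Longrightarrow> k \<noteq> l \<Longrightarrow> t \<in> {-1..1} \<Longrightarrow> u \<in> {-1..1} \<Longrightarrow>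
        (\<And>i j. \<delta> * t * p k t $ i * p k t $ j = \<delta> * u * p l u $ i * p l u $ j) \<Longrightarrow> t = 0 \<and> u = 0"
  obtains \<gamma> \<kappa> where "distinct_families G m T n \<gamma>"
    "\<And>k t. k < n \<Longrightarrow> t \<in> {-1..1} \<Longrightarrow> spatial (\<gamma> k t)" "\<And>k. k < n \<Longrightarrow> \<kappa> k > 0"
    "\<And>k t i j. k < n \<Longrightarrow> t \<in> {-1..1} \<Longrightarrow> sq_dist (\<gamma> k t) i j = \<kappa> k * shape (\<delta> * t) (p k t) i j"
proof -
  have ex: "\<exists>\<gamma> \<kappa>. family_through G m T \<gamma> \<and> \<kappa> > 0 \<and> (\<forall>t\<in>{-1..1}. spatial (\<gamma> t) \<and>
      (\<forall>i j. sq_dist (\<gamma> t) i j = \<kappa> * shape (\<delta> * t) (p k t) i j))" if k: "k < n" for k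
    by (rule family_of_directions[OF G m T cont[OF k] p[OF k] small[OF k] inj[OF k]]) blast+
  define \<gamma> where "\<gamma> k = (SOME \<gamma>. \<exists>\<kappa>. family_through G m T \<gamma> \<and> \<kappa> > 0 \<and> (\<forall>t\<in>{-1..1}. spatial (\<gamma> t) \<and>
      (\<forall>i j. sq_dist (\<gamma> t) i j = \<kappa> * shape (\<delta> * t) (p k t) i j)))" for k
  have "\<exists>\<kappa>. family_through G m T (\<gamma> k) \<and> \<kappa> > 0 \<and> (\<forall>t\<in>{-1..1}. spatial (\<gamma> k t) \<and>
      (\<forall>i j. sq_dist (\<gamma> k t) i j = \<kappa> * shape (\<delta> * t) (p k t) i j))" if "k < n" for k
    unfolding \<gamma>_def by (rule someI_ex[OF ex[OF that]])
  then obtain \<kappa> where \<kappa>: "\<And>k. k < n \<Longrightarrow> family_through G m T (\<gamma> k) \<and> \<kappa> k > 0 \<and>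
      (\<forall>t\<in>{-1..1}. spatial (\<gamma> k t) \<and> (\<forall>i j. sq_dist (\<gamma> k t) i j = \<kappa> k * shape (\<delta> * t) (p k t) i j))"
    by metis
  have pos: "1 + \<delta> * t * p k t $ i * p k t $ j > 0" if "k < n" "t \<in> {-1..1}" for k t i j
    using small[OF that, of i j] by (simp add: abs_le_iff)
  have "distinct_families G m T n \<gamma>"
    unfolding distinct_families_def
  proof (intro conjI allI impI ballI)
    show "k < n \<Longrightarrow> family_through G m T (\<gamma> k)" for k using \<kappa> by blast
    fix k l t u assume k: "k < n" and l: "l < n" and kl: "k \<noteq> l"
      and t: "t \<in> {-1..1::real}" and u: "u \<in> {-1..1::real}"
      and sim: "similar_config (\<gamma> k t) (\<gamma> l u)"
    from sim obtain c where c: "c > 0" "\<And>i j. sq_dist (\<gamma> l u) i j = c * sq_dist (\<gamma> k t) i j"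
      by (rule similar_config_sq_dist) blast
    have \<kappa>': "\<kappa> k > 0" "\<kappa> l > 0" using \<kappa> k l by auto
    have "c * \<kappa> k / \<kappa> l > 0" using c(1) \<kappa>' by simp
    moreover have "shape (\<delta> * u) (p l u) i j = (c * \<kappa> k / \<kappa> l) * shape (\<delta> * t) (p k t) i j" for i j
    proof -
      have "\<kappa> l * shape (\<delta> * u) (p l u) i j = c * (\<kappa> k * shape (\<delta> * t) (p k t) i j)"
        using c(2)[of i j] \<kappa>[OF k] \<kappa>[OF l] t u by simp
      then show ?thesis using \<kappa>' by (simp add: field_simps)
    qed
    ultimately have eq: "\<delta> * u * p l u $ i * p l u $ j = \<delta> * t * p k t $ i * p k t $ j" for i j
      using shape_unique[OF m _ _ pos[OF l u] pos[OF k t]] p[OF k t] p[OF l u] by blast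
    have "t = 0 \<and> u = 0"
      by (rule cross[OF k l kl t u]) (rule eq[symmetric])
    then show "t = 0" "u = 0" by auto
  qed
  then show thesis using that \<kappa> by blast
qed

text \<open>Two equal masses give an explicit family: only their mutual distance is changed.\<close>

lemma equal_masses_direction:
  assumes ab: "a \<noteq> b" and eq: "m $ a = m $ b"
  defines "p \<equiv> axis a 1 - axis b 1"
  shows "p \<noteq> 0 \<and> weighted m p \<in> codisp \<and> eigen_direction (shape \<beta> p) m p"
proof (intro conjI)
  have pc: "p $ i = (if i = a then 1 else if i = b then -1 else 0)" for i
    using ab by (simp add: p_def axis_def)
  have "p $ a \<noteq> 0" by (simp add: pc)
  then show "p \<noteq> 0" by auto
  have two: "(\<Sum>j\<in>UNIV. f j * p $ j) = f a - f b" for f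
    unfolding p_def by (rule sum_axis_diff)
  show "weighted m p \<in> codisp"
    using two[of "\<lambda>i. m $ i"] eq by (simp add: codisp_iff weighted_def)
  have "(\<Sum>j\<in>UNIV. shape \<beta> p i j * (m $ j * p $ j)) = (- shape \<beta> p a b * m $ a) * p $ i + 0" for i
    using two[of "\<lambda>j. shape \<beta> p i j * m $ j"] ab eq by (auto simp: mult.assoc shape_def pc)
  then show "eigen_direction (shape \<beta> p) m p"
    unfolding eigen_direction_def by blast
qed

lemma three_families_equal_masses:
  fixes T :: "real^3^4"
  assumes G: "G > 0" and m: "\<And>i. m $ i > 0" and T: "regular_tetrahedron T"
    and ijk: "i \<noteq> j" "j \<noteq> k" "i \<noteq> k" "m $ i = m $ j" "m $ j = m $ k"
  shows "\<exists>\<gamma>. distinct_families G m T 3 \<gamma>"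
proof -
  define a where "a l = (if l = 2 then j else i)" for l :: nat
  define b where "b l = (if l = 0 then j else k)" for l :: nat
  define p :: "nat \<Rightarrow> real^4" where "p l = axis (a l) 1 - axis (b l) 1" for l
  have ab: "a l \<noteq> b l" "m $ a l = m $ b l" for l
    using ijk by (auto simp: a_def b_def)
  have pc: "p l $ x = (if x = a l then 1 else if x = b l then -1 else 0)" for l x
    using ab(1)[of l] by (simp add: p_def axis_def)
  show ?thesis
  proof (rule distinct_families_of_directions[OF G m T, where n = 3 and p = "\<lambda>l t. p l" and \<delta> = "1 / 1000"])
    show "p l \<noteq> 0 \<and> weighted m (p l) \<in> codisp \<and> eigen_direction (shape (1 / 1000 * t) (p l)) m (p l)" for l t
      unfolding p_def by (rule equal_masses_direction[OF ab])
    show "\<bar>1 / 1000 * t * p l $ x * p l $ y\<bar> \<le> 1 / 1000" if "t \<in> {-1..1}" for l t x y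
      using that by (auto simp: pc abs_le_iff)
    show "t = u" if "\<And>x y. 1 / 1000 * t * p l $ x * p l $ y = 1 / 1000 * u * p l $ x * p l $ y" for l t u
      using that[of "a l" "a l"] by (simp add: pc)
    show "t = 0 \<and> u = 0" if kl: "l < 3" "l' < 3" "l \<noteq> l'"
      and eq: "\<And>x y. 1 / 1000 * t * p l $ x * p l $ y = 1 / 1000 * u * p l' $ x * p l' $ y" for l l' t u
    proof -
      have "\<exists>x. p l $ x \<noteq> 0 \<and> p l' $ x = 0" if "l < 3" "l' < 3" "l \<noteq> l'" for l l'
      proof -
        have "a l \<notin> {a l', b l'} \<or> b l \<notin> {a l', b l'}"
          using that ijk by (auto simp: a_def b_def split: if_splits)
        then show ?thesis using pc ab(1)[of l] by (metis insert_iff zero_neq_neg_one zero_neq_one)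
      qed
      from this[OF kl] this[OF kl(2,1) kl(3)[symmetric]]
      obtain x y where "p l $ x \<noteq> 0" "p l' $ x = 0" "p l' $ y \<noteq> 0" "p l $ y = 0" by blast
      with eq[of x x] eq[of y y] show ?thesis by simp
    qed
  qed auto
qed

context inertia_frame
begin

lemma L_pos: "L l > 0"
proof -
  have "v l \<noteq> 0" using v_orth[of l l] by auto
  then obtain i where i: "v l $ i \<noteq> 0" by (auto simp: vec_eq_iff)
  have "L l = (\<Sum>i\<in>UNIV. (m $ i * v l $ i)\<^sup>2)"
    using v_diag[of l l] by (simp add: weighted_def inner_vec_def power2_eq_square mult_ac)
  also have "\<dots> > 0"
  proof (rule sum_pos2[of _ i])
    show "0 < (m $ i * v l $ i)\<^sup>2" using i m_pos[of i] by simp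
  qed auto
  finally show ?thesis .
qed

text \<open>The off-diagonal entries \<open>\<beta> p\<^sub>i p\<^sub>j\<close> control \<open>\<beta>\<close>, since \<open>\<Sum> m\<^sub>i p\<^sub>i = 0\<close> gives
  \<open>\<Sum>\<^sub>i m\<^sub>i\<^sup>2 p\<^sub>i\<^sup>2 = - \<Sum>\<^sub>i\<^sub>\<noteq>\<^sub>j m\<^sub>i m\<^sub>j p\<^sub>i p\<^sub>j\<close>.\<close>

lemma off_diagonal_bound:
  assumes e: "e \<ge> 0" and off: "\<And>i j. i \<noteq> j \<Longrightarrow> \<bar>\<beta> * dir a $ i * dir a $ j\<bar> \<le> e" and a: "a $ k = 1"
  shows "\<bar>\<beta>\<bar> * L k \<le> e * (\<Sum>i\<in>UNIV. m $ i)\<^sup>2"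
proof -
  let ?p = "dir a" and ?w = "weighted m (dir a)"
  have "?w \<bullet> ?w = weighted m ?w \<bullet> ?p"
    by (simp add: weighted_self_adjoint)
  also have "\<dots> = (\<Sum>l\<in>UNIV. a $ l * (weighted m (weighted m (v l)) \<bullet> ?p))"
    by (subst dir_def) (simp add: linear_sum[OF weighted_linear] linear_cmul[OF weighted_linear] inner_sum_left)
  also have "\<dots> = (\<Sum>l\<in>UNIV. L l * (a $ l)\<^sup>2)"
    by (simp add: inertia_dir power2_eq_square mult_ac)
  also have "\<dots> \<ge> L k * (a $ k)\<^sup>2"
    using L_pos by (intro member_le_sum[of k UNIV "\<lambda>l. L l * (a $ l)\<^sup>2"]) (auto simp: less_imp_le)
  finally have Lk: "L k \<le> ?w \<bullet> ?w" using a by simp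
  have "0 = (\<Sum>i\<in>UNIV. ?w $ i) * (\<Sum>i\<in>UNIV. ?w $ i)"
    using weighted_dir_codisp[of a] by (simp add: codisp_iff)
  also have "\<dots> = (\<Sum>i\<in>UNIV. \<Sum>j\<in>UNIV. (if i = j then 0 else ?w $ i * ?w $ j) + (if i = j then ?w $ i * ?w $ i else 0))"
    unfolding sum_product by (intro sum.cong refl) auto
  also have "\<dots> = (\<Sum>i\<in>UNIV. \<Sum>j\<in>UNIV. if i = j then 0 else ?w $ i * ?w $ j) + ?w \<bullet> ?w"
    by (simp add: sum.distrib inner_vec_def)
  finally have "\<beta> * (?w \<bullet> ?w) = - (\<beta> * (\<Sum>i\<in>UNIV. \<Sum>j\<in>UNIV. if i = j then 0 else ?w $ i * ?w $ j))"
    by (simp add: eq_neg_iff_add_eq_0 flip: distrib_left)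
  also have "\<dots> = - (\<Sum>i\<in>UNIV. \<Sum>j\<in>UNIV. if i = j then 0 else m $ i * m $ j * (\<beta> * ?p $ i * ?p $ j))"
    unfolding sum_distrib_left by (intro arg_cong[where f = uminus] sum.cong refl) (simp add: weighted_def mult_ac)
  finally have *: "\<beta> * (?w \<bullet> ?w) =
      - (\<Sum>i\<in>UNIV. \<Sum>j\<in>UNIV. if i = j then 0 else m $ i * m $ j * (\<beta> * ?p $ i * ?p $ j))" .
  have "\<bar>\<beta>\<bar> * (?w \<bullet> ?w) = \<bar>\<beta> * (?w \<bullet> ?w)\<bar>"
    by (simp add: abs_mult)
  also have "\<dots> = \<bar>\<Sum>i\<in>UNIV. \<Sum>j\<in>UNIV. if i = j then 0 else m $ i * m $ j * (\<beta> * ?p $ i * ?p $ j)\<bar>"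
    unfolding * by (rule abs_minus_cancel)
  also have "\<dots> \<le> (\<Sum>i\<in>UNIV. \<bar>\<Sum>j\<in>UNIV. if i = j then 0 else m $ i * m $ j * (\<beta> * ?p $ i * ?p $ j)\<bar>)"
    by (rule sum_abs)
  also have "\<dots> \<le> (\<Sum>i\<in>UNIV. \<Sum>j\<in>UNIV. \<bar>if i = j then 0 else m $ i * m $ j * (\<beta> * ?p $ i * ?p $ j)\<bar>)"
    by (intro sum_mono sum_abs)
  also have "\<dots> \<le> (\<Sum>i\<in>UNIV. \<Sum>j\<in>UNIV. m $ i * m $ j * e)"
  proof (intro sum_mono)
    fix i j
    have mm: "m $ i * m $ j \<ge> 0" using m_pos[of i] m_pos[of j] by simp
    show "\<bar>if i = j then 0 else m $ i * m $ j * (\<beta> * ?p $ i * ?p $ j)\<bar> \<le> m $ i * m $ j * e"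
    proof (cases "i = j")
      case False
      have "\<bar>m $ i * m $ j * (\<beta> * ?p $ i * ?p $ j)\<bar> = m $ i * m $ j * \<bar>\<beta> * ?p $ i * ?p $ j\<bar>"
        using mm by (simp only: abs_mult[of "m $ i * m $ j"] abs_of_nonneg)
      also have "\<dots> \<le> m $ i * m $ j * e"
        by (rule mult_left_mono[OF off[OF False] mm])
      finally show ?thesis using False by simp
    qed (use mm e in simp)
  qed
  also have "\<dots> = e * (\<Sum>i\<in>UNIV. m $ i)\<^sup>2"
    by (simp add: power2_eq_square sum_product) (simp add: sum_distrib_left mult_ac)
  finally have "\<bar>\<beta>\<bar> * (?w \<bullet> ?w) \<le> e * (\<Sum>i\<in>UNIV. m $ i)\<^sup>2" .
  moreover have "\<bar>\<beta>\<bar> * L k \<le> \<bar>\<beta>\<bar> * (?w \<bullet> ?w)"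
    using Lk by (intro mult_left_mono) auto
  ultimately show ?thesis by linarith
qed

text \<open>Normalising the largest coordinate to one puts every direction into one of the three
  charts.\<close>

lemma normalise_direction:
  assumes "p \<noteq> 0" "weighted m p \<in> codisp"
  obtains k a c where "a \<in> chart k" "c \<noteq> 0" "p = c *\<^sub>R dir a"
proof -
  obtain b where b: "p = dir b" by (rule dir_surj[OF assms(2)])
  obtain k where k: "\<And>l. \<bar>b $ l\<bar> \<le> \<bar>b $ k\<bar>"
  proof -
    have "Max (range (\<lambda>l. \<bar>b $ l\<bar>)) \<in> range (\<lambda>l. \<bar>b $ l\<bar>)" by (intro Max_in) auto
    then obtain k where "Max (range (\<lambda>l. \<bar>b $ l\<bar>)) = \<bar>b $ k\<bar>" by (rule rangeE)
    then show thesis using that Max_ge[of "range (\<lambda>l. \<bar>b $ l\<bar>)"] by (metis finite_class.finite_UNIV finite_imageI rangeI)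
  qed
  have bk: "b $ k \<noteq> 0"
  proof
    assume "b $ k = 0"
    then have "b = 0" using k by (simp add: vec_eq_iff)
    then show False using assms(1) b by (simp add: dir_def)
  qed
  show thesis
  proof (rule that[of "(1 / b $ k) *\<^sub>R b" k "b $ k"])
    show "(1 / b $ k) *\<^sub>R b \<in> chart k"
      using k bk by (simp add: chart_def cube_def abs_divide)
    show "p = b $ k *\<^sub>R dir ((1 / b $ k) *\<^sub>R b)"
      using bk by (simp add: dir_scale b)
  qed (rule bk)
qed

end

lemma shape_rescale: "shape \<beta> (c *\<^sub>R p) = shape (\<beta> * c\<^sup>2) p"
  by (simp add: fun_eq_iff shape_def power2_eq_square mult_ac)

lemma eigen_direction_rescale:
  assumes "eigen_direction s m (c *\<^sub>R p)" "c \<noteq> 0"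
  shows "eigen_direction s m p"
proof -
  obtain l d where "\<And>i. (\<Sum>j\<in>UNIV. s i j * (m $ j * (c *\<^sub>R p) $ j)) = l * (c *\<^sub>R p) $ i + d"
    using assms(1) unfolding eigen_direction_def by blast
  then have "c * (\<Sum>j\<in>UNIV. s i j * (m $ j * p $ j)) = c * (l * p $ i + d / c)" for i
    using assms(2) by (simp add: sum_distrib_left algebra_simps)
  then have "(\<Sum>j\<in>UNIV. s i j * (m $ j * p $ j)) = l * p $ i + d / c" for i
    using assms(2) by simp
  then show ?thesis unfolding eigen_direction_def by blast
qed

text \<open>The neighbourhood of the regular shapes used for uniqueness.\<close>

lemma open_nearly_regular:
  "open {x :: real^3^4. \<forall>i j k l. i \<noteq> j \<longrightarrow> k \<noteq> l \<longrightarrow> sq_dist x i j < q * sq_dist x k l}"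
proof -
  have "{x :: real^3^4. \<forall>i j k l. i \<noteq> j \<longrightarrow> k \<noteq> l \<longrightarrow> sq_dist x i j < q * sq_dist x k l} =
     (\<Inter>i. \<Inter>j. \<Inter>k. \<Inter>l. {x. i \<noteq> j \<longrightarrow> k \<noteq> l \<longrightarrow> sq_dist x i j < q * sq_dist x k l})"
    by auto
  moreover have "open {x :: real^3^4. i \<noteq> j \<longrightarrow> k \<noteq> l \<longrightarrow> sq_dist x i j < q * sq_dist x k l}" for i j k l
  proof (cases "i \<noteq> j \<and> k \<noteq> l")
    case True
    have "open {x :: real^3^4. sq_dist x i j < q * sq_dist x k l}"
      unfolding sq_dist_def by (intro open_Collect_less continuous_intros)
    then show ?thesis using True by simp
  qed auto
  ultimately show ?thesis by (simp only:) (intro open_INT ballI finite_class.finite_UNIV)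
qed

theorem three_families_generic:
  fixes T :: "real^3^4"
  assumes G: "G > 0" and m: "\<And>i. m $ i > 0" and T: "regular_tetrahedron T"
    and no3: "\<not> (\<exists>i j k. i \<noteq> j \<and> j \<noteq> k \<and> i \<noteq> k \<and> m $ i = m $ j \<and> m $ j = m $ k)"
  shows "\<exists>\<gamma>. distinct_families G m T 3 \<gamma> \<and>
         (\<exists>U. open U \<and> T \<in> U \<and>
           (\<forall>x\<in>U. balanced_RE4 G m x \<longrightarrow>
             (\<exists>k<3. \<exists>t\<in>{-1..1}. similar_config (\<gamma> k t) x)))"
proof -
  obtain v L where "inertia_frame m v L"
    by (rule inertia_frame_exists[OF m no3])
  then interpret inertia_frame m v L .
  define idx :: "nat \<Rightarrow> 3" where "idx k = (if k = 0 then 1 else if k = 1 then 2 else 3)" for k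
  have idx_inj: "k < 3 \<Longrightarrow> l < 3 \<Longrightarrow> idx k = idx l \<Longrightarrow> k = l" for k l
    by (auto simp: idx_def split: if_splits)
  have idx_surj: "\<exists>k<3. idx k = l" for l
  proof -
    have "\<exists>k<3. idx k = 1" "\<exists>k<3. idx k = 2" "\<exists>k<3. idx k = 3"
      by (rule exI[of _ 0], simp add: idx_def) (rule exI[of _ 1], simp add: idx_def, rule exI[of _ 2], simp add: idx_def)
    then have "\<forall>l. \<exists>k<3. idx k = l" unfolding forall_3 by blast
    then show ?thesis by blast
  qed
  let ?I = "{-1..1::real}"
  have in_radius: "\<bar>radius * t\<bar> \<le> radius" if "t \<in> ?I" for t
    using that radius_pos by (auto simp: abs_mult abs_le_iff)
  define p where "p k t = dir (branch (idx k) (radius * t))" for k t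
  have coord: "weighted m (v l) \<bullet> p k t = branch (idx k) (radius * t) $ l" for k l t
    by (simp add: p_def coord_dir)
  have one: "weighted m (v (idx k)) \<bullet> p k t = 1" if "t \<in> ?I" for k t
    by (simp add: coord branch_one[OF in_radius[OF that]])
  obtain \<gamma> \<kappa> where fam: "distinct_families G m T 3 \<gamma>"
    and sp: "\<And>k t. k < 3 \<Longrightarrow> t \<in> ?I \<Longrightarrow> spatial (\<gamma> k t)" and \<kappa>: "\<And>k. k < 3 \<Longrightarrow> \<kappa> k > 0"
    and sq: "\<And>k t i j. k < 3 \<Longrightarrow> t \<in> ?I \<Longrightarrow> sq_dist (\<gamma> k t) i j = \<kappa> k * shape (radius * t) (p k t) i j"
  proof (rule distinct_families_of_directions[OF G m T, where n = 3 and p = p and \<delta> = radius])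
    show "continuous_on ?I (p k)" for k
      unfolding p_def
    proof (intro dir_continuous continuous_on_compose2[OF branch_continuous] continuous_intros image_subsetI)
      show "radius * t \<in> {- radius..radius}" if "t \<in> ?I" for t
        using in_radius[OF that] unfolding abs_le_iff by auto
    qed
    fix k l t u assume k: "k < (3::nat)" and t: "t \<in> ?I"
    show "p k t \<noteq> 0 \<and> weighted m (p k t) \<in> codisp \<and> eigen_direction (shape (radius * t) (p k t)) m (p k t)"
      unfolding p_def
      using branch_eigen[OF in_radius[OF t]] dir_nonzero[OF branch_one[OF in_radius[OF t]]] weighted_dir_codisp
      by blast
    have "branch (idx k) (radius * t) \<in> cube"
      using branch_fixed(1)[OF in_radius[OF t], of "idx k"] by (simp add: chart_def)
    from dir_product_small[OF this radius_small(1)[OF in_radius[OF t]]]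
    show "\<bar>radius * t * p k t $ i * p k t $ j\<bar> \<le> 1 / 1000" for i j
      by (simp add: p_def mult.assoc)
    assume u: "u \<in> ?I"
    show "t = u" if "\<And>i j. radius * t * p k t $ i * p k t $ j = radius * u * p k u $ i * p k u $ j"
      using quadratic_eq_pairing[OF that, of "weighted m (v (idx k))" "weighted m (v (idx k))"] radius_pos
      by (simp add: one[OF t] one[OF u])
    assume l: "l < 3" and kl: "k \<noteq> l"
    show "t = 0 \<and> u = 0" if eq: "\<And>i j. radius * t * p k t $ i * p k t $ j = radius * u * p l u $ i * p l u $ j"
    proof -
      have ne: "idx k \<noteq> idx l" using idx_inj k l kl by blast
      let ?a = "branch (idx k) (radius * t) $ idx l" and ?b = "branch (idx l) (radius * u) $ idx k"
      (* pair the quadratic data with the two coordinates normalised on the two branches *)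
      have "radius * t = radius * u * ?b * ?b" "radius * t * ?a * ?a = radius * u"
        using quadratic_eq_pairing[OF eq, of "weighted m (v (idx k))" "weighted m (v (idx k))"]
          quadratic_eq_pairing[OF eq, of "weighted m (v (idx l))" "weighted m (v (idx l))"]
        by (simp_all add: one[OF t] one[OF u], simp_all add: coord)
      then have tu: "t = u * (?b * ?b)" "u = t * (?a * ?a)"
        using radius_pos by (simp_all add: mult.assoc)
      have half: "\<bar>?a\<bar> \<le> 1 / 2" "\<bar>?b\<bar> \<le> 1 / 2"
        using branch_half[OF in_radius[OF t]] branch_half[OF in_radius[OF u]] ne by (metis, metis)
      have "\<bar>?a * ?a\<bar> \<le> 1 / 4" "\<bar>?b * ?b\<bar> \<le> 1 / 4"
        using mult_mono[OF half(1) half(1)] mult_mono[OF half(2) half(2)] by (simp_all add: abs_mult)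
      then have "\<bar>t\<bar> \<le> \<bar>u\<bar> * (1 / 4)" "\<bar>u\<bar> \<le> \<bar>t\<bar> * (1 / 4)"
        by (subst tu(1), simp only: abs_mult, intro mult_left_mono, simp_all only: abs_mult abs_ge_zero)
           (subst tu(2), simp only: abs_mult, intro mult_left_mono, simp_all only: abs_mult abs_ge_zero)
      then show ?thesis by linarith
    qed
  qed blast
  define M where "M = (\<Sum>i\<in>UNIV. m $ i)"
  define Lmin where "Lmin = Min (range L)"
  have M: "M > 0" unfolding M_def using m by (intro sum_pos) auto
  have Lmin: "Lmin > 0" "Lmin \<le> L l" for l
    unfolding Lmin_def using L_pos by auto
  (* off-diagonal entries below e force the normalised parameter into the range of the branches *)
  define e where "e = radius * Lmin / M\<^sup>2"
  have e: "e > 0" using radius_pos Lmin M by (simp add: e_def)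
  define h where "h = min (1 / 8) (e / 3)"
  have h: "h > 0" "h \<le> 1 / 8" "3 * h \<le> e" using e by (auto simp: h_def)
  define q where "q = 1 + h"
  have q: "q\<^sup>2 - 1 \<le> e"
  proof -
    have "h * h \<le> h * 1" using h by (intro mult_left_mono) auto
    moreover have "q\<^sup>2 - 1 = 2 * h + h * h" by (simp add: q_def power2_eq_square algebra_simps)
    ultimately show ?thesis using h(1,3) by linarith
  qed
  define U where "U = {x :: real^3^4. \<forall>i j k l. i \<noteq> j \<longrightarrow> k \<noteq> l \<longrightarrow> sq_dist x i j < q * sq_dist x k l}"
  have "open U" unfolding U_def by (rule open_nearly_regular)
  moreover have "T \<in> U"
  proof -
    obtain d where d: "d > 0" "\<And>i j. i \<noteq> j \<Longrightarrow> dist (T $ i) (T $ j) = d"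
      using T unfolding regular_tetrahedron_def by blast
    then show ?thesis using h by (simp add: U_def sq_dist_def q_def)
  qed
  moreover have "\<exists>k<3. \<exists>t\<in>?I. similar_config (\<gamma> k t) x" if xU: "x \<in> U" and bal: "balanced_RE4 G m x" for x
  proof -
    have nc: "noncollision x" and RE: "admits_relative_equilibrium_R4 G m x"
      using bal by (auto simp: balanced_RE4_def)
    have ratio: "sq_dist x i j \<le> q * sq_dist x k l" if "i \<noteq> j" "k \<noteq> l" for i j k l
      using xU that by (auto simp: U_def less_imp_le)
    let ?s = "sq_dist x 1 2"
    have s: "?s > 0" using nc by (simp add: noncollision_iff_sq_dist)
    have "spatial x"
      unfolding spatial_def
    proof (intro ballI impI)
      fix \<xi> :: "real^4" assume \<xi>: "\<xi> \<in> codisp" "config_map x \<xi> = 0"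
      show "\<xi> = 0"
      proof (rule nearly_regular_inj[OF s _ \<xi>])
        fix i j :: 4 assume ij: "i \<noteq> j"
        have up: "sq_dist x i j \<le> ?s + h * ?s" "?s \<le> sq_dist x i j + h * sq_dist x i j"
          using ratio[OF ij, of 1 2] ratio[of 1 2, OF _ ij] by (simp_all add: q_def algebra_simps)
        have "h * ?s \<le> 1 / 8 * ?s" "h * sq_dist x i j \<le> 1 / 8 * sq_dist x i j"
          by (rule mult_right_mono[OF h(2)], simp add: sq_dist_def)+
        with up show "\<bar>sq_dist x i j - ?s\<bar> \<le> ?s / 8"
          unfolding abs_le_iff by (intro conjI; linarith)
      qed
    qed
    then obtain \<kappa>' \<beta> r where \<kappa>': "\<kappa>' > 0" and sqx: "\<And>i j. sq_dist x i j = \<kappa>' * shape \<beta> r i j"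
      and off: "\<And>i j. i \<noteq> j \<Longrightarrow> \<bar>\<beta> * r $ i * r $ j\<bar> \<le> q\<^sup>2 - 1"
      and r: "\<beta> \<noteq> 0 \<Longrightarrow> r \<noteq> 0 \<and> weighted m r \<in> codisp \<and> eigen_direction (shape \<beta> r) m r"
      using shape_of_relative_equilibrium[OF G m _ nc RE ratio] by metis
    have "\<exists>k<3. \<exists>t\<in>?I. shape \<beta> r = shape (radius * t) (p k t)"
    proof (cases "\<beta> = 0")
      case True
      then have "shape \<beta> r = shape (radius * 0) (p 0 0)"
        by (simp add: shape_def fun_eq_iff)
      then show ?thesis by (intro exI[of _ 0] conjI bexI[of _ 0]) auto
    next
      case False
      note r = r[OF False]
      obtain k' a c where a: "a \<in> chart k'" and c: "c \<noteq> 0" and ra: "r = c *\<^sub>R dir a"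
        using normalise_direction r by metis
      obtain k where k: "k < 3" "idx k = k'" using idx_surj by blast
      define b where "b = \<beta> * c\<^sup>2"
      have sh: "shape \<beta> r = shape b (dir a)"
        unfolding ra b_def by (rule shape_rescale)
      have a1: "a $ k' = 1" using a by (simp add: chart_def)
      have "\<bar>b * dir a $ i * dir a $ j\<bar> \<le> e" if "i \<noteq> j" for i j
      proof -
        have "b * dir a $ i * dir a $ j = \<beta> * r $ i * r $ j"
          by (simp add: b_def ra power2_eq_square mult_ac)
        then show ?thesis using off[OF that] q by simp
      qed
      then have "\<bar>b\<bar> * L k' \<le> e * M\<^sup>2"
        unfolding M_def using e a1 by (intro off_diagonal_bound) auto
      also have "\<dots> = radius * Lmin" using M by (simp add: e_def)
      also have "\<dots> \<le> radius * L k'"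
        using radius_pos Lmin(2) by (intro mult_left_mono) auto
      finally have b: "\<bar>b\<bar> \<le> radius" using L_pos[of k'] by simp
      have "eigen_direction (shape b (dir a)) m (dir a)"
        using r c unfolding sh[symmetric] ra by (blast intro: eigen_direction_rescale)
      then have "a = branch k' b" by (rule branch_unique[OF b a])
      moreover have "radius * (b / radius) = b" using radius_pos by simp
      ultimately have "shape \<beta> r = shape (radius * (b / radius)) (p k (b / radius))"
        by (simp only: sh p_def k(2))
      moreover have "b / radius \<in> ?I"
        using b radius_pos by (auto simp: field_simps abs_le_iff)
      ultimately show ?thesis using k(1) by blast
    qed
    then obtain k t where k: "k < 3" and t: "t \<in> ?I" and sh: "shape \<beta> r = shape (radius * t) (p k t)"
      by blast
    have "similar_config (\<gamma> k t) x"
    proof (rule similar_config_of_sq_dist[OF sp[OF k t], of "\<kappa>' / \<kappa> k"])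
      show "0 < \<kappa>' / \<kappa> k" using \<kappa>' \<kappa>[OF k] by simp
      show "sq_dist x i j = \<kappa>' / \<kappa> k * sq_dist (\<gamma> k t) i j" for i j
        using \<kappa>[OF k] by (simp add: sqx sq[OF k t] sh)
    qed
    then show ?thesis using k t by blast
  qed
  ultimately show ?thesis using fam by blast
qed

theorem mainTheorem1:
  fixes G :: real and m :: "real^4" and T :: "real^3^4"
  assumes "G > 0"
    and "\<And>i. m $ i > 0"
    and "regular_tetrahedron T"
  shows "(\<exists>\<gamma>. distinct_families G m T 3 \<gamma>) \<and>
     (\<not> (\<exists>i j k. i \<noteq> j \<and> j \<noteq> k \<and> i \<noteq> k \<and> m $ i = m $ j \<and> m $ j = m $ k) \<longrightarrow>
       (\<exists>\<gamma>. distinct_families G m T 3 \<gamma> \<and>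
         (\<exists>U. open U \<and> T \<in> U \<and>
           (\<forall>x\<in>U. balanced_RE4 G m x \<longrightarrow>
             (\<exists>k<3. \<exists>t\<in>{-1..1}. similar_config (\<gamma> k t) x)))))"
proof (cases "\<exists>i j k. i \<noteq> j \<and> j \<noteq> k \<and> i \<noteq> k \<and> m $ i = m $ j \<and> m $ j = m $ k")
  case True
  then show ?thesis
    using three_families_equal_masses[OF assms] by blast
next
  case False
  show ?thesis
    using three_families_generic[OF assms False] by blast
qed

end
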